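(* Let $G$ be a connected real reductive linear group, and let $G = KAN$ be an Iwasawa decomposition. Then any unipotent subgroup $U$ of $G$ is conjugate in $G$ to a subgroup of $N$. In particular, all maximal unipotent subgroups of $G$ are conjugate in $G$.
   Context: "Linear" means that $G$ is a subgroup of some $\mathrm{GL}(n,\mathbb{R})$; "real reductive" is used in its usual sense for Lie groups. A unipotent subgroup means a connected subgroup consisting of unipotent matrices. A maximal unipotent subgroup of $G$ is one that is maximal under inclusion among the unipotent subgroups of $G$. Iwasawa decomposition is the standard notion: for a Cartan involution $\theta$ of $G$ with fixed point group $K$, let $\mathrm{Lie}(G) = \mathfrak{k} \oplus \mathfrak{p}$ be the decomposition into the $+1$ and $-1$ eigenspaces of the differential of $\theta$, let $\mathfrak{a} \subset \mathfrak{p}$ be a maximal abelian subspace, and let $\mathfrak{n}$ be the sum of the restricted root spaces for a choice of positive restricted roots of $\mathfrak{a}$ in $\mathrm{Lie}(G)$. Then $A$ and $N$ are the connected Lie subgroups of $G$ with Lie algebras $\mathfrak{a}$ and $\mathfrak{n}$, and $G = KAN$. *)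

theory Defs
  imports "HOL-Analysis.Analysis" "HOL-Algebra.Generated_Groups"
begin

section \<open>Real matrix groups and their Lie algebras\<close>

definition GL :: "(real^'n^'n) monoid" where
  "GL = \<lparr>carrier = {A. invertible A}, mult = (**), one = mat 1\<rparr>"

definition matpow :: "real^'n^'n \<Rightarrow> nat \<Rightarrow> real^'n^'n" where
  "matpow A k = (((**) A) ^^ k) (mat 1)"

text \<open>The library has no exponential on square matrices, since they do not form an instance of
  the class of normed algebras.\<close>

definition mexp :: "real^'n^'n \<Rightarrow> real^'n^'n" where
  "mexp A = (\<Sum>k. (1 / fact k) *\<^sub>R matpow A k)"

definition conj_by :: "real^'n^'n \<Rightarrow> real^'n^'n \<Rightarrow> real^'n^'n" where
  "conj_by g x = g ** x ** matrix_inv g"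

definition bracket :: "real^'n^'n \<Rightarrow> real^'n^'n \<Rightarrow> real^'n^'n" where
  "bracket X Y = X ** Y - Y ** X"

text \<open>The Lie algebra of a closed subgroup of the general linear group.\<close>

definition lie_algebra :: "(real^'n^'n) set \<Rightarrow> (real^'n^'n) set" where
  "lie_algebra G = {X. \<forall>t::real. mexp (t *\<^sub>R X) \<in> G}"

text \<open>The connected Lie subgroup with Lie algebra \<open>\<h>\<close> is the group generated by \<open>exp \<h>\<close>. It need
  not be closed a priori.\<close>

definition connected_lie_subgroup :: "(real^'n^'n) set \<Rightarrow> (real^'n^'n) set" where
  "connected_lie_subgroup \<h> = generate GL (mexp ` \<h>)"

text \<open>The differential at the identity of a homomorphism between matrix groups; a continuous
  homomorphism of Lie groups is automatically smooth.\<close>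

definition differential :: "(real^'n^'n \<Rightarrow> real^'n^'n) \<Rightarrow> real^'n^'n \<Rightarrow> real^'n^'n" where
  "differential \<theta> X = vector_derivative (\<lambda>t. \<theta> (mexp (t *\<^sub>R X))) (at 0)"


section \<open>Reductive groups and Cartan involutions\<close>

text \<open>A linear connected real reductive group is a connected closed subgroup of the general linear
  group that is stable under transpose, after a suitable choice of basis (equivalently, that is
  stable under taking adjoints for a suitable inner product). The reductive structure has to be
  compatible with the embedding: the group of upper triangular unipotent 2 by 2 matrices is
  isomorphic to the additive group of the reals, hence has a reductive Lie algebra, but must not
  be counted as reductive here.\<close>

definition connected_reductive_linear_group :: "(real^'n^'n) set \<Rightarrow> bool" where
  "connected_reductive_linear_group G \<longleftrightarrow>
     subgroup G GL \<and>
     closedin (top_of_set (carrier GL)) G \<and>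
     connected G \<and>
     (\<exists>P. invertible P \<and> (\<forall>h \<in> conj_by P ` G. transpose h \<in> conj_by P ` G))"

definition fixed_group :: "(real^'n^'n) set \<Rightarrow> (real^'n^'n \<Rightarrow> real^'n^'n) \<Rightarrow> (real^'n^'n) set" where
  "fixed_group G \<theta> = {g \<in> G. \<theta> g = g}"

definition eigenspace_plus :: "(real^'n^'n) set \<Rightarrow> (real^'n^'n \<Rightarrow> real^'n^'n) \<Rightarrow> (real^'n^'n) set" where
  "eigenspace_plus G \<theta> = {X \<in> lie_algebra G. differential \<theta> X = X}"

definition eigenspace_minus :: "(real^'n^'n) set \<Rightarrow> (real^'n^'n \<Rightarrow> real^'n^'n) \<Rightarrow> (real^'n^'n) set" where
  "eigenspace_minus G \<theta> = {X \<in> lie_algebra G. differential \<theta> X = - X}"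

text \<open>The form \<open>B\<close> plays the role of the Killing form, which is degenerate as soon as the centre has
  positive dimension: it is an invariant form for which
  \<open>B\<^sub>\<theta>(X, Y) = - B(X, \<theta> Y)\<close> is an inner product on the Lie algebra. Only its values on the Lie algebra
  matter. The last condition is the global Cartan decomposition \<open>G = K exp \<p>\<close>; together with the
  compactness of \<open>K\<close> it determines how \<open>\<theta>\<close> acts on the centre and on compact factors.\<close>

definition cartan_involution :: "(real^'n^'n) set \<Rightarrow> (real^'n^'n \<Rightarrow> real^'n^'n) \<Rightarrow> bool" where
  "cartan_involution G \<theta> \<longleftrightarrow>
     \<theta> \<in> iso (GL\<lparr>carrier := G\<rparr>) (GL\<lparr>carrier := G\<rparr>) \<and>
     continuous_on G \<theta> \<and>
     (\<forall>g \<in> G. \<theta> (\<theta> g) = g) \<and>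
     compact (fixed_group G \<theta>) \<and>
     (\<exists>B :: real^'n^'n \<Rightarrow> real^'n^'n \<Rightarrow> real.
        bilinear B \<and>
        (\<forall>X \<in> lie_algebra G. \<forall>Y \<in> lie_algebra G. B X Y = B Y X) \<and>
        (\<forall>g \<in> G. \<forall>X \<in> lie_algebra G. \<forall>Y \<in> lie_algebra G. B (conj_by g X) (conj_by g Y) = B X Y) \<and>
        (\<forall>X \<in> lie_algebra G. \<forall>Y \<in> lie_algebra G.
           B (differential \<theta> X) (differential \<theta> Y) = B X Y) \<and>
        (\<forall>X \<in> lie_algebra G. X \<noteq> 0 \<longrightarrow> - B X (differential \<theta> X) > 0)) \<and>
     bij_betw (\<lambda>(k, X). k ** mexp X) (fixed_group G \<theta> \<times> eigenspace_minus G \<theta>) G"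


section \<open>Iwasawa decompositions\<close>

definition abelian_subspace :: "(real^'n^'n) set \<Rightarrow> (real^'n^'n) set \<Rightarrow> bool" where
  "abelian_subspace \<a> \<p> \<longleftrightarrow>
     subspace \<a> \<and> \<a> \<subseteq> \<p> \<and> (\<forall>X \<in> \<a>. \<forall>Y \<in> \<a>. bracket X Y = 0)"

definition maximal_abelian_subspace :: "(real^'n^'n) set \<Rightarrow> (real^'n^'n) set \<Rightarrow> bool" where
  "maximal_abelian_subspace \<a> \<p> \<longleftrightarrow>
     abelian_subspace \<a> \<p> \<and> (\<forall>\<b>. abelian_subspace \<b> \<p> \<and> \<a> \<subseteq> \<b> \<longrightarrow> \<b> = \<a>)"

text \<open>A linear functional on the subspace \<open>\<a>\<close> is represented by the function on all matrices that
  agrees with it on \<open>\<a>\<close> and vanishes outside \<open>\<a>\<close>, so that distinct representatives are distinct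
  functionals and sums and negatives can be formed pointwise.\<close>

definition dual_space :: "(real^'n^'n) set \<Rightarrow> (real^'n^'n \<Rightarrow> real) set" where
  "dual_space \<a> = {\<alpha>. \<exists>f. linear f \<and> \<alpha> = (\<lambda>H. if H \<in> \<a> then f H else 0)}"

definition root_space ::
  "(real^'n^'n) set \<Rightarrow> (real^'n^'n) set \<Rightarrow> (real^'n^'n \<Rightarrow> real) \<Rightarrow> (real^'n^'n) set" where
  "root_space \<g> \<a> \<alpha> = {X \<in> \<g>. \<forall>H \<in> \<a>. bracket H X = \<alpha> H *\<^sub>R X}"

definition restricted_roots ::
  "(real^'n^'n) set \<Rightarrow> (real^'n^'n) set \<Rightarrow> (real^'n^'n \<Rightarrow> real) set" where
  "restricted_roots \<g> \<a> = {\<alpha> \<in> dual_space \<a>. \<alpha> \<noteq> (\<lambda>_. 0) \<and> root_space \<g> \<a> \<alpha> \<noteq> {0}}"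

definition positive_system :: "(real^'n^'n \<Rightarrow> real) set \<Rightarrow> (real^'n^'n \<Rightarrow> real) set \<Rightarrow> bool" where
  "positive_system \<Sigma> P \<longleftrightarrow>
     P \<subseteq> \<Sigma> \<and>
     (\<forall>\<alpha> \<in> \<Sigma>. (\<alpha> \<in> P) \<noteq> ((\<lambda>H. - \<alpha> H) \<in> P)) \<and>
     (\<forall>\<alpha> \<in> P. \<forall>\<beta> \<in> P. (\<lambda>H. \<alpha> H + \<beta> H) \<in> \<Sigma> \<longrightarrow> (\<lambda>H. \<alpha> H + \<beta> H) \<in> P)"

definition iwasawa_decomposition ::
  "(real^'n^'n) set \<Rightarrow> (real^'n^'n) set \<Rightarrow> (real^'n^'n) set \<Rightarrow> (real^'n^'n) set \<Rightarrow> bool" where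
  "iwasawa_decomposition G K A N \<longleftrightarrow>
     (\<exists>\<theta> \<a> P.
        cartan_involution G \<theta> \<and>
        K = fixed_group G \<theta> \<and>
        maximal_abelian_subspace \<a> (eigenspace_minus G \<theta>) \<and>
        positive_system (restricted_roots (lie_algebra G) \<a>) P \<and>
        A = connected_lie_subgroup \<a> \<and>
        N = connected_lie_subgroup (span (\<Union>\<alpha>\<in>P. root_space (lie_algebra G) \<a> \<alpha>)) \<and>
        G = K <#>\<^bsub>GL\<^esub> A <#>\<^bsub>GL\<^esub> N)"


section \<open>Unipotent subgroups\<close>

definition unipotent :: "real^'n^'n \<Rightarrow> bool" where
  "unipotent u \<longleftrightarrow> (\<exists>k. matpow (u - mat 1) k = 0)"

definition unipotent_subgroup :: "(real^'n^'n) set \<Rightarrow> (real^'n^'n) set \<Rightarrow> bool" where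
  "unipotent_subgroup U G \<longleftrightarrow>
     subgroup U GL \<and> U \<subseteq> G \<and> connected U \<and> (\<forall>u \<in> U. unipotent u)"

definition maximal_unipotent_subgroup :: "(real^'n^'n) set \<Rightarrow> (real^'n^'n) set \<Rightarrow> bool" where
  "maximal_unipotent_subgroup U G \<longleftrightarrow>
     unipotent_subgroup U G \<and> (\<forall>V. unipotent_subgroup V G \<and> U \<subseteq> V \<longrightarrow> V = U)"

end

(* Fix the Cartan involution theta, the maximal abelian subspace a and the positive system defining n.
   The cone of matrices contained in some Ad(k)n, k in K, is closed because K is compact, and it is
   invariant under U because A N normalises n and G = K A N. By Kolchin's theorem U lowers a
   filtration of the space of matrices, so rescaled limits of u^j X produce U-fixed vectors of
   invariant closed cones; applied modulo a maximal U-invariant subspace this yields a k for which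
   k U k^-1 normalises n.

   It remains to see that a unipotent u in G normalising n lies in N. Write u = k a n. Then k normalises
   n, hence a, and since Ad u is unipotent and Ad k is orthogonal, k centralises a. Contracting N by
   exp(-tH), with H in a positive on all positive roots, shows that k a is unipotent. A vector of a
   root space fixed by k a forces the root to vanish at log a, so Ad a = 1, and Ad k, being orthogonal
   and unipotent, is also 1. Finally k a is a central unipotent element of G; in suitable coordinates
   its transpose also lies in G, so it is a normal unipotent matrix, that is, the identity. *)

theory Submission
  imports Defs
begin

section \<open>Square matrices as a Banach algebra\<close>

text \<open>The first half is a form of Borel's fixed point theorem for the compact family of
  conjugates of \<n>, but no algebraic structure is at hand and \<open>U\<close> is not assumed
  closed. The substitute is linear. Let W be of largest dimension among the U-invariant subspaces
  contained in a conjugate of \<n>, and consider the conjugates that contain W. Modulo W, u^j X is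
  polynomial in j, and its leading coefficient is a point of their union lying deeper in the
  filtration. So a deepest point outside W is fixed modulo W and could be adjoined to W; hence there
  is none, and W is a whole conjugate of \<n>.

  Two features of the data shape the second half. The inner product built from \<theta> lives on the
  Lie algebra and controls an element only through Ad, that is, up to the centre; the centre is
  settled by the transpose of the embedding. And the positive system is given by combinatorial
  axioms, so an H positive on it has to be constructed: it is the vector dual to the trace of ad on
  \<n>.\<close>

lemma matrix_mult_scaleR_left: "(c *\<^sub>R A) ** B = c *\<^sub>R (A ** B)" for A B :: "real^'n^'n"
  by (simp add: matrix_matrix_mult_def vec_eq_iff sum_distrib_left mult.assoc)

lemma matrix_mult_scaleR_right: "A ** (c *\<^sub>R B) = c *\<^sub>R (A ** B)" for A B :: "real^'n^'n"
  by (simp add: matrix_matrix_mult_def vec_eq_iff sum_distrib_left mult.left_commute)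

lemma matrix_mult_diff_right: "A ** (B - C) = A ** B - A ** C" for A B C :: "real^'n^'n"
  by (simp add: matrix_matrix_mult_def vec_eq_iff right_diff_distrib sum_subtractf)

lemma matrix_mult_diff_left: "(A - B) ** C = A ** C - B ** C" for A B C :: "real^'n^'n"
  by (simp add: matrix_matrix_mult_def vec_eq_iff left_diff_distrib sum_subtractf)

lemma matrix_mult_zero_left [simp]: "0 ** B = 0" for B :: "real^'n^'n"
  by (simp add: matrix_matrix_mult_def vec_eq_iff)

lemma matrix_mult_zero_right [simp]: "B ** 0 = 0" for B :: "real^'n^'n"
  by (simp add: matrix_matrix_mult_def vec_eq_iff)

lemma matrix_mult_minus_left [simp]: "(- A) ** B = - (A ** B)" for A B :: "real^'n^'n"
  by (simp add: matrix_matrix_mult_def vec_eq_iff sum_negf)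

lemma matrix_mult_minus_right [simp]: "A ** (- B) = - (A ** B)" for A B :: "real^'n^'n"
  by (simp add: matrix_matrix_mult_def vec_eq_iff sum_negf)

lemma matrix_mult_add_left: "(A + B) ** C = A ** C + B ** C" for A B C :: "real^'n^'n"
  by (simp add: matrix_matrix_mult_def vec_eq_iff distrib_right sum.distrib)

lemmas matrix_mult_simps = matrix_mult_scaleR_left matrix_mult_scaleR_right matrix_mult_diff_right
  matrix_mult_diff_left matrix_add_ldistrib matrix_mult_add_left

lemma bilinear_matrix_mult: "bilinear ((**) :: real^'n^'n \<Rightarrow> real^'n^'n \<Rightarrow> real^'n^'n)"
  by (auto simp: bilinear_def linear_iff matrix_mult_simps)

interpretation matmul: bounded_bilinear "(**) :: real^'n^'n \<Rightarrow> real^'n^'n \<Rightarrow> real^'n^'n"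
  using bilinear_conv_bounded_bilinear bilinear_matrix_mult by blast

text \<open>The matrices are copied to a type normed by the operator norm, for which the unit has
  norm 1 and the norm is submultiplicative; the generic \<open>exp\<close> of a Banach algebra then
  applies and is carried back along \<open>mat_of\<close>.\<close>

typedef (overloaded) 'n sqm = "UNIV :: (real^'n^'n) set" morphisms mat_of sqm ..

declare sqm_inverse [simplified, simp] mat_of_inverse [simp]

lemma sqm_inject_iff [simp]: "sqm A = sqm B \<longleftrightarrow> A = B"
  by (simp add: sqm_inject)

instantiation sqm :: (finite) real_normed_algebra_1
begin

definition "0 = sqm 0"
definition "1 = sqm (mat 1)"
definition "x + y = sqm (mat_of x + mat_of y)"
definition "x - y = sqm (mat_of x - mat_of y)"
definition "- x = sqm (- mat_of x)"
definition "x * y = sqm (mat_of x ** mat_of y)"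
definition "c *\<^sub>R x = sqm (c *\<^sub>R mat_of x)"
definition "norm x = onorm ((*v) (mat_of x))"
definition "dist x y = norm (x - y)" for x y :: "'a sqm"
definition "uniformity = (INF e\<in>{0<..}. principal {(x :: 'a sqm, y). dist x y < e})"
definition "open U = (\<forall>x\<in>U. \<forall>\<^sub>F (x', y) in uniformity. x' = x \<longrightarrow> (y::'a sqm) \<in> U)"
definition "sgn x = inverse (norm x) *\<^sub>R x" for x :: "'a sqm"

instance
proof
  fix x y z :: "'a sqm" and a b :: real
  show "x + y + z = x + (y + z)" "x + y = y + x" "0 + x = x" "- x + x = 0" "x - y = x + - y"
    by (simp_all add: plus_sqm_def zero_sqm_def uminus_sqm_def minus_sqm_def add_ac)
  show "a *\<^sub>R (x + y) = a *\<^sub>R x + a *\<^sub>R y" "(a + b) *\<^sub>R x = a *\<^sub>R x + b *\<^sub>R x"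
    "a *\<^sub>R b *\<^sub>R x = (a * b) *\<^sub>R x" "1 *\<^sub>R x = x"
    by (simp_all add: plus_sqm_def scaleR_sqm_def algebra_simps)
  show "x * y * z = x * (y * z)" "(x + y) * z = x * z + y * z" "x * (y + z) = x * y + x * z"
     "a *\<^sub>R x * y = a *\<^sub>R (x * y)" "x * a *\<^sub>R y = a *\<^sub>R (x * y)" "1 * x = x" "x * 1 = x"
    by (simp_all add: plus_sqm_def scaleR_sqm_def times_sqm_def one_sqm_def matrix_mult_simps matrix_mul_assoc)
  have "(0::real^'a^'a) \<noteq> mat 1" by (auto simp: vec_eq_iff mat_def intro!: exI)
  then show "(0::'a sqm) \<noteq> 1" by (simp add: zero_sqm_def one_sqm_def)
  show "dist x y = norm (x - y)" "sgn x = inverse (norm x) *\<^sub>R x"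
    by (simp_all add: dist_sqm_def sgn_sqm_def)
  show "uniformity = (INF e\<in>{0<..}. principal {(x :: 'a sqm, y). dist x y < e})"
    by (rule uniformity_sqm_def)
  show "open U = (\<forall>x\<in>U. \<forall>\<^sub>F (x', y) in uniformity. x' = x \<longrightarrow> y \<in> U)" for U :: "'a sqm set"
    by (rule open_sqm_def)
  show "norm x = 0 \<longleftrightarrow> x = 0"
    using onorm_eq_0[OF matrix_vector_mul_bounded_linear, of "mat_of x"]
    by (metis norm_sqm_def zero_sqm_def mat_of_inverse sqm_inverse UNIV_I matrix_eq matrix_vector_mult_0)
  have "(*v) (mat_of x + mat_of y) = (\<lambda>v. mat_of x *v v + mat_of y *v v)"
    by (simp add: matrix_vector_mult_add_rdistrib fun_eq_iff)
  then show "norm (x + y) \<le> norm x + norm y"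
    by (simp add: norm_sqm_def plus_sqm_def onorm_triangle)
  have "(*v) (a *\<^sub>R mat_of x) = (\<lambda>v. a *\<^sub>R (mat_of x *v v))"
    by (simp add: scaleR_matrix_vector_assoc fun_eq_iff)
  then show "norm (a *\<^sub>R x) = \<bar>a\<bar> * norm x"
    by (simp add: norm_sqm_def scaleR_sqm_def onorm_scaleR)
  have "(*v) (mat_of x ** mat_of y) = (*v) (mat_of x) \<circ> (*v) (mat_of y)"
    by (simp add: matrix_vector_mul_assoc fun_eq_iff)
  then show "norm (x * y) \<le> norm x * norm y"
    by (simp add: norm_sqm_def times_sqm_def onorm_compose)
  have "(*v) (mat 1 :: real^'a^'a) = (\<lambda>v. v)" by (simp add: fun_eq_iff)
  then show "norm (1::'a sqm) = 1"
    by (simp add: norm_sqm_def one_sqm_def onorm_id)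
qed

end

lemma mat_of_simps [simp]: "mat_of 0 = 0" "mat_of 1 = mat 1" "mat_of (x + y) = mat_of x + mat_of y"
  "mat_of (x - y) = mat_of x - mat_of y" "mat_of (- x) = - mat_of x" "mat_of (x * y) = mat_of x ** mat_of y"
  "mat_of (c *\<^sub>R x) = c *\<^sub>R mat_of x"
  by (simp_all add: zero_sqm_def one_sqm_def plus_sqm_def minus_sqm_def uminus_sqm_def times_sqm_def scaleR_sqm_def)

lemma sqm_simps: "sqm 0 = 0" "sqm (mat 1) = 1" "sqm (A + B) = sqm A + sqm B"
  "sqm (A - B) = sqm A - sqm B" "sqm (- A) = - sqm A" "sqm (A ** B) = sqm A * sqm B"
  "sqm (c *\<^sub>R A) = c *\<^sub>R sqm A"
  by (simp_all add: zero_sqm_def one_sqm_def plus_sqm_def minus_sqm_def uminus_sqm_def times_sqm_def scaleR_sqm_def)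

lemma bounded_linear_sqm: "bounded_linear (sqm :: real^'n^'n \<Rightarrow> 'n::finite sqm)"
  by (subst linear_conv_bounded_linear[symmetric]) (auto simp: linear_iff sqm_simps)

text \<open>Entries are bounded by the operator norm, whence the square of the dimension as
  constant. Completeness is inherited through this bound.\<close>

lemma bounded_linear_mat_of: "bounded_linear (mat_of :: 'n::finite sqm \<Rightarrow> real^'n^'n)"
proof (rule bounded_linear_intro[where K = "real CARD('n) * real CARD('n)"])
  fix x :: "'n sqm"
  have comp: "\<bar>mat_of x $ i $ j\<bar> \<le> norm x" for i j
    unfolding norm_sqm_def by (rule matrix_component_le_onorm) 
  have "norm (mat_of x) \<le> (\<Sum>i\<in>UNIV. norm (mat_of x $ i))"
    unfolding norm_vec_def by (rule L2_set_le_sum) auto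
  also have "\<dots> \<le> (\<Sum>i\<in>(UNIV::'n set). \<Sum>j\<in>(UNIV::'n set). \<bar>mat_of x $ i $ j\<bar>)"
    by (intro sum_mono norm_le_l1_cart)
  also have "\<dots> \<le> (\<Sum>i\<in>(UNIV::'n set). \<Sum>j\<in>(UNIV::'n set). norm x)"
    by (intro sum_mono comp)
  finally show "norm (mat_of x) \<le> norm x * (real CARD('n) * real CARD('n))"
    by (simp add: mult_ac)
qed simp_all

instance sqm :: (finite) banach
proof
  fix X :: "nat \<Rightarrow> 'a sqm" assume "Cauchy X"
  then have "Cauchy (\<lambda>n. mat_of (X n))"
    by (rule bounded_linear.Cauchy[OF bounded_linear_mat_of])
  then obtain L where "(\<lambda>n. mat_of (X n)) \<longlonglongrightarrow> L" using Cauchy_convergent convergent_def by blast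
  then have "(\<lambda>n. sqm (mat_of (X n))) \<longlonglongrightarrow> sqm L"
    by (rule bounded_linear.tendsto[OF bounded_linear_sqm])
  then show "convergent X" by (auto simp: convergent_def)
qed

section \<open>The matrix exponential\<close>

lemma matpow_0 [simp]: "matpow A 0 = mat 1" and matpow_Suc: "matpow A (Suc k) = A ** matpow A k"
  by (simp_all add: matpow_def)

lemma sqm_matpow: "sqm (matpow A k) = sqm A ^ k"
  by (induction k) (simp_all add: matpow_Suc sqm_simps)

lemma matpow_eq: "matpow A k = mat_of (sqm A ^ k)"
  by (simp flip: sqm_matpow)

lemma matpow_Suc2: "matpow A (Suc k) = matpow A k ** A"
  by (simp add: matpow_eq power_Suc2 del: power_Suc)

lemma mexp_eq: "mexp A = mat_of (exp (sqm A))"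
proof -
  have "(\<lambda>k. mat_of (sqm A ^ k /\<^sub>R fact k)) sums mat_of (exp (sqm A))"
    by (rule bounded_linear.sums[OF bounded_linear_mat_of exp_converges])
  then show ?thesis unfolding mexp_def
    by (simp add: sums_iff matpow_eq divide_inverse)
qed

lemma mexp_zero [simp]: "mexp 0 = mat 1"
  by (simp add: mexp_eq sqm_simps)

lemma mexp_add_commuting: "X ** Y = Y ** X \<Longrightarrow> mexp (X + Y) = mexp X ** mexp Y"
  by (simp add: mexp_eq sqm_simps exp_add_commuting flip: sqm_simps(6) mat_of_simps(6))

lemma mexp_minus_right [simp]: "mexp X ** mexp (- X) = mat 1"
  by (subst mexp_add_commuting[symmetric]) auto

lemma mexp_minus_left [simp]: "mexp (- X) ** mexp X = mat 1"
  by (subst mexp_add_commuting[symmetric]) auto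

lemma mexp_scaleR_add: "mexp ((s + t) *\<^sub>R X) = mexp (s *\<^sub>R X) ** mexp (t *\<^sub>R X)"
  by (simp add: scaleR_left_distrib mexp_add_commuting matrix_mult_simps)

lemma mexp_scaleR_nat: "mexp (real k *\<^sub>R X) = matpow (mexp X) k"
  by (induction k) (simp_all add: matpow_Suc mexp_scaleR_add)

lemma inverse_matrix_unique:
  fixes A :: "real^'n^'n"
  assumes "A ** B = mat 1" shows "matrix_inv A = B" "invertible A" "B ** A = mat 1"
proof -
  show 1: "B ** A = mat 1" using assms matrix_left_right_inverse by blast
  then show 2: "invertible A" using assms invertible_def by blast
  then have "matrix_inv A ** A = mat 1"
    by (metis (mono_tags, lifting) invertible_def matrix_inv_def someI_ex)
  then show "matrix_inv A = B"
    by (metis assms matrix_mul_assoc matrix_mul_lid matrix_mul_rid)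
qed

lemma matrix_inv_simps:
  fixes A :: "real^'n^'n"
  assumes "invertible A" shows "A ** matrix_inv A = mat 1" "matrix_inv A ** A = mat 1"
  using assms inverse_matrix_unique unfolding invertible_def by blast+

lemma matrix_inv_mexp [simp]: "matrix_inv (mexp X) = mexp (- X)" and invertible_mexp [simp]: "invertible (mexp X)"
  using inverse_matrix_unique[OF mexp_minus_right] by auto

lemma conj_by_mexp_eq: "conj_by (mexp X) Y = mexp X ** Y ** mexp (- X)"
  by (simp add: conj_by_def)

text \<open>Powers satisfy H^k X = X L^k. Allowing two different matrices covers conjugation,
  commutation and, with L = H + c, eigenvectors of ad H at once.\<close>

lemma mexp_intertwine:
  fixes H X L :: "real^'n^'n"
  assumes "H ** X = X ** L" shows "mexp H ** X = X ** mexp L"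
proof -
  let ?h = "sqm H" and ?x = "sqm X" and ?l = "sqm L"
  have hx: "?h * ?x = ?x * ?l" using assms by (simp flip: sqm_simps)
  have pw: "?h ^ k * ?x = ?x * ?l ^ k" for k
  proof (induction k)
    case (Suc k)
    have "?h ^ Suc k * ?x = ?h * (?h ^ k * ?x)" by (simp add: mult.assoc)
    also have "\<dots> = ?x * (?l * ?l ^ k)" by (metis Suc hx mult.assoc)
    finally show ?case by simp
  qed simp
  have "(\<lambda>k. (?h ^ k /\<^sub>R fact k) * ?x) sums (exp ?h * ?x)"
    by (rule sums_mult2[OF exp_converges])
  moreover have "(\<lambda>k. ?x * (?l ^ k /\<^sub>R fact k)) sums (?x * exp ?l)"
    by (rule sums_mult[OF exp_converges])
  ultimately have "exp ?h * ?x = ?x * exp ?l"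
    by (simp add: pw sums_iff)
  then show ?thesis by (simp add: mexp_eq flip: mat_of_simps(6)) (metis mat_of_simps(6) sqm_inverse UNIV_I)
qed

lemma mexp_has_vector_derivative:
  "((\<lambda>t. mexp (t *\<^sub>R X)) has_vector_derivative mexp (t *\<^sub>R X) ** X) (at t within T)"
  using bounded_linear.has_vector_derivative[OF bounded_linear_mat_of exp_scaleR_has_vector_derivative_right[of "sqm X" t T]]
  by (simp add: mexp_eq sqm_simps)

section \<open>Norm estimates for powers and exponentials in a Banach algebra\<close>

lemma norm_power_diff_le:
  fixes a b :: "'a::real_normed_algebra_1"
  assumes "norm a \<le> C" "norm b \<le> C"
  shows "norm (a ^ n - b ^ n) \<le> real n * C ^ (n - 1) * norm (a - b)"
proof (induction n)
  case (Suc n)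
  have C: "0 \<le> C" using assms(1) norm_ge_zero order_trans by blast
  have b: "norm (b ^ n) \<le> C ^ n" using assms(2) by (meson norm_ge_zero norm_power_ineq order_trans power_mono)
  have "a ^ Suc n - b ^ Suc n = a * (a ^ n - b ^ n) + (a - b) * b ^ n"
    by (simp add: algebra_simps)
  then have "norm (a ^ Suc n - b ^ Suc n) \<le> norm a * norm (a ^ n - b ^ n) + norm (a - b) * norm (b ^ n)"
    by (metis add_mono norm_mult_ineq norm_triangle_le)
  also have "\<dots> \<le> C * (real n * C ^ (n - 1) * norm (a - b)) + norm (a - b) * C ^ n"
    by (intro add_mono mult_mono Suc assms b C) auto
  also have "\<dots> = real (Suc n) * C ^ (Suc n - 1) * norm (a - b)"
    by (cases n) (simp_all add: algebra_simps)
  finally show ?case .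
qed simp

lemma norm_exp_diff_exp_le:
  fixes x y :: "'a::{real_normed_algebra_1,banach}"
  assumes "norm x \<le> C" "norm y \<le> C"
  shows "norm (exp x - exp y) \<le> exp C * norm (x - y)"
proof -
  have s: "(\<lambda>n. x ^ n /\<^sub>R fact n - y ^ n /\<^sub>R fact n) sums (exp x - exp y)"
    by (intro sums_diff exp_converges)
  \<comment> \<open>The majorant vanishes at n = 0, and n / n! = 1 / (n-1)! turns its shift into the
    series of exp C.\<close>
  define g where "g n = real n * C ^ (n - 1) * norm (x - y) / fact n" for n
  have "g (Suc n) = C ^ n /\<^sub>R fact n * norm (x - y)" for n
    unfolding g_def by (simp add: divide_simps)
  then have "(\<lambda>n. g (Suc n)) sums (exp C * norm (x - y))"
    by (simp only:) (intro sums_mult2 exp_converges)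
  then have t: "g sums (exp C * norm (x - y))"
    using sums_Suc_iff[of g] by (simp add: g_def)
  have "norm (x ^ n /\<^sub>R fact n - y ^ n /\<^sub>R fact n) \<le> g n" for n
    using norm_power_diff_le[OF assms, of n]
    by (simp add: g_def divide_simps flip: scaleR_diff_right)
  then show ?thesis
    using norm_suminf_le[of "\<lambda>n. x ^ n /\<^sub>R fact n - y ^ n /\<^sub>R fact n" g] s t
    by (simp add: sums_iff)
qed

lemma tendsto_exp_banach:
  fixes l :: "'a::{real_normed_algebra_1,banach}"
  assumes "(f \<longlongrightarrow> l) F" shows "((\<lambda>x. exp (f x)) \<longlongrightarrow> exp l) F"
proof (rule LIM_zero_cancel, rule Lim_null_comparison)
  have "\<forall>\<^sub>F x in F. norm (f x - l) < 1" 
    using tendstoD[OF assms, of 1] by (simp add: dist_norm)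
  then show "\<forall>\<^sub>F x in F. norm (exp (f x) - exp l) \<le> exp (norm l + 1) * norm (f x - l)"
  proof eventually_elim
    case (elim x)
    then have "norm (f x) \<le> norm l + 1" using norm_triangle_sub[of "f x" l] by simp
    then show ?case using norm_exp_diff_exp_le[of "f x" "norm l + 1" l] by simp
  qed
  show "((\<lambda>x. exp (norm l + 1) * norm (f x - l)) \<longlongrightarrow> 0) F"
    using tendsto_mult[OF tendsto_const tendsto_norm_zero[OF LIM_zero[OF assms]], of "exp (norm l + 1)"] by simp
qed

lemma tendsto_mexp: "(f \<longlongrightarrow> l) F \<Longrightarrow> ((\<lambda>x. mexp (f x)) \<longlongrightarrow> mexp l) F"
  unfolding mexp_eq
  by (intro bounded_linear.tendsto[OF bounded_linear_mat_of] tendsto_exp_banach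
      bounded_linear.tendsto[OF bounded_linear_sqm])

lemma continuous_on_mexp: "continuous_on S mexp"
  by (auto simp: continuous_on_def intro!: tendsto_mexp)

lemma norm_exp_diff_le:
  fixes x :: "'a::{real_normed_algebra_1,banach}"
  shows "norm (exp x - 1 - x) \<le> norm x ^ 2 * exp (norm x)"
proof -
  have s: "(\<lambda>n. x ^ (n + 2) /\<^sub>R fact (n + 2)) sums (exp x - 1 - x)"
    using sums_split_initial_segment[OF exp_converges[of x], of 2] by (simp add: numeral_2_eq_2 algebra_simps)
  have t: "(\<lambda>n. norm x ^ 2 * (norm x ^ n /\<^sub>R fact n)) sums (norm x ^ 2 * exp (norm x))"
    by (rule sums_mult[OF exp_converges])
  have "norm (x ^ (n + 2) /\<^sub>R fact (n + 2)) \<le> norm x ^ 2 * (norm x ^ n /\<^sub>R fact n)" for n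
  proof -
    have "norm (x ^ (n + 2) /\<^sub>R fact (n + 2)) = norm (x ^ (n + 2)) / fact (n + 2)"
      by (simp only: norm_scaleR) (simp add: divide_inverse mult.commute del: power_Suc power_add fact_Suc)
    also have "\<dots> \<le> norm x ^ (n + 2) / fact (n + 2)"
      by (intro divide_right_mono norm_power_ineq) simp
    also have "\<dots> \<le> norm x ^ (n + 2) / fact n"
      by (intro divide_left_mono fact_mono) (auto simp: mult_pos_pos)
    finally show ?thesis by (simp only: power_add) (simp add: divide_inverse mult_ac)
  qed
  then show ?thesis
    using norm_suminf_le[of "\<lambda>n. x ^ (n + 2) /\<^sub>R fact (n + 2)" "\<lambda>n. norm x ^ 2 * (norm x ^ n /\<^sub>R fact n)"] s t
    by (simp add: sums_iff)
qed

lemma mexp_has_derivative_0: "(mexp has_derivative (\<lambda>X. X)) (at 0)"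
proof -
  have "(exp has_derivative (\<lambda>x. x)) (at (0::'n::finite sqm))"
  proof (rule has_derivativeI_sandwich[where e = 1])
    show "norm (exp y - exp 0 - (y - 0)) / norm (y - 0) \<le> norm y * exp 1" 
      if "y \<in> UNIV" "y \<noteq> 0" "dist y 0 < 1" for y :: "'n sqm"
    proof -
      have "norm (exp y - 1 - y) \<le> norm y ^ 2 * exp 1"
        using norm_exp_diff_le[of y] that by (smt (verit) dist_0_norm dist_commute exp_le_cancel_iff mult_left_mono zero_le_power2)
      then show ?thesis using that by (simp add: divide_simps power2_eq_square mult_ac)
    qed
    show "((\<lambda>y. norm y * exp 1) \<longlongrightarrow> 0) (at (0::'n sqm))"
      by (auto intro!: tendsto_eq_intros)
  qed auto
  then have "((\<lambda>A. exp (sqm A)) has_derivative (\<lambda>A. sqm A)) (at (0::real^'n^'n))"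
    using has_derivative_compose[OF bounded_linear.has_derivative[OF bounded_linear_sqm has_derivative_ident], of exp "\<lambda>x. x" 0]
    by (simp add: sqm_simps)
  from bounded_linear.has_derivative[OF bounded_linear_mat_of this]
  show ?thesis by (simp add: mexp_eq[abs_def])
qed

section \<open>Conjugation and the bracket\<close>

lemma linear_conj_by: "linear (conj_by g)"
  by (simp add: linear_iff conj_by_def matrix_mult_simps)

lemma conj_by_one [simp]: "conj_by (mat 1) X = X"
  by (metis conj_by_def inverse_matrix_unique(1) matrix_mul_lid matrix_mul_rid)

lemma matrix_inv_mult:
  fixes g h :: "real^'n^'n"
  assumes "invertible g" "invertible h"
  shows "matrix_inv (g ** h) = matrix_inv h ** matrix_inv g"
proof (rule inverse_matrix_unique)
  have "g ** h ** (matrix_inv h ** matrix_inv g) = g ** (h ** matrix_inv h) ** matrix_inv g"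
    by (simp add: matrix_mul_assoc)
  then show "g ** h ** (matrix_inv h ** matrix_inv g) = mat 1" by (simp add: matrix_inv_simps assms)
qed

lemma conj_by_mult:
  assumes "invertible g" "invertible h" shows "conj_by (g ** h) X = conj_by g (conj_by h X)"
  by (simp add: conj_by_def matrix_inv_mult[OF assms] matrix_mul_assoc)

lemma matrix_inv_invertible [simp]: 
  fixes g :: "real^'n^'n"
  assumes "invertible g" shows "invertible (matrix_inv g)" "matrix_inv (matrix_inv g) = g"
  using inverse_matrix_unique[OF matrix_inv_simps(2)[OF assms]] by auto

lemma conj_by_inv [simp]:
  assumes "invertible g" 
  shows "conj_by (matrix_inv g) (conj_by g X) = X" "conj_by g (conj_by (matrix_inv g) X) = X"
  using assms by (simp_all flip: conj_by_mult add: matrix_inv_simps)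

lemma conj_by_mat_mult:
  assumes "invertible g" shows "conj_by g (X ** Y) = conj_by g X ** conj_by g Y"
proof -
  have "conj_by g X ** conj_by g Y = g ** X ** (matrix_inv g ** g) ** Y ** matrix_inv g"
    by (simp add: conj_by_def matrix_mul_assoc)
  then show ?thesis by (simp add: matrix_inv_simps assms conj_by_def matrix_mul_assoc)
qed

lemma conj_by_mat_1 [simp]: "invertible g \<Longrightarrow> conj_by g (mat 1) = mat 1"
  by (simp add: conj_by_def matrix_inv_simps)

lemma conj_by_mult_self: "invertible g \<Longrightarrow> conj_by g X ** g = g ** X"
  by (metis conj_by_def matrix_inv_simps(2) matrix_mul_assoc matrix_mul_rid)

lemma mexp_conj_by:
  assumes "invertible g" shows "mexp (conj_by g X) = conj_by g (mexp X)"
  using mexp_intertwine[OF conj_by_mult_self[OF assms]] assms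
  by (metis conj_by_def matrix_inv_simps(1) matrix_mul_assoc matrix_mul_rid)

lemma linear_bracket_right: "linear (bracket X)"
  by (simp add: linear_iff bracket_def matrix_mult_simps algebra_simps)

lemma bilinear_bracket: "bilinear bracket"
  by (simp add: bilinear_def linear_iff bracket_def matrix_mult_simps algebra_simps)

lemma bracket_self [simp]: "bracket X X = 0"
  by (simp add: bracket_def)

lemma bracket_swap: "bracket X Y = - bracket Y X"
  by (simp add: bracket_def)

lemma bracket_minus [simp]: "bracket (- X) Y = - bracket X Y" "bracket X (- Y) = - bracket X Y"
  by (simp_all add: bracket_def)

lemma bracket_0 [simp]: "bracket 0 Y = 0" "bracket X 0 = 0"
  by (simp_all add: bracket_def)

lemma bracket_jacobi: "bracket X (bracket Y Z) = bracket (bracket X Y) Z + bracket Y (bracket X Z)"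
  by (simp add: bracket_def matrix_mult_simps matrix_mul_assoc)

lemma conj_by_bracket:
  assumes "invertible g" shows "conj_by g (bracket X Y) = bracket (conj_by g X) (conj_by g Y)"
  using assms by (simp add: bracket_def conj_by_mat_mult linear_diff[OF linear_conj_by])

text \<open>The terms \<open>c n\<close> are those of the series of \<open>exp (ad z)\<close> applied to \<open>x\<close>.\<close>

lemma conj_exp_series:
  fixes x z :: "'a::{real_normed_algebra_1,banach}"
  obtains c where "c 0 = x" "\<And>n. c (Suc n) = (z * c n - c n * z) /\<^sub>R real (Suc n)"
    "c sums (exp z * x * exp (- z))"
proof
  define a where "a i = (z ^ i /\<^sub>R fact i) * x" for i
  define b where "b j = (- z) ^ j /\<^sub>R fact j" for j
  define c where "c n = (\<Sum>i\<le>n. a i * b (n - i))" for n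
  show "c 0 = x" by (simp add: c_def a_def b_def)
  have za: "z * a i = real (Suc i) *\<^sub>R a (Suc i)" for i
    unfolding a_def by (simp del: mult_Suc add: mult.assoc)
  have bz: "b j * z = - (real (Suc j) *\<^sub>R b (Suc j))" for j
  proof -
    have "(- z) ^ j * z = z * (- z) ^ j" by (rule power_commuting_commutes) simp
    then show ?thesis unfolding b_def by (simp del: mult_Suc add: scaleR_right.minus)
  qed
  show "c (Suc n) = (z * c n - c n * z) /\<^sub>R real (Suc n)" for n
  proof -
    have "z * c n - c n * z = (\<Sum>i\<le>n. z * a i * b (n - i)) + (\<Sum>i\<le>n. a i * - (b (n - i) * z))"
      by (simp add: c_def sum_distrib_left sum_distrib_right mult.assoc sum_negf)
    also have "\<dots> = (\<Sum>i\<le>n. real (Suc i) *\<^sub>R (a (Suc i) * b (n - i)))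
        + (\<Sum>i\<le>n. real (Suc n - i) *\<^sub>R (a i * b (Suc n - i)))"
      by (simp add: za bz Suc_diff_le del: of_nat_Suc)
    also have "(\<Sum>i\<le>n. real (Suc i) *\<^sub>R (a (Suc i) * b (n - i)))
        = (\<Sum>i\<le>Suc n. real i *\<^sub>R (a i * b (Suc n - i)))"
      by (subst sum.atMost_Suc_shift) simp
    also have "(\<Sum>i\<le>n. real (Suc n - i) *\<^sub>R (a i * b (Suc n - i)))
        = (\<Sum>i\<le>Suc n. real (Suc n - i) *\<^sub>R (a i * b (Suc n - i)))"
      by simp
    also have "(\<Sum>i\<le>Suc n. real i *\<^sub>R (a i * b (Suc n - i)))
        + (\<Sum>i\<le>Suc n. real (Suc n - i) *\<^sub>R (a i * b (Suc n - i)))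
        = (\<Sum>i\<le>Suc n. real (Suc n) *\<^sub>R (a i * b (Suc n - i)))"
      by (simp flip: sum.distrib scaleR_add_left of_nat_add)
    also have "\<dots> = real (Suc n) *\<^sub>R c (Suc n)"
      by (simp only: scaleR_right.sum c_def)
    finally show ?thesis by simp
  qed
  have bs: "summable (\<lambda>n. norm (b n))" "(\<Sum>n. b n) = exp (- z)"
    unfolding b_def using summable_norm_exp[of "- z"] exp_converges[of "- z"] by (auto simp: sums_iff)
  have "summable (\<lambda>n. norm (z ^ n /\<^sub>R fact n) * norm x)"
    by (intro summable_mult2 summable_norm_exp)
  then have as: "summable (\<lambda>n. norm (a n))"
    by (rule summable_comparison_test'[where N = 0]) (unfold a_def real_norm_def abs_norm_cancel, rule norm_mult_ineq)
  have "a sums (exp z * x)" unfolding a_def by (rule sums_mult2[OF exp_converges])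
  then show "c sums (exp z * x * exp (- z))"
    unfolding c_def using Cauchy_product_sums[OF as bs(1)] bs by (simp add: sums_iff)
qed

text \<open>Every term of the series of exp(ad Z) X after the zeroth lies in S, and S is closed. X
  itself may lie outside S: this covers Ad(n) H - H for H in \<a>, and with S = {0} the vectors
  killed by ad Z.\<close>

lemma conj_by_mexp_diff_mem:
  assumes S: "subspace S" and inv: "\<And>Y. Y \<in> S \<Longrightarrow> bracket Z Y \<in> S" and Z: "bracket Z X \<in> S"
  shows "conj_by (mexp Z) X - X \<in> S"
proof -
  obtain c where c0: "c 0 = sqm X"
    and cS: "\<And>n. c (Suc n) = (sqm Z * c n - c n * sqm Z) /\<^sub>R real (Suc n)"
    and cs: "c sums (exp (sqm Z) * sqm X * exp (- sqm Z))"
    using conj_exp_series by blast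
  have mS: "mat_of (c (Suc n)) = bracket Z (mat_of (c n)) /\<^sub>R real (Suc n)" for n
    by (simp add: cS bracket_def)
  have mem: "mat_of (c (Suc n)) \<in> S" for n
  proof (induction n)
    case 0
    then show ?case using Z by (simp add: mS c0)
  next
    case (Suc n)
    then show ?case using inv subspace_scale[OF S] by (simp only: mS[of "Suc n"])
  qed
  have "(\<lambda>n. mat_of (c n)) sums conj_by (mexp Z) X"
    using bounded_linear.sums[OF bounded_linear_mat_of cs]
    unfolding conj_by_mexp_eq by (simp add: mexp_eq sqm_simps)
  then have "(\<lambda>n. mat_of (c (Suc n))) sums (conj_by (mexp Z) X - X)"
    by (subst sums_Suc_iff) (simp add: c0)
  then have "(\<lambda>n. \<Sum>i<n. mat_of (c (Suc i))) \<longlonglongrightarrow> conj_by (mexp Z) X - X"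
    by (simp add: sums_def)
  moreover have "(\<Sum>i<n. mat_of (c (Suc i))) \<in> S" for n
    using mem S by (auto intro: subspace_sum)
  ultimately show ?thesis by (rule closed_sequentially[OF closed_subspace[OF S], rotated])
qed

lemma conj_by_mexp_mem:
  assumes S: "subspace S" and inv: "\<And>Y. Y \<in> S \<Longrightarrow> bracket Z Y \<in> S" and X: "X \<in> S"
  shows "conj_by (mexp Z) X \<in> S"
  using subspace_add[OF S conj_by_mexp_diff_mem[OF S inv inv[OF X]] X] by simp

lemma conj_by_mexp_fixed: "bracket Z X = 0 \<Longrightarrow> conj_by (mexp Z) X = X"
  using conj_by_mexp_diff_mem[of "{0}" Z X] by (simp add: subspace_single_0)

lemma mexp_scaleR_mat_1: "mexp (c *\<^sub>R mat 1) = exp c *\<^sub>R mat 1"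
  using exp_of_real[of c, where 'a = "'a sqm"]
  by (simp add: mexp_eq sqm_simps of_real_def)

text \<open>The eigenvector equation reads H X = X (H + c), so e^H X = X e^(H + c) = e^c X
  e^H.\<close>

lemma conj_by_mexp_eigenvector:
  assumes "bracket H X = c *\<^sub>R X" shows "conj_by (mexp H) X = exp c *\<^sub>R X"
proof -
  have "H ** X = X ** (H + c *\<^sub>R mat 1)"
    using assms by (simp add: bracket_def matrix_mult_simps algebra_simps)
  then have "mexp H ** X = X ** mexp (H + c *\<^sub>R mat 1)" by (rule mexp_intertwine)
  also have "mexp (H + c *\<^sub>R mat 1) = exp c *\<^sub>R mexp H"
    by (simp add: mexp_add_commuting matrix_mult_simps mexp_scaleR_mat_1)
  finally show ?thesis
    by (simp add: conj_by_mexp_eq matrix_mult_simps matrix_mul_assoc[symmetric])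
qed

lemma conj_by_mexp_has_vector_derivative_0:
  "((\<lambda>t. conj_by (mexp (t *\<^sub>R Z)) X) has_vector_derivative bracket Z X) (at 0)"
proof -
  have d: "((\<lambda>t. mexp (t *\<^sub>R Z)) has_vector_derivative Z) (at 0)" for Z :: "real^'n^'n"
    using mexp_has_vector_derivative[of Z 0 UNIV] by simp
  have "((\<lambda>t. mexp (t *\<^sub>R Z) ** X ** mexp (t *\<^sub>R (- Z))) has_vector_derivative
      (mexp (0 *\<^sub>R Z) ** X) ** (- Z) + (mexp (0 *\<^sub>R Z) ** 0 + Z ** X) ** mexp (0 *\<^sub>R (- Z))) (at 0)"
    by (intro matmul.has_vector_derivative d has_vector_derivative_const)
  then show ?thesis by (simp add: conj_by_mexp_eq bracket_def)
qed

section \<open>Limits of powers and one-parameter subgroups\<close>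

lemma exp_scaleR_nat: "exp (real m *\<^sub>R x) = exp x ^ m" for x :: "'a::{real_normed_algebra_1,banach}"
proof (induction m)
  case (Suc m)
  have "exp (real (Suc m) *\<^sub>R x) = exp (x + real m *\<^sub>R x)" by (simp add: algebra_simps)
  also have "\<dots> = exp x * exp (real m *\<^sub>R x)" by (rule exp_add_commuting) simp
  finally show ?case using Suc by simp
qed simp

text \<open>With w = h - 1 of size O(1/m), the factors h and exp w differ by O(1/m^2); telescoping
  the m-th powers, which stay bounded, loses a factor m and leaves O(1/m).\<close>

lemma power_tendsto_exp:
  fixes h :: "nat \<Rightarrow> 'a::{real_normed_algebra_1,banach}"
  assumes m: "filterlim m at_top sequentially" and h: "(\<lambda>i. real (m i) *\<^sub>R (h i - 1)) \<longlonglongrightarrow> z"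
  shows "(\<lambda>i. h i ^ m i) \<longlonglongrightarrow> exp z"
proof -
  define y where "y i = real (m i) *\<^sub>R (h i - 1)" for i
  have y: "y \<longlonglongrightarrow> z" using h by (simp add: y_def[abs_def])
  define c where "c = norm z + 1"
  have c0: "0 \<le> c" by (simp add: c_def)
  have "\<forall>\<^sub>F i in sequentially. norm (y i - z) < 1"
    using tendstoD[OF y, of 1] by (simp add: dist_norm)
  then have yc: "\<forall>\<^sub>F i in sequentially. norm (y i) \<le> c"
    by eventually_elim (use norm_triangle_sub c_def in \<open>smt (verit)\<close>)
  have m0: "\<forall>\<^sub>F i in sequentially. 0 < m i"
    using m[unfolded filterlim_at_top, rule_format, of 1] by eventually_elim simp
  have "(\<lambda>i. h i ^ m i - exp (y i)) \<longlonglongrightarrow> 0"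
  proof (rule Lim_null_comparison)
    show "\<forall>\<^sub>F i in sequentially. norm (h i ^ m i - exp (y i)) \<le> exp c * (c\<^sup>2 * exp c) * inverse (real (m i))"
      using yc m0
    proof eventually_elim
      case (elim i)
      define r where "r = real (m i)"
      have r: "r \<ge> 1" using elim by (simp add: r_def)
      define w where "w = y i /\<^sub>R r"
      have hw: "h i = 1 + w" using r by (simp add: w_def y_def r_def)
      have nw: "norm w \<le> c / r" using elim r by (simp add: w_def divide_simps mult.commute)
      have "norm (exp w) \<le> exp (c / r)" using norm_exp[of w] nw by (meson exp_le_cancel_iff order_trans)
      moreover have "norm (h i) \<le> exp (c / r)"
        using norm_triangle_ineq[of 1 w] nw exp_ge_add_one_self[of "c / r"] unfolding hw norm_one by linarith
      ultimately have "norm (h i ^ m i - exp w ^ m i) \<le> r * exp (c / r) ^ (m i - 1) * norm (h i - exp w)"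
        using norm_power_diff_le[of "h i" "exp (c/r)" "exp w" "m i"] by (simp add: r_def)
      also have "\<dots> \<le> r * exp c * ((c / r)\<^sup>2 * exp c)"
      proof (intro mult_mono mult_left_mono)
        have "exp (c / r) ^ (m i - 1) \<le> exp (c / r) ^ m i"
          by (intro power_increasing) (use c0 r in auto)
        also have "\<dots> = exp c" using r by (simp flip: exp_of_nat_mult r_def)
        finally show "exp (c / r) ^ (m i - 1) \<le> exp c" .
        have "norm (h i - exp w) = norm (exp w - 1 - w)" by (simp add: hw norm_minus_commute algebra_simps)
        also have "\<dots> \<le> (norm w)\<^sup>2 * exp (norm w)" by (rule norm_exp_diff_le)
        also have "\<dots> \<le> (c / r)\<^sup>2 * exp c"
        proof (intro mult_mono power_mono nw)
          have "c / r \<le> c" using r c0 by (simp add: divide_le_eq mult_le_cancel_left1)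
          then show "exp (norm w) \<le> exp c" using nw by simp
        qed auto
        finally show "norm (h i - exp w) \<le> (c / r)\<^sup>2 * exp c" .
      qed (use r in auto)
      also have "\<dots> = exp c * (c\<^sup>2 * exp c) * inverse r"
        using r by (simp add: power2_eq_square divide_simps)
      finally show ?case using r by (simp add: r_def w_def flip: exp_scaleR_nat)
    qed
    have "(\<lambda>i. inverse (real (m i))) \<longlonglongrightarrow> 0"
      by (intro tendsto_inverse_0_at_top filterlim_compose[OF filterlim_real_sequentially m])
    from tendsto_mult_right_zero[OF this]
    show "(\<lambda>i. exp c * (c\<^sup>2 * exp c) * inverse (real (m i))) \<longlonglongrightarrow> 0" .
  qed
  from tendsto_add[OF this tendsto_exp_banach[OF y]] show ?thesis by simp
qed

lemma matpow_tendsto_mexp: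
  assumes m: "filterlim m at_top sequentially" and h: "(\<lambda>i. real (m i) *\<^sub>R (h i - mat 1)) \<longlonglongrightarrow> Z"
  shows "(\<lambda>i. matpow (h i) (m i)) \<longlonglongrightarrow> mexp Z"
proof -
  have "(\<lambda>i. real (m i) *\<^sub>R (sqm (h i) - 1)) \<longlonglongrightarrow> sqm Z"
    using bounded_linear.tendsto[OF bounded_linear_sqm h] by (simp add: sqm_simps)
  from bounded_linear.tendsto[OF bounded_linear_mat_of power_tendsto_exp[OF m this]]
  show ?thesis by (simp add: matpow_eq mexp_eq)
qed

lemma tendsto_vector_derivative_0:
  assumes "(f has_vector_derivative D) (at 0)"
  shows "((\<lambda>t. (f t - f 0) /\<^sub>R t) \<longlongrightarrow> D) (at 0)"
proof (rule LIM_zero_cancel, rule tendsto_norm_zero_cancel)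
  have "((\<lambda>t. norm ((1 / norm (t - 0)) *\<^sub>R (f t - (f 0 + (t - 0) *\<^sub>R D)))) \<longlongrightarrow> 0) (at 0)"
    using assms unfolding has_vector_derivative_def has_derivative_at2 by (intro tendsto_norm_zero) blast
  moreover have "\<forall>\<^sub>F t in at 0. norm ((1 / norm (t - 0)) *\<^sub>R (f t - (f 0 + (t - 0) *\<^sub>R D)))
      = norm ((f t - f 0) /\<^sub>R t - D)"
  proof (rule eventually_at_filter[THEN iffD2], rule always_eventually, intro allI impI)
    fix t :: real assume "t \<noteq> 0"
    then have "(f t - f 0) /\<^sub>R t - D = inverse t *\<^sub>R (f t - (f 0 + t *\<^sub>R D))"
      by (simp add: algebra_simps)
    then show "norm ((1 / norm (t - 0)) *\<^sub>R (f t - (f 0 + (t - 0) *\<^sub>R D))) = norm ((f t - f 0) /\<^sub>R t - D)"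
      by (simp add: divide_inverse)
  qed
  ultimately show "((\<lambda>t. norm ((f t - f 0) /\<^sub>R t - D)) \<longlongrightarrow> 0) (at 0)"
    by (rule Lim_transform_eventually)
qed

text \<open>The curve exp(tX) exp(tY) has derivative X + Y at 0, so its values at small t have the
  shape required by the limit theorem for powers. Closure of the Lie algebra under sums and
  additivity of the differential both rest on this limit.\<close>

lemma lie_product_formula:
  "(\<lambda>i. matpow (mexp (inverse (real (Suc i)) *\<^sub>R X) ** mexp (inverse (real (Suc i)) *\<^sub>R Y)) (Suc i))
     \<longlonglongrightarrow> mexp (X + Y)"
proof (rule matpow_tendsto_mexp)
  show "filterlim Suc at_top sequentially" by (rule filterlim_Suc)
  define f where "f t = mexp (t *\<^sub>R X) ** mexp (t *\<^sub>R Y)" for t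
  have d: "((\<lambda>t. mexp (t *\<^sub>R Z)) has_vector_derivative Z) (at 0)" for Z :: "real^'a^'a"
    using mexp_has_vector_derivative[of Z 0 UNIV] by simp
  have "(f has_vector_derivative (mexp (0 *\<^sub>R X) ** Y + X ** mexp (0 *\<^sub>R Y))) (at 0)"
    unfolding f_def by (intro matmul.has_vector_derivative d)
  then have "((\<lambda>t. (f t - f 0) /\<^sub>R t) \<longlongrightarrow> X + Y) (at 0)"
    by (intro tendsto_vector_derivative_0) (simp add: add.commute)
  moreover have "filterlim (\<lambda>i. inverse (real (Suc i))) (at 0) sequentially"
    by (rule filterlim_atI[OF LIMSEQ_inverse_real_of_nat]) auto
  ultimately have "(\<lambda>i. (f (inverse (real (Suc i))) - f 0) /\<^sub>R inverse (real (Suc i))) \<longlonglongrightarrow> X + Y"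
    by (rule filterlim_compose)
  then show "(\<lambda>i. real (Suc i) *\<^sub>R (mexp (inverse (real (Suc i)) *\<^sub>R X) ** mexp (inverse (real (Suc i)) *\<^sub>R Y) - mat 1))
     \<longlonglongrightarrow> X + Y"
    by (simp add: f_def)
qed

text \<open>Only continuity is assumed. Integration over a short interval [t, t + a] gives \<gamma>
  t times the matrix D a, which is invertible for small a since D a / a tends to 1; hence \<gamma>
  is differentiable and solves \<gamma>' = \<gamma> X.\<close>

lemma one_parameter_subgroup_mexp:
  fixes \<gamma> :: "real \<Rightarrow> real^'n^'n"
  assumes cont: "continuous_on UNIV \<gamma>" and add: "\<And>s t. \<gamma> (s + t) = \<gamma> s ** \<gamma> t" and one: "\<gamma> 0 = mat 1"
  obtains X where "\<And>t. \<gamma> t = mexp (t *\<^sub>R X)"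
proof -
  \<comment> \<open>The base point -1 makes 0 an interior point, so that two-sided derivatives exist
    there.\<close>
  define F where "F u = integral {-1..u} \<gamma>" for u
  have intg: "\<gamma> integrable_on {u..v}" for u v
    using cont continuous_on_subset integrable_continuous_real by blast
  have F': "(F has_vector_derivative \<gamma> u) (at u)" if "-1 < u" for u
  proof -
    have "(F has_vector_derivative \<gamma> u) (at u within {-1..u+1})"
      unfolding F_def using that cont by (intro integral_has_vector_derivative) (auto intro: continuous_on_subset)
    then show ?thesis using that by (simp add: at_within_Icc_at)
  qed
  define D where "D a = F a - F 0" for a
  have D: "F (t + a) - F t = \<gamma> t ** D a" if "-1 < t" "0 < a" for t a
  proof -
    have I: "F v - F u = integral {u..v} \<gamma>" if "-1 < u" "u < v" for u v :: real
      unfolding F_def using Henstock_Kurzweil_Integration.integral_combine[where f = \<gamma> and a = "-1" and c = u and b = v] intg that by (simp add: algebra_simps)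
    have "F (t + a) - F t = integral {0 + t..a + t} \<gamma>" using I[of t "t + a"] that by (simp add: add.commute)
    also have "\<dots> = integral {0..a} (\<lambda>s. \<gamma> t ** \<gamma> s)"
      by (subst integral_shift_Icc_real[symmetric]) (simp add: o_def add)
    also have "\<dots> = \<gamma> t ** integral {0..a} \<gamma>"
      using integral_linear[OF intg matmul.bounded_linear_right[of "\<gamma> t"], of 0 a] by (simp add: o_def)
    also have "integral {0..a} \<gamma> = D a" unfolding D_def using I[of 0 a] that by simp
    finally show ?thesis .
  qed
  have "(F has_vector_derivative mat 1) (at 0)" using F'[of 0] one by simp
  then have "((\<lambda>t. (F t - F 0) /\<^sub>R t) \<longlongrightarrow> mat 1) (at 0)"
    by (rule tendsto_vector_derivative_0)
  moreover have "filterlim (\<lambda>i. inverse (real (Suc i))) (at 0) sequentially"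
    by (rule filterlim_atI[OF LIMSEQ_inverse_real_of_nat]) auto
  ultimately have "(\<lambda>i. D (inverse (real (Suc i))) /\<^sub>R inverse (real (Suc i))) \<longlonglongrightarrow> mat 1"
    unfolding D_def by (rule filterlim_compose)
  moreover have "isCont det (mat 1 :: real^'n^'n)"
    unfolding det_def by (intro continuous_intros) 
  ultimately have "(\<lambda>i. det (D (inverse (real (Suc i))) /\<^sub>R inverse (real (Suc i)))) \<longlonglongrightarrow> det (mat 1 :: real^'n^'n)"
    using isCont_tendsto_compose by blast
  then have "\<forall>\<^sub>F i in sequentially. det (D (inverse (real (Suc i))) /\<^sub>R inverse (real (Suc i))) > 0"
    by (intro order_tendstoD(1)[where y = "1"]) auto
  then obtain i where i: "det (D (inverse (real (Suc i))) /\<^sub>R inverse (real (Suc i))) > 0"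
    using eventually_sequentially by auto
  define a where "a = inverse (real (Suc i))"
  have a: "a > 0" by (simp add: a_def)
  have "invertible (D a /\<^sub>R a)" using i by (simp add: invertible_det_nz a_def)
  then obtain B where "(D a /\<^sub>R a) ** B = mat 1" unfolding invertible_def by blast
  then have DC: "D a ** (B /\<^sub>R a) = mat 1" by (simp add: matrix_mult_simps)
  have \<gamma>eq: "\<gamma> t = (F (t + a) - F t) ** (B /\<^sub>R a)" if "-1 < t" for t
    using D[OF that a] DC by (simp flip: matrix_mul_assoc)
  define X where "X = (\<gamma> a - \<gamma> 0) ** (B /\<^sub>R a)"
  have shift: "((\<lambda>t::real. t + b) has_vector_derivative 1) (at t)" for b t
    unfolding has_real_derivative_iff_has_vector_derivative[symmetric] by (auto intro!: derivative_eq_intros)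
  have "((\<lambda>t. F (t + a)) has_vector_derivative \<gamma> a) (at 0)"
    using vector_diff_chain_at[OF shift[of a 0], of F "\<gamma> a"] F'[of a] a by (simp add: o_def)
  moreover have "(F has_vector_derivative \<gamma> 0) (at 0)" using F'[of 0] by simp
  ultimately have "((\<lambda>t. (F (t + a) - F t) ** (B /\<^sub>R a)) has_vector_derivative X) (at 0)"
    unfolding X_def
    by (intro bounded_linear.has_vector_derivative[OF matmul.bounded_linear_left] has_vector_derivative_diff)
  then have \<gamma>0: "(\<gamma> has_vector_derivative X) (at 0)"
    by (rule has_vector_derivative_transform_within_open[where S = "{-1<..}"]) (auto simp: \<gamma>eq)
  have \<gamma>': "(\<gamma> has_vector_derivative \<gamma> t ** X) (at t)" for t
  proof -
    have "((\<lambda>s. \<gamma> t ** \<gamma> (s - t)) has_vector_derivative \<gamma> t ** X) (at t)"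
      using bounded_linear.has_vector_derivative[OF matmul.bounded_linear_right
          vector_diff_chain_at[OF shift[of "- t" t]], of \<gamma> X "\<gamma> t"] \<gamma>0
      by (simp add: o_def)
    moreover have "\<gamma> t ** \<gamma> (s - t) = \<gamma> s" for s using add[of t "s - t"] by simp
    ultimately show ?thesis by simp
  qed
  define f where "f t = \<gamma> t ** mexp (t *\<^sub>R (- X))" for t
  have "(f has_vector_derivative 0) (at t)" for t
  proof -
    have "(f has_vector_derivative (\<gamma> t ** (mexp (t *\<^sub>R (- X)) ** (- X)) + \<gamma> t ** X ** mexp (t *\<^sub>R (- X)))) (at t)"
      unfolding f_def by (intro matmul.has_vector_derivative \<gamma>' mexp_has_vector_derivative)
    moreover have "X ** mexp (t *\<^sub>R (- X)) = mexp (t *\<^sub>R (- X)) ** X"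
      by (rule mexp_intertwine[symmetric]) (simp add: matrix_mult_simps)
    ultimately show ?thesis by (simp flip: matrix_mul_assoc)
  qed
  then obtain c where c: "\<And>t. f t = c"
    using has_vector_derivative_zero_constant[of UNIV f] by auto
  have "c = mat 1" using c[of 0] by (simp add: f_def one)
  then have "\<gamma> t ** mexp (- (t *\<^sub>R X)) ** mexp (t *\<^sub>R X) = mexp (t *\<^sub>R X)" for t
    using c[of t] by (simp add: f_def)
  then show ?thesis using that by (simp flip: matrix_mul_assoc)
qed

section \<open>Closed linear groups\<close>

lemma GL_simps: "carrier GL = {A. invertible A}" "x \<otimes>\<^bsub>GL\<^esub> y = x ** y" "\<one>\<^bsub>GL\<^esub> = mat 1"
  by (simp_all add: GL_def)

lemma group_GL: "group (GL :: (real^'n^'n) monoid)"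
proof (rule groupI)
  fix x :: "real^'n^'n" assume "x \<in> carrier GL"
  then show "\<exists>y\<in>carrier GL. y \<otimes>\<^bsub>GL\<^esub> x = \<one>\<^bsub>GL\<^esub>"
    by (intro bexI[of _ "matrix_inv x"]) (auto simp: GL_simps matrix_inv_simps)
qed (auto simp: GL_simps invertible_mult matrix_mul_assoc intro: inverse_matrix_unique(2)[of "mat 1" "mat 1"])

lemma inv_GL: "invertible x \<Longrightarrow> inv\<^bsub>GL\<^esub> x = matrix_inv x"
  by (rule group.inv_equality[OF group_GL]) (auto simp: GL_simps matrix_inv_simps)

locale closed_linear_group =
  fixes G :: "(real^'n^'n) set"
  assumes subgroup_G: "subgroup G GL" and closed_G: "closedin (top_of_set (carrier GL)) G"
begin

abbreviation \<g> where "\<g> \<equiv> lie_algebra G"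

lemma G_invertible: "x \<in> G \<Longrightarrow> invertible x"
  using subgroup.mem_carrier[OF subgroup_G] by (auto simp: GL_simps)

lemma one_G [simp]: "mat 1 \<in> G"
  using subgroup.one_closed[OF subgroup_G] by (simp add: GL_simps)

lemma mult_G [intro]: "x \<in> G \<Longrightarrow> y \<in> G \<Longrightarrow> x ** y \<in> G"
  using subgroup.m_closed[OF subgroup_G] by (simp add: GL_simps)

lemma inv_G [intro]: "x \<in> G \<Longrightarrow> matrix_inv x \<in> G"
  using subgroup.m_inv_closed[OF subgroup_G] inv_GL G_invertible by metis

lemma conj_by_G: "g \<in> G \<Longrightarrow> x \<in> G \<Longrightarrow> conj_by g x \<in> G"
  by (auto simp: conj_by_def)

lemma matpow_G: "x \<in> G \<Longrightarrow> matpow x k \<in> G"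
  by (induction k) (auto simp: matpow_Suc)

text \<open>The group is closed relative to the general linear group only, hence the invertible
  limit.\<close>

lemma tendsto_G:
  assumes "\<And>i. f i \<in> G" "f \<longlonglongrightarrow> l" "invertible l"
  shows "l \<in> G"
proof -
  obtain T where T: "closed T" "G = T \<inter> carrier GL" using closed_G by (auto simp: closedin_closed)
  then have "f i \<in> T" for i using assms(1)[of i] by simp
  from closed_sequentially[OF T(1) this assms(2)]
  show ?thesis using T assms(3) by (simp add: GL_simps)
qed

lemma mexp_G: "X \<in> \<g> \<Longrightarrow> mexp X \<in> G"
  by (auto simp: lie_algebra_def dest: spec[of _ 1])

lemma subspace_g: "subspace \<g>"
proof (rule subspaceI)
  show "0 \<in> \<g>" by (simp add: lie_algebra_def)
  fix X Y assume X: "X \<in> \<g>" 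
  { fix c :: real show "c *\<^sub>R X \<in> \<g>" using X by (simp add: lie_algebra_def) }
  assume Y: "Y \<in> \<g>"
  have "mexp (t *\<^sub>R X + t *\<^sub>R Y) \<in> G" for t
  proof (rule tendsto_G[OF _ lie_product_formula])
    show "matpow (mexp (inverse (real (Suc i)) *\<^sub>R t *\<^sub>R X) ** mexp (inverse (real (Suc i)) *\<^sub>R t *\<^sub>R Y)) (Suc i) \<in> G" for i
      by (intro matpow_G mult_G) (use X Y in \<open>simp_all add: lie_algebra_def\<close>)
  qed simp
  then show "X + Y \<in> \<g>" by (simp add: lie_algebra_def scaleR_right_distrib)
qed

lemma conj_by_g: "g \<in> G \<Longrightarrow> X \<in> \<g> \<Longrightarrow> conj_by g X \<in> \<g>"
  using mexp_conj_by[OF G_invertible] conj_by_G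
  by (simp add: lie_algebra_def linear_scale[OF linear_conj_by, symmetric])

text \<open>The bracket is the limit of the difference quotients of Ad(exp tX) Y, which stay in the
  closed subspace \<open>\<g>\<close>.\<close>

lemma bracket_g:
  assumes "X \<in> \<g>" "Y \<in> \<g>" shows "bracket X Y \<in> \<g>"
proof (rule closed_sequentially[OF closed_subspace[OF subspace_g]])
  define f where "f t = conj_by (mexp (t *\<^sub>R X)) Y" for t
  have f: "f t \<in> \<g>" for t
    unfolding f_def using assms by (intro conj_by_g) (auto simp: lie_algebra_def)
  then show "(f (inverse (real (Suc i))) - f 0) /\<^sub>R inverse (real (Suc i)) \<in> \<g>" for i
    by (intro subspace_scale subspace_diff subspace_g)
  have "((\<lambda>t. (f t - f 0) /\<^sub>R t) \<longlongrightarrow> bracket X Y) (at 0)"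
    unfolding f_def by (rule tendsto_vector_derivative_0[OF conj_by_mexp_has_vector_derivative_0])
  moreover have "filterlim (\<lambda>i. inverse (real (Suc i))) (at 0) sequentially"
    by (rule filterlim_atI[OF LIMSEQ_inverse_real_of_nat]) auto
  ultimately show "(\<lambda>i. (f (inverse (real (Suc i))) - f 0) /\<^sub>R inverse (real (Suc i))) \<longlonglongrightarrow> bracket X Y"
    by (rule filterlim_compose)
qed

text \<open>For m = floor(t / |Y|) the multiple m Y tends to t y as Y shrinks, and exp(m Y) is the
  m-th power of an element of the group.\<close>

lemma direction_of_small_elements_mem_g:
  assumes Y: "\<And>i. mexp (Y i) \<in> G" "\<And>i. Y i \<noteq> 0" "Y \<longlonglongrightarrow> 0"
    and y: "(\<lambda>i. Y i /\<^sub>R norm (Y i)) \<longlonglongrightarrow> y"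
  shows "y \<in> \<g>"
proof -
  have pos: "mexp (t *\<^sub>R y) \<in> G" if t: "t > 0" for t
  proof -
    define m where "m i = nat \<lfloor>t / norm (Y i)\<rfloor>" for i
    have bd: "\<bar>real (m i) * norm (Y i) - t\<bar> \<le> norm (Y i)" for i
    proof -
      have n: "norm (Y i) > 0" using Y(2) by simp
      have m: "real (m i) \<le> t / norm (Y i)" "t / norm (Y i) \<le> real (m i) + 1"
        unfolding m_def using t n by auto
      have "real (m i) * norm (Y i) \<le> t" using m(1) n by (simp add: field_simps)
      moreover have "t \<le> (real (m i) + 1) * norm (Y i)" using m(2) n by (simp add: field_simps)
      ultimately show ?thesis by (simp add: algebra_simps)
    qed
    have "(\<lambda>i. real (m i) * norm (Y i)) \<longlonglongrightarrow> t"
    proof (rule LIM_zero_cancel, rule Lim_null_comparison)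
      show "\<forall>\<^sub>F i in sequentially. norm (real (m i) * norm (Y i) - t) \<le> norm (Y i)"
        using bd by simp
      show "(\<lambda>i. norm (Y i)) \<longlonglongrightarrow> 0" using tendsto_norm_zero[OF Y(3)] .
    qed
    then have "(\<lambda>i. (real (m i) * norm (Y i)) *\<^sub>R (Y i /\<^sub>R norm (Y i))) \<longlonglongrightarrow> t *\<^sub>R y"
      by (rule tendsto_scaleR[OF _ y])
    moreover have "(real (m i) * norm (Y i)) *\<^sub>R (Y i /\<^sub>R norm (Y i)) = real (m i) *\<^sub>R Y i" for i
      using Y(2)[of i] by simp
    ultimately have "(\<lambda>i. real (m i) *\<^sub>R Y i) \<longlonglongrightarrow> t *\<^sub>R y"
      by (simp only:)
    from tendsto_mexp[OF this] show ?thesis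
      by (rule tendsto_G[rotated]) (simp_all add: mexp_scaleR_nat matpow_G Y(1))
  qed
  have "mexp (t *\<^sub>R y) \<in> G" for t
  proof (cases "t > 0 \<or> t = 0")
    case False
    then have "matrix_inv (mexp ((- t) *\<^sub>R y)) \<in> G" by (intro inv_G pos) auto
    then show ?thesis by simp
  qed (use pos in auto)
  then show ?thesis by (simp add: lie_algebra_def)
qed

section \<open>Exponential coordinates near the identity of a closed linear group\<close>

lemma exists_projection:
  assumes "subspace (S :: 'a::euclidean_space set)"
  obtains \<pi> where "linear \<pi>" "\<And>x. \<pi> x \<in> S" "\<And>x. x \<in> S \<Longrightarrow> \<pi> x = x"
proof -
  obtain h where h: "range h \<subseteq> S" "linear h" "\<forall>v\<in>S. h (id v) = v"
    using linear_exists_left_inverse_on[OF linear_id assms inj_on_id] by blast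
  show thesis
  proof (rule that[OF h(2)])
    show "h x \<in> S" for x using h(1) by blast
    show "h x = x" if "x \<in> S" for x using h(3) that by simp
  qed
qed

text \<open>Near 1 every matrix is exp(\<pi> X) exp(X - \<pi> X) with \<pi> a projection onto the
  Lie algebra. Elements of the group tending to 1 outside exp \<g> would make the second factors
  small group elements with exponents in the kernel of \<pi>; a limit of their directions would lie
  both in that kernel and in \<open>\<g>\<close>.\<close>

lemma exp_chart:
  obtains e where "e > 0" "\<And>x. x \<in> G \<Longrightarrow> dist x (mat 1) < e \<Longrightarrow> x \<in> mexp ` \<g>"
proof (rule ccontr)
  assume contr: "\<not> thesis"
  obtain \<pi> where \<pi>: "linear \<pi>" "\<And>x. \<pi> x \<in> \<g>" "\<And>x. x \<in> \<g> \<Longrightarrow> \<pi> x = x"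
    using exists_projection[OF subspace_g] by blast
  have bl: "bounded_linear \<pi>" using \<pi>(1) linear_conv_bounded_linear by blast
  define f where "f X = mexp (\<pi> X) ** mexp (X - \<pi> X)" for X
  have f0: "f 0 = mat 1" by (simp add: f_def linear_0[OF \<pi>(1)])
  have d\<pi>: "(\<pi> has_derivative \<pi>) (at 0)" by (rule bounded_linear.has_derivative[OF bl has_derivative_ident])
  have d1: "((\<lambda>X. mexp (\<pi> X)) has_derivative \<pi>) (at 0)"
    using has_derivative_compose[OF d\<pi>, of mexp "\<lambda>x. x"] mexp_has_derivative_0 by (simp add: linear_0[OF \<pi>(1)])
  have d2: "((\<lambda>X. mexp (X - \<pi> X)) has_derivative (\<lambda>X. X - \<pi> X)) (at 0)"
    using has_derivative_compose[OF has_derivative_diff[OF has_derivative_ident d\<pi>], of mexp "\<lambda>x. x"] mexp_has_derivative_0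
    by (simp add: linear_0[OF \<pi>(1)])
  have "(f has_derivative (\<lambda>h. mexp (\<pi> 0) ** (h - \<pi> h) + \<pi> h ** mexp (0 - \<pi> 0))) (at 0)"
    unfolding f_def by (rule matmul.FDERIV[OF d1 d2])
  then have df: "(f has_derivative (\<lambda>h. h)) (at 0)"
    by (simp add: linear_0[OF \<pi>(1)])
  have contf: "continuous_on UNIV f"
    unfolding f_def
    by (intro matmul.continuous_on continuous_on_compose2[OF continuous_on_mexp[of UNIV]] continuous_intros
        linear_continuous_on[OF bl]) auto
  have "\<exists>X. norm X < inverse (real (Suc i)) \<and> f X \<in> G \<and> f X \<notin> mexp ` \<g>" for i
  proof -
    \<comment> \<open>The product map is known to be differentiable at 0 and continuous nearby;
      Sussmann's open mapping theorem asks for the derivative at the one point.\<close>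
    have "f 0 \<in> interior (f ` ball 0 (inverse (real (Suc i))))"
      by (rule sussmann_open_mapping[OF open_UNIV contf UNIV_I df bounded_linear_ident])
         (auto simp: o_def)
    then obtain e where e: "e > 0" "ball (mat 1) e \<subseteq> f ` ball 0 (inverse (real (Suc i)))"
      unfolding f0 by (auto simp: mem_interior)
    from contr that e(1) obtain x where x: "x \<in> G" "dist x (mat 1) < e" "x \<notin> mexp ` \<g>" by blast
    then have "x \<in> f ` ball 0 (inverse (real (Suc i)))" using e(2) by (auto simp: dist_commute)
    then show ?thesis using x by auto
  qed
  then obtain X where X: "\<And>i. norm (X i) < inverse (real (Suc i))" "\<And>i. f (X i) \<in> G" "\<And>i. f (X i) \<notin> mexp ` \<g>"
    by metis
  have X0: "X \<longlonglongrightarrow> 0"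
    by (rule Lim_null_comparison[OF _ LIMSEQ_inverse_real_of_nat]) (intro always_eventually allI less_imp_le X(1))
  define Y where "Y i = X i - \<pi> (X i)" for i
  have Y0: "Y \<longlonglongrightarrow> 0"
    using tendsto_diff[OF X0 bounded_linear.tendsto[OF bl X0]] by (simp add: Y_def[abs_def] linear_0[OF \<pi>(1)])
  have YG: "mexp (Y i) \<in> G" for i
  proof -
    have "mexp (Y i) = matrix_inv (mexp (\<pi> (X i))) ** f (X i)"
      by (simp add: f_def Y_def matrix_mul_assoc)
    then show ?thesis using X(2)[of i] mexp_G[OF \<pi>(2)[of "X i"]] by (simp only:) (intro mult_G inv_G)
  qed
  have Yn: "Y i \<noteq> 0" for i
  proof
    assume "Y i = 0"
    then have "f (X i) = mexp (\<pi> (X i))" by (simp add: f_def Y_def)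
    then show False using X(3)[of i] \<pi>(2) by auto
  qed
  have sph: "\<forall>i. Y i /\<^sub>R norm (Y i) \<in> sphere 0 1" using Yn by simp
  obtain y r where y: "y \<in> sphere 0 1" "strict_mono r" "((\<lambda>i. Y i /\<^sub>R norm (Y i)) \<circ> r) \<longlonglongrightarrow> y"
    by (rule seq_compactE[OF compact_imp_seq_compact[OF compact_sphere] sph])
  have yg: "y \<in> \<g>"
    using direction_of_small_elements_mem_g[of "Y \<circ> r" y] YG Yn LIMSEQ_subseq_LIMSEQ[OF Y0 y(2)] y(3)
    by (simp add: o_def)
  have "\<pi> (Y i /\<^sub>R norm (Y i)) = 0" for i
    using \<pi>(2,3) by (simp add: Y_def linear_scale[OF \<pi>(1)] linear_diff[OF \<pi>(1)])
  then have "(\<lambda>i. 0) \<longlonglongrightarrow> \<pi> y"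
    using bounded_linear.tendsto[OF bl y(3)] by (simp add: o_def)
  then have "\<pi> y = 0" by (simp add: LIMSEQ_const_iff)
  then show False using \<pi>(3)[OF yg] y(1) by simp
qed

text \<open>The centraliser of y is open and closed in G, because near any x0 in it the elements of
  G are x0 times an exponential.\<close>

lemma central_if_commutes_with_exp:
  assumes conn: "connected G" and y: "\<And>X. X \<in> \<g> \<Longrightarrow> mexp X ** y = y ** mexp X" and x: "x \<in> G"
  shows "x ** y = y ** x"
proof -
  define Z where "Z = {x \<in> G. x ** y = y ** x}"
  obtain e where e: "e > 0" "\<And>x. x \<in> G \<Longrightarrow> dist x (mat 1) < e \<Longrightarrow> x \<in> mexp ` \<g>"
    using exp_chart by blast
  have "closedin (top_of_set G) Z"
  proof -
    have "closed {x. x ** y = y ** x}"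
      by (intro closed_Collect_eq matmul.continuous_on continuous_intros)
    then have "closedin (top_of_set G) (G \<inter> {x. x ** y = y ** x})" by (rule closedin_closed_Int)
    then show ?thesis by (simp add: Z_def Int_def)
  qed
  moreover have "openin (top_of_set G) Z"
    unfolding openin_euclidean_subtopology_iff
  proof (intro conjI ballI)
    show "Z \<subseteq> G" by (auto simp: Z_def)
    fix x0 assume x0: "x0 \<in> Z"
    then have g: "x0 \<in> G" by (simp add: Z_def)
    have "continuous_on UNIV (\<lambda>x :: real^'n^'n. matrix_inv x0 ** x)"
      using matmul.continuous_on[OF continuous_on_const continuous_on_id, of UNIV "matrix_inv x0"] by simp
    then obtain d where d: "d > 0" "\<And>x. dist x x0 < d \<Longrightarrow> dist (matrix_inv x0 ** x) (matrix_inv x0 ** x0) < e"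
      using e(1) unfolding continuous_on_iff by (metis UNIV_I)
    have "x \<in> Z" if "x \<in> G" "dist x x0 < d" for x
    proof -
      have "dist (matrix_inv x0 ** x) (mat 1) < e" using d(2)[OF that(2)] g by (simp add: matrix_inv_simps G_invertible)
      then have "matrix_inv x0 ** x \<in> mexp ` \<g>" using e(2) that(1) g by blast
      then have c: "(matrix_inv x0 ** x) ** y = y ** (matrix_inv x0 ** x)" using y by auto
      have "x = x0 ** (matrix_inv x0 ** x)" using g by (simp add: matrix_mul_assoc matrix_inv_simps G_invertible)
      then have "x ** y = x0 ** ((matrix_inv x0 ** x) ** y)" by (metis matrix_mul_assoc)
      also have "\<dots> = (x0 ** y) ** (matrix_inv x0 ** x)" by (simp add: c matrix_mul_assoc)
      also have "\<dots> = y ** (x0 ** (matrix_inv x0 ** x))" using x0 by (simp add: Z_def matrix_mul_assoc)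
      also have "\<dots> = y ** x" using \<open>x = x0 ** (matrix_inv x0 ** x)\<close> by simp
      finally show ?thesis using that by (simp add: Z_def)
    qed
    then show "\<exists>d>0. \<forall>x\<in>G. dist x x0 < d \<longrightarrow> x \<in> Z" using d(1) by blast
  qed
  ultimately have "Z = {} \<or> Z = G" using conn connected_clopen by blast
  moreover have "mat 1 \<in> Z" by (simp add: Z_def)
  ultimately have "x \<in> Z" using x by blast
  then show ?thesis by (simp add: Z_def)
qed

end

section \<open>Inner products on a subspace\<close>

text \<open>The quadratic attains its minimum 0 at t = 0, so its slope there vanishes. Replacing b
  by some c >= b with c > 0 avoids a case distinction on the sign of b.\<close>

lemma quadratic_nonneg_imp_zero:
  fixes a b :: real
  assumes "\<And>t. 0 \<le> 2 * t * a + t\<^sup>2 * b" shows "a = 0"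
proof (rule ccontr)
  assume a: "a \<noteq> 0"
  define c where "c = \<bar>b\<bar> + 1"
  have c: "c > 0" "b \<le> c" by (auto simp: c_def)
  have "2 * (- a / c) * a + (- a / c)\<^sup>2 * b \<le> 2 * (- a / c) * a + (- a / c)\<^sup>2 * c"
    by (intro add_left_mono mult_left_mono c) simp
  also have "\<dots> = - (a\<^sup>2 / c)" using c by (simp add: power2_eq_square field_simps)
  also have "\<dots> < 0" using a c by simp
  finally show False using assms[of "- a / c"] by simp
qed

text \<open>Bilinearity holds on the ambient space, symmetry and positivity on \<open>V\<close>
  only: the form of a Cartan involution is meaningful on the Lie algebra alone, inside the space of
  all matrices.\<close>

locale ip_on =
  fixes V :: "'a::euclidean_space set" and ip :: "'a \<Rightarrow> 'a \<Rightarrow> real"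
  assumes subspace_V: "subspace V" and bilinear_ip: "bilinear ip"
    and ip_sym: "x \<in> V \<Longrightarrow> y \<in> V \<Longrightarrow> ip x y = ip y x"
    and ip_pos: "x \<in> V \<Longrightarrow> x \<noteq> 0 \<Longrightarrow> 0 < ip x x"
begin

lemmas ip_simps = bilinear_ladd[OF bilinear_ip] bilinear_radd[OF bilinear_ip]
  bilinear_lmul[OF bilinear_ip] bilinear_rmul[OF bilinear_ip]
  bilinear_lneg[OF bilinear_ip] bilinear_rneg[OF bilinear_ip]
  bilinear_lzero[OF bilinear_ip] bilinear_rzero[OF bilinear_ip]
  bilinear_lsub[OF bilinear_ip] bilinear_rsub[OF bilinear_ip]

lemma ip_sum_left: "ip (sum f A) y = (\<Sum>i\<in>A. ip (f i) y)"
  using bilinear_ip linear_sum[of "\<lambda>x. ip x y" f A] by (simp add: bilinear_def)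

lemma ip_sum_right: "ip x (sum f A) = (\<Sum>i\<in>A. ip x (f i))"
  using bilinear_ip unfolding bilinear_def by (simp add: linear_sum)

lemma ip_nonneg: "x \<in> V \<Longrightarrow> 0 \<le> ip x x"
  using ip_pos[of x] by (cases "x = 0") (auto simp: ip_simps less_imp_le)

lemma ip_eq_0: "x \<in> V \<Longrightarrow> ip x x = 0 \<Longrightarrow> x = 0"
  using ip_pos[of x] by force

text \<open>The Rayleigh quotient is homogeneous of degree 0, so it has a maximum c on W. The form c
  <y,y> - <T y,y> is then nonnegative and zero at the maximiser x0, and its first variation in the
  direction r = c x0 - T x0, which is 2 <r,r>, must vanish.\<close>

lemma symmetric_eigenvector:
  assumes W: "subspace W" "W \<subseteq> V" "W \<noteq> {0}" and T: "linear T" "\<And>x. x \<in> W \<Longrightarrow> T x \<in> W"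
    and sym: "\<And>x y. x \<in> W \<Longrightarrow> y \<in> W \<Longrightarrow> ip (T x) y = ip x (T y)"
  obtains c x where "x \<in> W" "x \<noteq> 0" "T x = c *\<^sub>R x"
proof -
  note Tl = linear_add[OF T(1)] linear_scale[OF T(1)] linear_diff[OF T(1)]
  define S where "S = W \<inter> sphere 0 1"
  have "compact S" unfolding S_def by (rule closed_Int_compact[OF closed_subspace[OF W(1)] compact_sphere])
  moreover have "S \<noteq> {}"
  proof -
    obtain w where w: "w \<in> W" "w \<noteq> 0" using W subspace_0 by blast
    then have "w /\<^sub>R norm w \<in> S" using subspace_scale[OF W(1)] by (simp add: S_def)
    then show ?thesis by blast
  qed
  moreover have "continuous_on S (\<lambda>x. ip (T x) x / ip x x)"
  proof (intro continuous_on_divide ballI)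
    have bb: "bounded_bilinear ip" using bilinear_ip bilinear_conv_bounded_bilinear by blast
    show "continuous_on S (\<lambda>x. ip (T x) x)" "continuous_on S (\<lambda>x. ip x x)"
      by (intro bounded_bilinear.continuous_on[OF bb] linear_continuous_on T(1) continuous_on_id
          linear_conv_bounded_linear[THEN iffD1])+
    fix x assume "x \<in> S"
    then have "x \<in> V" "x \<noteq> 0" using W(2) by (auto simp: S_def)
    then show "ip x x \<noteq> 0" using ip_eq_0 by blast
  qed
  ultimately obtain x0 where x0: "x0 \<in> S" "\<And>y. y \<in> S \<Longrightarrow> ip (T y) y / ip y y \<le> ip (T x0) x0 / ip x0 x0"
    using continuous_attains_sup[of S] by blast
  define c where "c = ip (T x0) x0 / ip x0 x0"
  have x0W: "x0 \<in> W" "x0 \<noteq> 0" using x0(1) by (auto simp: S_def)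
  have le: "ip (T y) y \<le> c * ip y y" if y: "y \<in> W" for y
  proof (cases "y = 0")
    case False
    have p: "0 < ip y y" using ip_pos y W(2) False by blast
    have "y /\<^sub>R norm y \<in> S" using y False subspace_scale[OF W(1)] by (simp add: S_def)
    from x0(2)[OF this] have "ip (T y) y / ip y y \<le> c"
      using False by (simp add: Tl ip_simps c_def)
    then show ?thesis using p by (simp add: field_simps)
  qed (simp add: ip_simps)
  have TxV: "T x0 \<in> V" using T(2)[OF x0W(1)] W(2) by blast
  define r where "r = c *\<^sub>R x0 - T x0"
  have rW: "r \<in> W" unfolding r_def using x0W T(2) W(1) by (intro subspace_diff subspace_scale)
  then have rV: "r \<in> V" using W(2) by blast
  have "ip r r = 0"
  proof (rule quadratic_nonneg_imp_zero)
    fix t :: real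
    have "x0 + t *\<^sub>R r \<in> W" using x0W(1) rW W(1) by (intro subspace_add subspace_scale)
    from le[OF this] have "0 \<le> c * ip (x0 + t *\<^sub>R r) (x0 + t *\<^sub>R r) - ip (T (x0 + t *\<^sub>R r)) (x0 + t *\<^sub>R r)" by simp
    also have "\<dots> = (c * ip x0 x0 - ip (T x0) x0) + t * (c * ip x0 r + c * ip r x0 - ip (T x0) r - ip (T r) x0)
        + t\<^sup>2 * (c * ip r r - ip (T r) r)"
      by (simp add: Tl ip_simps algebra_simps power2_eq_square)
    also have "c * ip x0 x0 - ip (T x0) x0 = 0"
      using ip_pos[of x0] x0W W(2) by (auto simp: c_def)
    also have "ip (T r) x0 = ip (T x0) r"
      using sym[OF rW x0W(1)] ip_sym[OF rV TxV] by simp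
    also have "ip x0 r = ip r x0" using ip_sym rW x0W(1) W(2) by blast
    also have "ip (T x0) r = ip r (T x0)" by (rule ip_sym[OF TxV rV])
    also have "c * ip r x0 + c * ip r x0 - ip r (T x0) - ip r (T x0) = 2 * ip r (c *\<^sub>R x0 - T x0)"
      by (simp add: ip_simps)
    finally show "0 \<le> 2 * t * ip r r + t\<^sup>2 * (c * ip r r - ip (T r) r)"
      by (simp add: r_def[symmetric] mult_ac)
  qed
  then have "r = 0" using ip_eq_0 rW W(2) by blast
  then have "T x0 = c *\<^sub>R x0" by (simp add: r_def)
  with x0W show thesis by (rule that)
qed

text \<open>A nonzero F-invariant subspace of T0(W) of least dimension consists of common
  eigenvectors, since the eigenspace of any T in F inside it is again F-invariant. Staying inside
  the image of T0 secures T0 z \<noteq> 0, because image and kernel of a symmetric operator meet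
  only in 0.\<close>

lemma common_eigenvector:
  assumes W: "subspace W" "W \<subseteq> V"
    and F: "\<And>T. T \<in> F \<Longrightarrow> linear T" "\<And>T x. T \<in> F \<Longrightarrow> x \<in> W \<Longrightarrow> T x \<in> W"
    and sym: "\<And>T x y. T \<in> F \<Longrightarrow> x \<in> W \<Longrightarrow> y \<in> W \<Longrightarrow> ip (T x) y = ip x (T y)"
    and comm: "\<And>S T x. S \<in> F \<Longrightarrow> T \<in> F \<Longrightarrow> x \<in> W \<Longrightarrow> S (T x) = T (S x)"
    and T0: "T0 \<in> F" "w0 \<in> W" "T0 w0 \<noteq> 0"
  obtains z where "z \<in> W" "z \<noteq> 0" "T0 z \<noteq> 0" "\<And>T. T \<in> F \<Longrightarrow> \<exists>c. T z = c *\<^sub>R z"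
proof -
  define good where "good E \<longleftrightarrow> subspace E \<and> E \<subseteq> T0 ` W \<and> E \<noteq> {0} \<and> (\<forall>T\<in>F. \<forall>x\<in>E. T x \<in> E)" for E
  have TW: "T0 ` W \<subseteq> W" using F(2)[OF T0(1)] by auto
  have "good (T0 ` W)"
    unfolding good_def
  proof (intro conjI ballI)
    show "subspace (T0 ` W)" by (rule linear_subspace_image[OF F(1)[OF T0(1)] W(1)])
    show "T0 ` W \<noteq> {0}" using T0(2,3) by auto
    fix T x assume T: "T \<in> F" "x \<in> T0 ` W"
    then obtain w where w: "w \<in> W" "x = T0 w" by auto
    then have "T x = T0 (T w)" using comm[OF T(1) T0(1)] by simp
    then show "T x \<in> T0 ` W" using F(2)[OF T(1) w(1)] by simp
  qed simp
  then obtain E where E: "good E" "\<And>E'. good E' \<Longrightarrow> dim E \<le> dim E'"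
    using ex_has_least_nat[of good "T0 ` W" dim] by blast
  have Es: "subspace E" "E \<subseteq> T0 ` W" "E \<noteq> {0}" and EF: "\<And>T x. T \<in> F \<Longrightarrow> x \<in> E \<Longrightarrow> T x \<in> E"
    using E(1) by (auto simp: good_def)
  have EW: "E \<subseteq> W" using Es(2) TW by blast
  obtain z where z: "z \<in> E" "z \<noteq> 0" using Es subspace_0 by blast
  have "\<exists>c. T z = c *\<^sub>R z" if T: "T \<in> F" for T
  proof -
    obtain c x where x: "x \<in> E" "x \<noteq> 0" "T x = c *\<^sub>R x"
      using symmetric_eigenvector[OF Es(1) _ Es(3) F(1)[OF T] EF[OF T], of thesis] sym[OF T] EW W(2)
      by (metis subsetD subset_trans)
    define E' where "E' = {y \<in> E. T y = c *\<^sub>R y}"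
    have "good E'"
      unfolding good_def
    proof (intro conjI ballI)
      show "subspace E'"
        using Es(1) F(1)[OF T] unfolding E'_def subspace_def
        by (auto simp: linear_0 linear_add linear_scale scaleR_right_distrib)
      show "E' \<subseteq> T0 ` W" using Es(2) by (auto simp: E'_def)
      show "E' \<noteq> {0}" using x by (auto simp: E'_def)
      fix S y assume S: "S \<in> F" "y \<in> E'"
      then have y: "y \<in> E" "T y = c *\<^sub>R y" by (auto simp: E'_def)
      have "T (S y) = S (T y)" using comm[OF T S(1)] y(1) EW by blast
      then show "S y \<in> E'" using EF[OF S(1) y(1)] y(2) F(1)[OF S(1)] by (simp add: E'_def linear_scale)
    qed
    then have "dim E \<le> dim E'" by (rule E(2))
    then have "E' = E"
      using subspace_dim_equal[of E' E] Es(1) \<open>good E'\<close> by (auto simp: good_def E'_def)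
    then show ?thesis using z(1) by (auto simp: E'_def)
  qed
  moreover have "T0 z \<noteq> 0"
  proof
    assume 0: "T0 z = 0"
    obtain w where w: "w \<in> W" "z = T0 w" using z(1) Es(2) by blast
    have "ip z z = ip w (T0 z)" using sym[OF T0(1) w(1), of z] w z(1) EW by auto
    then have "ip z z = 0" by (simp add: 0 ip_simps)
    then show False using ip_eq_0 z EW W(2) by blast
  qed
  ultimately show thesis using that z EW by blast
qed

section \<open>Orthonormal bases and Bessel's inequality\<close>

definition onb :: "'a set \<Rightarrow> 'a set \<Rightarrow> bool" where
  "onb W E \<longleftrightarrow> finite E \<and> E \<subseteq> W \<and> (\<forall>e\<in>E. \<forall>f\<in>E. ip e f = (if e = f then 1 else 0))
     \<and> (\<forall>x\<in>W. x = (\<Sum>e\<in>E. ip x e *\<^sub>R e))"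

lemma ip_sum_orthonormal:
  assumes "finite E" "\<And>e f. e \<in> E \<Longrightarrow> f \<in> E \<Longrightarrow> ip e f = (if e = f then 1 else 0)" "f \<in> E"
  shows "ip (\<Sum>e\<in>E. c e *\<^sub>R e) f = c f"
proof -
  have "ip (\<Sum>e\<in>E. c e *\<^sub>R e) f = (\<Sum>e\<in>E. if e = f then c e else 0)"
    unfolding ip_sum_left by (intro sum.cong) (use assms in \<open>auto simp: ip_simps\<close>)
  also have "\<dots> = c f" using assms(1,3) by simp
  finally show ?thesis .
qed

text \<open>An orthonormal set of largest cardinality works: a nonzero remainder of an expansion
  could be normalised and added.\<close>

lemma onb_exists:
  assumes W: "subspace W" "W \<subseteq> V"
  obtains E where "onb W E"
proof -
  define P where "P E \<longleftrightarrow> finite E \<and> E \<subseteq> W \<and> (\<forall>e\<in>E. \<forall>f\<in>E. ip e f = (if e = f then 1 else 0))" for E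
  have card: "card E \<le> DIM('a)" if "P E" for E
  proof -
    have "independent E"
    proof (rule independent_if_scalars_zero)
      show "finite E" using that by (simp add: P_def)
      fix c x assume "(\<Sum>e\<in>E. c e *\<^sub>R e) = 0" "x \<in> E"
      then show "c x = 0" using ip_sum_orthonormal[of E x c] that by (simp add: P_def ip_simps)
    qed
    then show ?thesis using independent_bound by blast
  qed
  have "P {}" by (simp add: P_def)
  then obtain E where E: "P E" "\<And>E'. P E' \<Longrightarrow> card E' \<le> card E"
    using ex_has_greatest_nat[of P "{}" card "Suc DIM('a)"] card by (auto simp: less_Suc_eq_le)
  have "x = (\<Sum>e\<in>E. ip x e *\<^sub>R e)" if x: "x \<in> W" for x
  proof (rule ccontr)
    define r where "r = x - (\<Sum>e\<in>E. ip x e *\<^sub>R e)"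
    assume "x \<noteq> (\<Sum>e\<in>E. ip x e *\<^sub>R e)"
    then have r0: "r \<noteq> 0" by (simp add: r_def)
    have rW: "r \<in> W" unfolding r_def
      using x E(1) W(1) by (intro subspace_diff subspace_sum subspace_scale) (auto simp: P_def)
    have re: "ip r e = 0" if "e \<in> E" for e
      unfolding r_def using ip_sum_orthonormal[of E e "ip x"] that E(1) by (simp add: P_def ip_simps)
    then have er: "ip e r = 0" if "e \<in> E" for e using ip_sym that rW W(2) E(1) by (metis P_def subsetD)
    have p: "0 < ip r r" using ip_pos rW W(2) r0 by blast
    define f where "f = r /\<^sub>R sqrt (ip r r)"
    have ff: "ip f f = 1" using p by (simp add: f_def ip_simps divide_simps)
    have fe: "ip f e = 0" "ip e f = 0" if "e \<in> E" for e
      using re er that by (auto simp: f_def ip_simps)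
    have "f \<notin> E" using fe ff by force
    moreover have "P (insert f E)"
      using E(1) fe ff rW subspace_scale[OF W(1)] \<open>f \<notin> E\<close> by (auto simp: P_def f_def)
    ultimately show False using E(2)[of "insert f E"] E(1) by (simp add: P_def)
  qed
  then have "onb W E" using E(1) unfolding onb_def P_def by blast
  then show thesis by (rule that)
qed

text \<open>All three cases compute the square norm of x - p for the projection p of x to W. The
  strict case is what later makes the trace of a coroot positive.\<close>

lemma onb_bessel:
  assumes E: "onb W E" and W: "subspace W" "W \<subseteq> V" and x: "x \<in> V"
  shows "(\<Sum>e\<in>E. (ip x e)\<^sup>2) \<le> ip x x" "x \<notin> W \<Longrightarrow> (\<Sum>e\<in>E. (ip x e)\<^sup>2) < ip x x"
    "x \<in> W \<Longrightarrow> (\<Sum>e\<in>E. (ip x e)\<^sup>2) = ip x x"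
proof -
  define p where "p = (\<Sum>e\<in>E. ip x e *\<^sub>R e)"
  have EW: "finite E" "E \<subseteq> W" using E by (auto simp: onb_def)
  have pW: "p \<in> W" unfolding p_def using EW W(1) by (intro subspace_sum subspace_scale) auto
  have pe: "ip p e = ip x e" if "e \<in> E" for e
    unfolding p_def using ip_sum_orthonormal[of E e "ip x"] E that by (simp add: onb_def)
  have pp: "ip p p = (\<Sum>e\<in>E. (ip x e)\<^sup>2)"
    using pe by (subst (2) p_def) (simp add: ip_sum_right ip_simps power2_eq_square)
  have xp: "ip x p = (\<Sum>e\<in>E. (ip x e)\<^sup>2)"
    unfolding p_def by (simp add: ip_sum_right ip_simps power2_eq_square)
  have px: "ip p x = ip x p" using ip_sym pW W(2) x by blast
  have eq: "ip (x - p) (x - p) = ip x x - (\<Sum>e\<in>E. (ip x e)\<^sup>2)"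
    by (simp add: ip_simps pp xp px)
  have xpV: "x - p \<in> V" using x pW W(2) subspace_V by (intro subspace_diff) auto
  show "(\<Sum>e\<in>E. (ip x e)\<^sup>2) \<le> ip x x" using ip_nonneg[OF xpV] eq by simp
  show "(\<Sum>e\<in>E. (ip x e)\<^sup>2) < ip x x" if "x \<notin> W"
    using ip_pos[OF xpV] eq that pW by auto
  show "(\<Sum>e\<in>E. (ip x e)\<^sup>2) = ip x x" if "x \<in> W"
    using eq E that by (simp add: onb_def p_def ip_simps)
qed

text \<open>For D = T - 1 the kernels of D and D^2 agree on W: if T fixes D y, then <D y, D y> = <T
  y, T D y> - <y, D y> = 0.\<close>

lemma orthogonal_unipotent_fixed:
  assumes T: "linear T" "\<And>x. x \<in> W \<Longrightarrow> T x \<in> W" and W: "subspace W" "W \<subseteq> V"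
    and orth: "\<And>x y. x \<in> W \<Longrightarrow> y \<in> W \<Longrightarrow> ip (T x) (T y) = ip x y"
    and x: "x \<in> W" and nil: "((\<lambda>y. T y - y) ^^ m) x = 0"
  shows "T x = x"
proof -
  define D where "D y = T y - y" for y
  have DW: "D y \<in> W" if "y \<in> W" for y unfolding D_def using that T(2) W(1) by (intro subspace_diff)
  have DD: "D y = 0" if y: "y \<in> W" and 0: "D (D y) = 0" for y
  proof -
    have "T (D y) = D y" using 0 by (simp add: D_def)
    then have "ip (D y) (D y) = ip (T y) (T (D y)) - ip y (D y)"
      by (metis D_def ip_simps(9))
    also have "\<dots> = 0" using orth[OF y DW[OF y]] by simp
    finally show ?thesis using ip_eq_0 DW[OF y] W(2) by blast
  qed
  have "(D ^^ m) x = 0 \<Longrightarrow> D x = 0" for m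
  proof (induction m)
    case (Suc m)
    show ?case
    proof (cases m)
      case (Suc j)
      have "(D ^^ j) x \<in> W" by (induction j) (auto simp: x DW)
      from DD[OF this] have "(D ^^ m) x = 0" using Suc.prems Suc by simp
      then show ?thesis by (rule Suc.IH)
    qed (use Suc.prems in simp)
  qed (simp add: D_def linear_0[OF T(1)])
  then show ?thesis using nil by (simp add: D_def[abs_def])
qed

end

section \<open>The differential of a Cartan involution\<close>

lemma mexp_scaleR_inject:
  assumes "\<And>t. mexp (t *\<^sub>R X) = mexp (t *\<^sub>R Y)" shows "X = Y"
proof -
  have d: "((\<lambda>t. mexp (t *\<^sub>R Z)) has_vector_derivative Z) (at 0)" for Z :: "real^'a^'a"
    using mexp_has_vector_derivative[of Z 0 UNIV] by simp
  have "(\<lambda>t. mexp (t *\<^sub>R X)) = (\<lambda>t. mexp (t *\<^sub>R Y))" using assms by (rule ext)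
  then show ?thesis using vector_derivative_unique_at[OF d[of X]] d[of Y] by simp
qed

text \<open>No relation between \<theta> and the transpose in \<open>adjoint\<close> is assumed; the
  transpose enters only for central elements.\<close>

locale cartan_group = closed_linear_group G for G :: "(real^'n^'n) set" +
  fixes \<theta> :: "real^'n^'n \<Rightarrow> real^'n^'n"
  assumes connected_G: "connected G" and cartan: "cartan_involution G \<theta>"
    and adjoint: "\<exists>P. invertible P \<and> (\<forall>h \<in> conj_by P ` G. transpose h \<in> conj_by P ` G)"
begin

abbreviation K where "K \<equiv> fixed_group G \<theta>"
abbreviation \<p> where "\<p> \<equiv> eigenspace_minus G \<theta>"

lemma theta_hom: "\<theta> \<in> hom (GL\<lparr>carrier := G\<rparr>) (GL\<lparr>carrier := G\<rparr>)"
  using cartan unfolding cartan_involution_def by (auto simp: iso_def)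

lemma theta_G: "x \<in> G \<Longrightarrow> \<theta> x \<in> G"
  using theta_hom by (auto simp: hom_def)

lemma theta_mult: "x \<in> G \<Longrightarrow> y \<in> G \<Longrightarrow> \<theta> (x ** y) = \<theta> x ** \<theta> y"
  using theta_hom by (simp add: hom_def GL_def)

lemma theta_theta: "x \<in> G \<Longrightarrow> \<theta> (\<theta> x) = x"
  using cartan unfolding cartan_involution_def by blast

lemma continuous_on_theta: "continuous_on G \<theta>"
  using cartan unfolding cartan_involution_def by blast

lemma compact_K: "compact K"
  using cartan unfolding cartan_involution_def by blast

lemma theta_one [simp]: "\<theta> (mat 1) = mat 1"
proof -
  let ?t = "\<theta> (mat 1)"
  have t: "?t ** ?t = ?t" using theta_mult[OF one_G one_G] by simp
  have i: "invertible ?t" by (intro G_invertible theta_G one_G)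
  have "?t = matrix_inv ?t ** (?t ** ?t)" by (simp add: matrix_mul_assoc matrix_inv_simps i)
  then show ?thesis by (simp add: t matrix_inv_simps i)
qed

lemma theta_inv: "x \<in> G \<Longrightarrow> \<theta> (matrix_inv x) = matrix_inv (\<theta> x)"
  using inverse_matrix_unique(1)[of "\<theta> x" "\<theta> (matrix_inv x)"] theta_mult[of x "matrix_inv x"]
  by (simp add: inv_G matrix_inv_simps G_invertible)

lemma theta_matpow: "x \<in> G \<Longrightarrow> \<theta> (matpow x k) = matpow (\<theta> x) k"
  by (induction k) (simp_all add: matpow_Suc theta_mult matpow_G)

lemma theta_conj_by: "g \<in> G \<Longrightarrow> x \<in> G \<Longrightarrow> \<theta> (conj_by g x) = conj_by (\<theta> g) (\<theta> x)"
  by (simp add: conj_by_def theta_mult theta_inv mult_G inv_G)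

lemma mexp_scaleR_G: "X \<in> \<g> \<Longrightarrow> mexp (t *\<^sub>R X) \<in> G"
  by (simp add: lie_algebra_def)

text \<open>The image under \<theta> of exp(tX) is a continuous one-parameter group, hence of the
  form exp(tY), and Y is its velocity at 0. So the derivative in \<open>differential\<close> exists
  although \<theta> is merely continuous.\<close>

lemma theta_mexp_aux:
  assumes X: "X \<in> \<g>"
  shows "\<theta> (mexp (t *\<^sub>R X)) = mexp (t *\<^sub>R differential \<theta> X)" "differential \<theta> X \<in> \<g>"
proof -
  define \<gamma> where "\<gamma> t = \<theta> (mexp (t *\<^sub>R X))" for t
  have "continuous_on UNIV \<gamma>"
    unfolding \<gamma>_def
    by (rule continuous_on_compose2[OF continuous_on_theta continuous_on_compose2[OF continuous_on_mexp[of UNIV]]])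
       (auto intro!: continuous_intros mexp_scaleR_G X)
  moreover have "\<gamma> (s + t) = \<gamma> s ** \<gamma> t" for s t
    by (simp add: \<gamma>_def mexp_scaleR_add theta_mult mexp_scaleR_G X)
  moreover have "\<gamma> 0 = mat 1" by (simp add: \<gamma>_def)
  ultimately obtain Y where Y: "\<And>t. \<gamma> t = mexp (t *\<^sub>R Y)"
    using one_parameter_subgroup_mexp by metis
  have "((\<lambda>t. mexp (t *\<^sub>R Y)) has_vector_derivative Y) (at 0)"
    using mexp_has_vector_derivative[of Y 0 UNIV] by simp
  then have D: "differential \<theta> X = Y"
    unfolding differential_def using Y by (intro vector_derivative_at) (simp add: \<gamma>_def)
  then show "\<theta> (mexp (t *\<^sub>R X)) = mexp (t *\<^sub>R differential \<theta> X)"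
    using Y by (simp add: \<gamma>_def)
  have "mexp (t *\<^sub>R Y) \<in> G" for t
    unfolding Y[symmetric] \<gamma>_def by (intro theta_G mexp_scaleR_G X)
  then show "differential \<theta> X \<in> \<g>" by (simp add: D lie_algebra_def)
qed

lemma differential_unique:
  assumes "X \<in> \<g>" "\<And>t. \<theta> (mexp (t *\<^sub>R X)) = mexp (t *\<^sub>R Y)" shows "differential \<theta> X = Y"
  by (rule mexp_scaleR_inject) (simp add: theta_mexp_aux(1)[OF assms(1), symmetric] assms(2))

lemma differential_scaleR: "X \<in> \<g> \<Longrightarrow> differential \<theta> (c *\<^sub>R X) = c *\<^sub>R differential \<theta> X"
  by (rule differential_unique) (simp_all add: subspace_scale subspace_g theta_mexp_aux(1))

lemma differential_add:
  assumes X: "X \<in> \<g>" and Y: "Y \<in> \<g>"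
  shows "differential \<theta> (X + Y) = differential \<theta> X + differential \<theta> Y"
proof (rule differential_unique)
  show XY: "X + Y \<in> \<g>" using X Y subspace_g by (rule subspace_add[rotated])
  fix t :: real
  let ?a = "\<lambda>i. matpow (mexp (inverse (real (Suc i)) *\<^sub>R t *\<^sub>R X) ** mexp (inverse (real (Suc i)) *\<^sub>R t *\<^sub>R Y)) (Suc i)"
  have s: "inverse (real (Suc i)) *\<^sub>R t *\<^sub>R Z = (inverse (real (Suc i)) * t) *\<^sub>R Z" for i and Z :: "real^'n^'n"
    by simp
  have aG: "?a i \<in> G" for i
    unfolding s by (intro matpow_G mult_G mexp_scaleR_G X Y)
  have "?a \<longlonglongrightarrow> mexp (t *\<^sub>R X + t *\<^sub>R Y)" by (rule lie_product_formula)
  moreover have "mexp (t *\<^sub>R X + t *\<^sub>R Y) \<in> G" using mexp_scaleR_G[OF XY, of t] by (simp add: scaleR_right_distrib)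
  ultimately have "(\<lambda>i. \<theta> (?a i)) \<longlonglongrightarrow> \<theta> (mexp (t *\<^sub>R X + t *\<^sub>R Y))"
    by (rule continuous_on_tendsto_compose[OF continuous_on_theta]) (use aG in simp)
  moreover have "\<theta> (?a i) = matpow (mexp (inverse (real (Suc i)) *\<^sub>R t *\<^sub>R differential \<theta> X) **
      mexp (inverse (real (Suc i)) *\<^sub>R t *\<^sub>R differential \<theta> Y)) (Suc i)" for i
    unfolding s by (simp only: theta_matpow theta_mult theta_mexp_aux(1) mult_G mexp_scaleR_G X Y)
  ultimately have "(\<lambda>i. matpow (mexp (inverse (real (Suc i)) *\<^sub>R t *\<^sub>R differential \<theta> X) **
      mexp (inverse (real (Suc i)) *\<^sub>R t *\<^sub>R differential \<theta> Y)) (Suc i)) \<longlonglongrightarrow> \<theta> (mexp (t *\<^sub>R X + t *\<^sub>R Y))"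
    by (simp only:)
  from LIMSEQ_unique[OF this lie_product_formula]
  show "\<theta> (mexp (t *\<^sub>R (X + Y))) = mexp (t *\<^sub>R (differential \<theta> X + differential \<theta> Y))"
    by (simp only: scaleR_right_distrib)
qed

text \<open>A linear map on all matrices that agrees with the differential on the Lie algebra, so that
  bilinear forms built from it are bilinear everywhere.\<close>

definition d\<theta> :: "real^'n^'n \<Rightarrow> real^'n^'n" where
  "d\<theta> = (SOME D. linear D \<and> (\<forall>X\<in>\<g>. D X = differential \<theta> X))"

lemma d\<theta>: "linear d\<theta>" "X \<in> \<g> \<Longrightarrow> differential \<theta> X = d\<theta> X"
proof -
  obtain \<pi> where \<pi>: "linear \<pi>" "\<And>x. \<pi> x \<in> \<g>" "\<And>x. x \<in> \<g> \<Longrightarrow> \<pi> x = x"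
    using exists_projection[OF subspace_g] by blast
  have "linear (\<lambda>X. differential \<theta> (\<pi> X))"
    by (rule linearI) (simp_all add: linear_add[OF \<pi>(1)] linear_scale[OF \<pi>(1)] differential_add differential_scaleR \<pi>(2))
  then have "\<exists>D. linear D \<and> (\<forall>X\<in>\<g>. D X = differential \<theta> X)" using \<pi>(3) by auto
  from someI_ex[OF this] show "linear d\<theta>" "X \<in> \<g> \<Longrightarrow> differential \<theta> X = d\<theta> X"
    by (auto simp: d\<theta>_def)
qed

lemmas d\<theta>_simps = linear_add[OF d\<theta>(1)] linear_scale[OF d\<theta>(1)] linear_neg[OF d\<theta>(1)] linear_0[OF d\<theta>(1)]

lemma d\<theta>_g: "X \<in> \<g> \<Longrightarrow> d\<theta> X \<in> \<g>"
  using theta_mexp_aux(2) d\<theta>(2) by simp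

lemma theta_mexp: "X \<in> \<g> \<Longrightarrow> \<theta> (mexp (t *\<^sub>R X)) = mexp (t *\<^sub>R d\<theta> X)"
  using theta_mexp_aux(1) d\<theta>(2) by simp

lemma d\<theta>_unique: "X \<in> \<g> \<Longrightarrow> (\<And>t. \<theta> (mexp (t *\<^sub>R X)) = mexp (t *\<^sub>R Y)) \<Longrightarrow> d\<theta> X = Y"
  using differential_unique d\<theta>(2) by metis

lemma d\<theta>_d\<theta>: "X \<in> \<g> \<Longrightarrow> d\<theta> (d\<theta> X) = X"
  by (rule d\<theta>_unique) (simp_all add: d\<theta>_g theta_mexp[symmetric] theta_theta mexp_scaleR_G)

lemma d\<theta>_conj_by: 
  assumes "g \<in> G" "X \<in> \<g>" shows "d\<theta> (conj_by g X) = conj_by (\<theta> g) (d\<theta> X)"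
proof (rule d\<theta>_unique)
  show "conj_by g X \<in> \<g>" using assms by (rule conj_by_g)
  fix t
  have "mexp (t *\<^sub>R conj_by g X) = conj_by g (mexp (t *\<^sub>R X))"
    by (simp add: mexp_conj_by G_invertible assms flip: linear_scale[OF linear_conj_by])
  then have "\<theta> (mexp (t *\<^sub>R conj_by g X)) = conj_by (\<theta> g) (mexp (t *\<^sub>R d\<theta> X))"
    using theta_conj_by[OF assms(1) mexp_scaleR_G[OF assms(2)]] by (simp add: theta_mexp assms)
  then show "\<theta> (mexp (t *\<^sub>R conj_by g X)) = mexp (t *\<^sub>R conj_by (\<theta> g) (d\<theta> X))"
    by (simp add: mexp_conj_by G_invertible theta_G assms flip: linear_scale[OF linear_conj_by])
qed

lemma d\<theta>_bracket:
  assumes X: "X \<in> \<g>" and Y: "Y \<in> \<g>" shows "d\<theta> (bracket X Y) = bracket (d\<theta> X) (d\<theta> Y)"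
proof -
  have bl: "bounded_linear d\<theta>" using d\<theta>(1) linear_conv_bounded_linear by blast
  have "((\<lambda>t. d\<theta> (conj_by (mexp (t *\<^sub>R X)) Y)) has_vector_derivative d\<theta> (bracket X Y)) (at 0)"
    by (rule bounded_linear.has_vector_derivative[OF bl conj_by_mexp_has_vector_derivative_0])
  moreover have "(\<lambda>t. d\<theta> (conj_by (mexp (t *\<^sub>R X)) Y)) = (\<lambda>t. conj_by (mexp (t *\<^sub>R d\<theta> X)) (d\<theta> Y))"
    by (rule ext) (simp only: d\<theta>_conj_by mexp_scaleR_G X Y theta_mexp)
  ultimately show ?thesis
    using vector_derivative_unique_at conj_by_mexp_has_vector_derivative_0 by metis
qed

section \<open>The invariant form and the inner product it induces\<close>

definition invariant_form :: "(real^'n^'n \<Rightarrow> real^'n^'n \<Rightarrow> real) \<Rightarrow> bool" where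
  "invariant_form B \<longleftrightarrow> bilinear B \<and>
        (\<forall>X \<in> \<g>. \<forall>Y \<in> \<g>. B X Y = B Y X) \<and>
        (\<forall>g \<in> G. \<forall>X \<in> \<g>. \<forall>Y \<in> \<g>. B (conj_by g X) (conj_by g Y) = B X Y) \<and>
        (\<forall>X \<in> \<g>. \<forall>Y \<in> \<g>. B (differential \<theta> X) (differential \<theta> Y) = B X Y) \<and>
        (\<forall>X \<in> \<g>. X \<noteq> 0 \<longrightarrow> - B X (differential \<theta> X) > 0)"

definition B :: "real^'n^'n \<Rightarrow> real^'n^'n \<Rightarrow> real" where "B = (SOME B. invariant_form B)"

lemma invariant_form_B: "invariant_form B"
proof -
  have "\<exists>B. invariant_form B" using cartan by (simp add: cartan_involution_def invariant_form_def)
  then show ?thesis unfolding B_def by (rule someI_ex)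
qed

lemma B_bilinear: "bilinear B" and B_sym: "X \<in> \<g> \<Longrightarrow> Y \<in> \<g> \<Longrightarrow> B X Y = B Y X"
  and B_conj: "g \<in> G \<Longrightarrow> X \<in> \<g> \<Longrightarrow> Y \<in> \<g> \<Longrightarrow> B (conj_by g X) (conj_by g Y) = B X Y"
  and B_theta: "X \<in> \<g> \<Longrightarrow> Y \<in> \<g> \<Longrightarrow> B (d\<theta> X) (d\<theta> Y) = B X Y"
  and B_pos: "X \<in> \<g> \<Longrightarrow> X \<noteq> 0 \<Longrightarrow> - B X (d\<theta> X) > 0"
  using invariant_form_B by (auto simp: invariant_form_def d\<theta>(2))

text \<open>This is the derivative at t = 0 of the invariance of \<open>B\<close> under Ad(exp
  tZ).\<close>

lemma B_bracket:
  assumes Z: "Z \<in> \<g>" and X: "X \<in> \<g>" and Y: "Y \<in> \<g>"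
  shows "B (bracket Z X) Y = - B X (bracket Z Y)"
proof -
  have bb: "bounded_bilinear B" using B_bilinear bilinear_conv_bounded_bilinear by blast
  let ?c = "\<lambda>t X. conj_by (mexp (t *\<^sub>R Z)) X"
  have "((\<lambda>t. B (?c t X) (?c t Y)) has_vector_derivative
      (B (?c 0 X) (bracket Z Y) + B (bracket Z X) (?c 0 Y))) (at 0)"
    by (rule bounded_bilinear.has_vector_derivative[OF bb conj_by_mexp_has_vector_derivative_0 conj_by_mexp_has_vector_derivative_0])
  moreover have "(\<lambda>t. B (?c t X) (?c t Y)) = (\<lambda>t. B X Y)"
    by (rule ext) (intro B_conj mexp_scaleR_G X Y Z)
  ultimately have "((\<lambda>t::real. B X Y) has_vector_derivative (B X (bracket Z Y) + B (bracket Z X) Y)) (at 0)"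
    by simp
  then have "B X (bracket Z Y) + B (bracket Z X) Y = 0"
    using vector_derivative_unique_at has_vector_derivative_const by blast
  then show ?thesis by simp
qed

definition ip :: "real^'n^'n \<Rightarrow> real^'n^'n \<Rightarrow> real" where "ip X Y = - B X (d\<theta> Y)"

lemma bilinear_ip: "bilinear ip"
  unfolding bilinear_def ip_def
  by (auto intro!: linearI simp: d\<theta>_simps bilinear_ladd[OF B_bilinear] bilinear_radd[OF B_bilinear]
      bilinear_lmul[OF B_bilinear] bilinear_rmul[OF B_bilinear])

lemma ip_sym: "X \<in> \<g> \<Longrightarrow> Y \<in> \<g> \<Longrightarrow> ip X Y = ip Y X"
  unfolding ip_def using B_sym B_theta[of "d\<theta> X" Y] by (simp add: d\<theta>_g d\<theta>_d\<theta>)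

sublocale ip_on \<g> ip
  by unfold_locales (use subspace_g bilinear_ip ip_sym B_pos in \<open>auto simp: ip_def\<close>)

lemma ip_bracket:
  assumes Z: "Z \<in> \<g>" and X: "X \<in> \<g>" and Y: "Y \<in> \<g>"
  shows "ip (bracket Z X) Y = - ip X (bracket (d\<theta> Z) Y)"
  using B_bracket[OF Z X d\<theta>_g[OF Y]] assms
  by (simp add: ip_def d\<theta>_bracket d\<theta>_g d\<theta>_d\<theta>)

lemma K_G: "k \<in> K \<Longrightarrow> k \<in> G" and theta_K: "k \<in> K \<Longrightarrow> \<theta> k = k"
  by (auto simp: fixed_group_def)

lemma K_I: "k \<in> G \<Longrightarrow> \<theta> k = k \<Longrightarrow> k \<in> K"
  by (auto simp: fixed_group_def)

lemma K_inv: "k \<in> K \<Longrightarrow> matrix_inv k \<in> K"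
  by (intro K_I) (auto simp: theta_inv K_G theta_K)

lemma ip_conj_by_K: "k \<in> K \<Longrightarrow> X \<in> \<g> \<Longrightarrow> Y \<in> \<g> \<Longrightarrow> ip (conj_by k X) (conj_by k Y) = ip X Y"
  by (simp add: ip_def d\<theta>_conj_by K_G theta_K B_conj d\<theta>_g)

lemma p_iff: "X \<in> \<p> \<longleftrightarrow> X \<in> \<g> \<and> d\<theta> X = - X"
  by (auto simp: eigenspace_minus_def d\<theta>(2))

lemma conj_by_K_p: "k \<in> K \<Longrightarrow> X \<in> \<p> \<Longrightarrow> conj_by k X \<in> \<p>"
  by (simp add: p_iff conj_by_g K_G d\<theta>_conj_by theta_K linear_neg[OF linear_conj_by])

lemma ip_bracket_p:
  assumes "Z \<in> \<p>" "X \<in> \<g>" "Y \<in> \<g>" shows "ip (bracket Z X) Y = ip X (bracket Z Y)"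
  using ip_bracket[of Z X Y] assms by (simp add: p_iff ip_simps)

text \<open>The adjoint of a central element is again in the group and commutes with it; hence a central
  element is a normal matrix in suitable coordinates.\<close>

lemma central_unipotent_trivial:
  assumes y: "y \<in> G" "unipotent y" and c: "\<And>X. X \<in> \<g> \<Longrightarrow> conj_by y X = X"
  shows "y = mat 1"
proof -
  have cen: "x ** y = y ** x" if x: "x \<in> G" for x
  proof (rule central_if_commutes_with_exp[OF connected_G _ x])
    fix X assume "X \<in> \<g>"
    then have "conj_by y (mexp X) = mexp X" using c mexp_conj_by[OF G_invertible[OF y(1)], of X] by simp
    then show "mexp X ** y = y ** mexp X" using conj_by_mult_self[OF G_invertible[OF y(1)]] by metis
  qed
  obtain P where P: "invertible P" "\<And>h. h \<in> G \<Longrightarrow> transpose (conj_by P h) \<in> conj_by P ` G"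
    using adjoint by auto
  define Y where "Y = conj_by P y"
  obtain z where z: "z \<in> G" "transpose Y = conj_by P z" using P(2)[OF y(1)] by (auto simp: Y_def)
  define Z where "Z = Y - mat 1"
  have "transpose Y ** Y = Y ** transpose Y"
    unfolding z(2) unfolding Y_def by (simp add: conj_by_mat_mult[OF P(1), symmetric] cen z(1))
  moreover have tZ: "transpose Z = transpose Y - mat 1"
    by (simp add: Z_def transpose_def vec_eq_iff mat_def)
  ultimately have normal: "transpose Z ** Z = Z ** transpose Z"
    by (simp add: tZ) (simp add: Z_def matrix_mult_simps)
  have norm: "norm (transpose Z *v v) = norm (Z *v v)" for v
  proof -
    have "(transpose Z *v v) \<bullet> (transpose Z *v v) = v \<bullet> (Z *v (transpose Z *v v))"
      by (metis dot_lmul_matrix vector_transpose_matrix transpose_transpose)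
    also have "\<dots> = v \<bullet> (transpose Z *v (Z *v v))" by (simp only: matrix_vector_mul_assoc normal)
    also have "\<dots> = (Z *v v) \<bullet> (Z *v v)"
      by (metis dot_lmul_matrix vector_transpose_matrix transpose_transpose inner_commute)
    finally show ?thesis by (simp add: norm_eq_sqrt_inner)
  qed
  \<comment> \<open>A normal matrix and its transpose have the same kernel, so Z^2 v = 0 puts Z v
    into the kernel of the transpose, which is orthogonal to the image of Z.\<close>
  have ker: "Z *v v = 0" if "Z *v (Z *v v) = 0" for v
  proof -
    have "transpose Z *v (Z *v v) = 0" using norm[of "Z *v v"] that by simp
    then have "v \<bullet> (transpose Z *v (Z *v v)) = 0" by simp
    then have "(Z *v v) \<bullet> (Z *v v) = 0"
      by (metis dot_lmul_matrix vector_transpose_matrix transpose_transpose inner_commute)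
    then show ?thesis by simp
  qed
  obtain k where k: "matpow (y - mat 1) k = 0" using y(2) by (auto simp: unipotent_def)
  have Zc: "Z = conj_by P (y - mat 1)"
    by (simp add: Z_def Y_def linear_diff[OF linear_conj_by] P(1))
  have "matpow Z j = conj_by P (matpow (y - mat 1) j)" for j
    by (induction j) (simp_all add: matpow_Suc Zc conj_by_mat_mult[OF P(1)] P(1))
  then have Zk: "matpow Z k = 0" by (simp add: k linear_0[OF linear_conj_by])
  have "matpow Z j *v v = 0 \<Longrightarrow> Z *v v = 0" for j v
  proof (induction j)
    case (Suc j)
    show ?case
    proof (cases j)
      case (Suc i)
      have "Z *v (Z *v (matpow Z i *v v)) = 0"
        using Suc.prems Suc by (simp add: matpow_Suc matrix_vector_mul_assoc)
      from ker[OF this] have "matpow Z j *v v = 0" using Suc by (simp add: matpow_Suc matrix_vector_mul_assoc)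
      then show ?thesis by (rule Suc.IH)
    qed (use Suc.prems in \<open>simp add: matpow_Suc\<close>)
  qed simp
  then have "Z *v v = 0" for v using Zk by (metis matrix_vector_mult_0)
  then have "Z = 0" by (simp add: matrix_eq)
  then have "conj_by P (y - mat 1) = 0" by (simp add: Zc)
  then have "y - mat 1 = 0" by (metis P(1) conj_by_inv(1) linear_0 linear_conj_by)
  then show ?thesis by simp
qed

end

section \<open>Restricted roots\<close>

locale iwasawa = cartan_group G \<theta> for G :: "(real^'n^'n) set" and \<theta> +
  fixes \<a> :: "(real^'n^'n) set" and \<Phi> :: "(real^'n^'n \<Rightarrow> real) set"
  assumes maximal_abelian: "maximal_abelian_subspace \<a> \<p>"
    and positive: "positive_system (restricted_roots \<g> \<a>) \<Phi>"
begin

abbreviation \<Sigma> where "\<Sigma> \<equiv> restricted_roots \<g> \<a>"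
abbreviation root where "root \<equiv> root_space \<g> \<a>"

definition \<n> where "\<n> = span (\<Union>\<alpha>\<in>\<Phi>. root \<alpha>)"

lemma subspace_a: "subspace \<a>" and a_p: "H \<in> \<a> \<Longrightarrow> H \<in> \<p>"
  and a_comm: "H \<in> \<a> \<Longrightarrow> H' \<in> \<a> \<Longrightarrow> bracket H H' = 0"
  using maximal_abelian by (auto simp: maximal_abelian_subspace_def abelian_subspace_def)

lemma a_g: "H \<in> \<a> \<Longrightarrow> H \<in> \<g>" and d\<theta>_a: "H \<in> \<a> \<Longrightarrow> d\<theta> H = - H"
  using a_p p_iff by auto

lemma subspace_p: "subspace \<p>"
  using subspace_g unfolding subspace_def by (auto simp: p_iff d\<theta>_simps)

lemma a_maximal:
  assumes X: "X \<in> \<p>" and c: "\<And>H. H \<in> \<a> \<Longrightarrow> bracket H X = 0"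
  shows "X \<in> \<a>"
proof -
  define \<b> where "\<b> = span (insert X \<a>)"
  have b: "\<exists>c. Y - c *\<^sub>R X \<in> \<a>" if "Y \<in> \<b>" for Y
    using that subspace_a unfolding \<b>_def by (auto simp: span_insert span_eq_iff[THEN iffD2])
  have "bracket Y Z = 0" if Y: "Y \<in> \<b>" and Z: "Z \<in> \<b>" for Y Z
  proof -
    obtain c d where cd: "Y - c *\<^sub>R X \<in> \<a>" "Z - d *\<^sub>R X \<in> \<a>" using b Y Z by blast
    define H H' where "H = Y - c *\<^sub>R X" and "H' = Z - d *\<^sub>R X"
    have YZ: "Y = H + c *\<^sub>R X" "Z = H' + d *\<^sub>R X" by (auto simp: H_def H'_def)
    have "bracket H H' = 0" "bracket H X = 0" "bracket X H' = 0"
      using cd c[of H] c[of H'] a_comm bracket_swap[of X H'] by (auto simp: H_def H'_def)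
    then show ?thesis
      unfolding YZ by (simp add: bilinear_ladd[OF bilinear_bracket] bilinear_radd[OF bilinear_bracket]
          bilinear_lmul[OF bilinear_bracket] bilinear_rmul[OF bilinear_bracket])
  qed
  moreover have "\<b> \<subseteq> \<p>"
    unfolding \<b>_def using X a_p subspace_p by (intro span_minimal) auto
  ultimately have "abelian_subspace \<b> \<p>"
    by (auto simp: abelian_subspace_def \<b>_def)
  moreover have "insert X \<a> \<subseteq> \<b>" unfolding \<b>_def by (rule span_superset)
  ultimately have "\<b> = \<a>" using maximal_abelian by (auto simp: maximal_abelian_subspace_def)
  then show ?thesis using \<open>insert X \<a> \<subseteq> \<b>\<close> by blast
qed

lemma root_g: "X \<in> root \<alpha> \<Longrightarrow> X \<in> \<g>" and root_bracket: "X \<in> root \<alpha> \<Longrightarrow> H \<in> \<a> \<Longrightarrow> bracket H X = \<alpha> H *\<^sub>R X"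
  by (auto simp: root_space_def)

lemma root_I: "X \<in> \<g> \<Longrightarrow> (\<And>H. H \<in> \<a> \<Longrightarrow> bracket H X = \<alpha> H *\<^sub>R X) \<Longrightarrow> X \<in> root \<alpha>"
  by (auto simp: root_space_def)

lemma Phi_Sigma: "\<alpha> \<in> \<Phi> \<Longrightarrow> \<alpha> \<in> \<Sigma>" 
  and Phi_cases: "\<alpha> \<in> \<Sigma> \<Longrightarrow> \<alpha> \<in> \<Phi> \<or> (\<lambda>H. - \<alpha> H) \<in> \<Phi>"
  and Phi_neg: "\<alpha> \<in> \<Phi> \<Longrightarrow> (\<lambda>H. - \<alpha> H) \<notin> \<Phi>"
  and Phi_add: "\<alpha> \<in> \<Phi> \<Longrightarrow> \<beta> \<in> \<Phi> \<Longrightarrow> (\<lambda>H. \<alpha> H + \<beta> H) \<in> \<Sigma> \<Longrightarrow> (\<lambda>H. \<alpha> H + \<beta> H) \<in> \<Phi>"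
  using positive unfolding positive_system_def by (blast, blast, blast, blast)

lemma dual_add: "\<alpha> \<in> dual_space \<a> \<Longrightarrow> \<beta> \<in> dual_space \<a> \<Longrightarrow> (\<lambda>H. \<alpha> H + \<beta> H) \<in> dual_space \<a>"
proof -
  assume "\<alpha> \<in> dual_space \<a>" "\<beta> \<in> dual_space \<a>"
  then obtain f g where fg: "linear f" "\<alpha> = (\<lambda>H. if H \<in> \<a> then f H else 0)"
    "linear g" "\<beta> = (\<lambda>H. if H \<in> \<a> then g H else 0)" by (auto simp: dual_space_def)
  have "linear (\<lambda>H. f H + g H)" using fg by (intro linear_compose_add)
  then show ?thesis using fg by (auto simp: dual_space_def intro!: exI[of _ "\<lambda>H. f H + g H"])
qed

lemma root_nonzero: 
  assumes "\<alpha> \<in> \<Sigma>" obtains H where "H \<in> \<a>" "\<alpha> H \<noteq> 0"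
proof -
  obtain f where f: "\<alpha> = (\<lambda>H. if H \<in> \<a> then f H else 0)" "\<alpha> \<noteq> (\<lambda>_. 0)"
    using assms by (auto simp: restricted_roots_def dual_space_def)
  then obtain H where "\<alpha> H \<noteq> 0" by (auto simp: fun_eq_iff)
  then show thesis using that[of H] f by (auto split: if_splits)
qed

lemma subspace_n: "subspace \<n>" and root_n: "\<alpha> \<in> \<Phi> \<Longrightarrow> X \<in> root \<alpha> \<Longrightarrow> X \<in> \<n>"
  by (auto simp: \<n>_def intro: span_base)

lemma n_induct:
  assumes "X \<in> \<n>" "linear f" "subspace T" "\<And>\<alpha> X. \<alpha> \<in> \<Phi> \<Longrightarrow> X \<in> root \<alpha> \<Longrightarrow> f X \<in> T"
  shows "f X \<in> T"
proof -
  have "\<n> \<subseteq> f -` T"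
    unfolding \<n>_def by (rule span_minimal) (use assms in \<open>auto intro: linear_subspace_vimage\<close>)
  then show ?thesis using assms(1) by auto
qed

lemma n_g: "X \<in> \<n> \<Longrightarrow> X \<in> \<g>"
  using n_induct[of X "\<lambda>x. x" \<g>] subspace_g root_g by (auto simp: linear_iff)

lemma bracket_a_n: "H \<in> \<a> \<Longrightarrow> X \<in> \<n> \<Longrightarrow> bracket H X \<in> \<n>"
  by (rule n_induct[OF _ linear_bracket_right subspace_n])
     (auto simp: root_bracket intro: subspace_scale[OF subspace_n] root_n)

lemma bracket_root:
  assumes X: "X \<in> root \<alpha>" and Y: "Y \<in> root \<beta>" shows "bracket X Y \<in> root (\<lambda>H. \<alpha> H + \<beta> H)"
proof (rule root_I)
  show "bracket X Y \<in> \<g>" using X Y by (intro bracket_g) (auto dest: root_g)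
  fix H assume H: "H \<in> \<a>"
  show "bracket H (bracket X Y) = (\<alpha> H + \<beta> H) *\<^sub>R bracket X Y"
    unfolding bracket_jacobi[of H X Y] root_bracket[OF X H] root_bracket[OF Y H]
    by (simp add: bilinear_lmul[OF bilinear_bracket] bilinear_rmul[OF bilinear_bracket] scaleR_left_distrib)
qed

text \<open>A sum of two positive roots is nonzero, since \<Phi> does not contain both a root and
  its negative; if the bracket of two root vectors is nonzero, that sum is a root and therefore
  positive.\<close>

lemma bracket_n_n: 
  assumes X: "X \<in> \<n>" and Y: "Y \<in> \<n>" shows "bracket X Y \<in> \<n>"
proof -
  have rr: "bracket X Y \<in> \<n>" if X: "\<alpha> \<in> \<Phi>" "X \<in> root \<alpha>" and Y: "\<beta> \<in> \<Phi>" "Y \<in> root \<beta>" for \<alpha> \<beta> X Y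
  proof (cases "bracket X Y = 0")
    case False
    define \<gamma> where "\<gamma> = (\<lambda>H. \<alpha> H + \<beta> H)"
    have m: "bracket X Y \<in> root \<gamma>" unfolding \<gamma>_def by (rule bracket_root[OF X(2) Y(2)])
    have "\<gamma> \<noteq> (\<lambda>_. 0)"
    proof
      assume "\<gamma> = (\<lambda>_. 0)"
      then have "\<beta> H = - \<alpha> H" for H by (simp add: \<gamma>_def fun_eq_iff add_eq_0_iff)
      then have "\<beta> = (\<lambda>H. - \<alpha> H)" by (rule ext)
      then show False using Phi_neg X Y by simp
    qed
    moreover have "\<gamma> \<in> dual_space \<a>"
      unfolding \<gamma>_def using Phi_Sigma[OF X(1)] Phi_Sigma[OF Y(1)]
      by (intro dual_add) (auto simp: restricted_roots_def)
    ultimately have "\<gamma> \<in> \<Sigma>" using m False by (auto simp: restricted_roots_def)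
    then have "\<gamma> \<in> \<Phi>" using Phi_add X Y by (simp add: \<gamma>_def)
    then show ?thesis using m by (rule root_n)
  qed (use subspace_0[OF subspace_n] in simp)
  have "bracket X' Y \<in> \<n>" if "\<alpha> \<in> \<Phi>" "X' \<in> root \<alpha>" for \<alpha> X'
    by (rule n_induct[OF Y linear_bracket_right subspace_n]) (rule rr[OF that])
  then show ?thesis
    using n_induct[OF X, of "\<lambda>X. bracket X Y" \<n>] bilinear_bracket subspace_n by (auto simp: bilinear_def)
qed

text \<open>A root vector X satisfies \<alpha>(H') <H, X> = <H, [H', X]> = <[H', H], X> = 0 for
  every H' in \<a>.\<close>

lemma ip_a_n: 
  assumes H: "H \<in> \<a>" and X: "X \<in> \<n>" shows "ip H X = 0"
proof -
  have "ip H X \<in> {0}"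
  proof (rule n_induct[OF X])
    show "linear (ip H)" using bilinear_ip by (simp add: bilinear_def)
    fix \<alpha> X assume X: "\<alpha> \<in> \<Phi>" "X \<in> root \<alpha>"
    obtain H' where H': "H' \<in> \<a>" "\<alpha> H' \<noteq> 0" using root_nonzero Phi_Sigma X(1) by blast
    have "\<alpha> H' * ip H X = ip H (bracket H' X)" by (simp add: root_bracket[OF X(2) H'(1)] ip_simps)
    also have "\<dots> = ip (bracket H' H) X"
      using ip_bracket_p[of H' H X] a_p[OF H'(1)] a_g[OF H] root_g[OF X(2)] by simp
    also have "\<dots> = 0" by (simp add: a_comm H H' ip_simps)
    finally show "ip H X \<in> {0}" using H'(2) by simp
  qed simp
  then show ?thesis by simp
qed

lemma a_n_zero: "X \<in> \<a> \<Longrightarrow> X \<in> \<n> \<Longrightarrow> X = 0"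
  using ip_a_n[of X X] ip_eq_0 a_g by blast

section \<open>Coroots and a regular element\<close>

lemma root_theta: "X \<in> root \<alpha> \<Longrightarrow> d\<theta> X \<in> root (\<lambda>H. - \<alpha> H)"
proof (rule root_I)
  assume X: "X \<in> root \<alpha>"
  then show "d\<theta> X \<in> \<g>" by (intro d\<theta>_g root_g)
  fix H assume H: "H \<in> \<a>"
  have "bracket (d\<theta> H) (d\<theta> X) = d\<theta> (\<alpha> H *\<^sub>R X)"
    using d\<theta>_bracket[OF a_g[OF H] root_g[OF X]] root_bracket[OF X H] by simp
  then show "bracket H (d\<theta> X) = - \<alpha> H *\<^sub>R d\<theta> X"
    by (simp add: d\<theta>_a H d\<theta>_simps minus_equation_iff[of "bracket H (d\<theta> X)"])
qed

text \<open>The element lies in \<open>\<p>\<close>, as \<theta> swaps its two factors, and it has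
  weight -\<alpha> + \<alpha> = 0, so it lies in the maximal abelian subspace. The second formula
  makes it dual to \<alpha> up to the factor <X, X>.\<close>

lemma coroot:
  assumes X: "X \<in> root \<alpha>"
  shows "bracket (d\<theta> X) X \<in> \<a>" "H \<in> \<a> \<Longrightarrow> ip (bracket (d\<theta> X) X) H = \<alpha> H * ip X X"
proof -
  let ?h = "bracket (d\<theta> X) X"
  have Xg: "X \<in> \<g>" "d\<theta> X \<in> \<g>" using X root_g d\<theta>_g by auto
  have hp: "?h \<in> \<p>"
    using Xg by (simp add: p_iff bracket_g d\<theta>_bracket d\<theta>_d\<theta>) (rule bracket_swap)
  show "?h \<in> \<a>"
  proof (rule a_maximal[OF hp])
    fix H assume H: "H \<in> \<a>"
    show "bracket H ?h = 0"
      unfolding bracket_jacobi[of H "d\<theta> X" X] root_bracket[OF X H] root_bracket[OF root_theta[OF X] H]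
      by (simp add: bilinear_lmul[OF bilinear_bracket] bilinear_rmul[OF bilinear_bracket])
  qed
  assume H: "H \<in> \<a>"
  have "ip ?h H = - ip X (bracket X H)" using ip_bracket[OF Xg(2) Xg(1) a_g[OF H]] by (simp add: d\<theta>_d\<theta> Xg)
  also have "\<dots> = ip X (bracket H X)" by (subst bracket_swap) (simp add: ip_simps)
  finally show "ip ?h H = \<alpha> H * ip X X" by (simp add: root_bracket[OF X H] ip_simps)
qed

lemma coroot_nonzero:
  assumes X: "X \<in> root \<alpha>" "X \<noteq> 0" and \<alpha>: "\<alpha> \<in> \<Sigma>" shows "bracket (d\<theta> X) X \<noteq> 0"
proof
  assume 0: "bracket (d\<theta> X) X = 0"
  obtain H where "H \<in> \<a>" "\<alpha> H \<noteq> 0" using root_nonzero \<alpha> by blast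
  then show False using coroot(2)[OF X(1), of H] ip_pos[OF root_g[OF X(1)] X(2)] by (simp add: 0 ip_simps)
qed

text \<open>The element representing the trace of \<open>ad\<close> on \<open>\<n>\<close>, usually called \<open>2\<rho>\<close>, is positive
  on every positive root: for \<open>X\<close> in a positive root space the adjoint of \<open>ad X\<close> does not preserve
  \<open>\<n>\<close>, so it has strictly larger Hilbert-Schmidt norm on \<open>\<n>\<close> than \<open>ad X\<close>.\<close>

lemma trace_coroot_pos:
  assumes E: "onb \<n> E" and X: "X \<in> root \<alpha>" "X \<noteq> 0" and \<alpha>: "\<alpha> \<in> \<Phi>"
  shows "0 < (\<Sum>e\<in>E. ip (bracket (bracket (d\<theta> X) X) e) e)"
proof -
  let ?Y = "d\<theta> X"
  have E': "finite E" "\<And>e. e \<in> E \<Longrightarrow> e \<in> \<n>" "\<And>x. x \<in> \<n> \<Longrightarrow> x = (\<Sum>e\<in>E. ip x e *\<^sub>R e)"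
    using E by (auto simp: onb_def)
  have Xg: "X \<in> \<g>" "?Y \<in> \<g>" using X root_g d\<theta>_g by auto
  have Xn: "X \<in> \<n>" using root_n \<alpha> X by blast
  have nV: "\<n> \<subseteq> \<g>" using n_g by blast
  have eg: "e \<in> \<g>" if "e \<in> E" for e using E'(2) n_g that by blast
  have t: "ip (bracket (bracket ?Y X) e) e = ip (bracket ?Y e) (bracket ?Y e) - ip (bracket X e) (bracket X e)"
    if e: "e \<in> E" for e
  proof -
    have "bracket (bracket ?Y X) e = bracket ?Y (bracket X e) - bracket X (bracket ?Y e)"
      by (simp add: bracket_jacobi[of ?Y X e])
    then show ?thesis
      using ip_bracket[OF Xg(2) bracket_g[OF Xg(1) eg[OF e]] eg[OF e]]
        ip_bracket[OF Xg(1) bracket_g[OF Xg(2) eg[OF e]] eg[OF e]]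
      by (simp add: ip_simps d\<theta>_d\<theta> Xg)
  qed
  have ye: "ip (bracket X e) f = - ip (bracket ?Y f) e" if "e \<in> E" "f \<in> E" for e f
    using ip_bracket[OF Xg(1) eg[OF that(1)] eg[OF that(2)]] ip_sym[OF eg[OF that(1)] bracket_g[OF Xg(2) eg[OF that(2)]]]
    by simp
  have "(\<Sum>e\<in>E. ip (bracket X e) (bracket X e)) = (\<Sum>e\<in>E. \<Sum>f\<in>E. (ip (bracket X e) f)\<^sup>2)"
    by (intro sum.cong refl onb_bessel(3)[OF E subspace_n nV, symmetric] n_g bracket_n_n Xn E'(2))
  also have "\<dots> = (\<Sum>e\<in>E. \<Sum>f\<in>E. (ip (bracket ?Y f) e)\<^sup>2)"
    by (intro sum.cong refl) (simp add: ye)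
  also have "\<dots> = (\<Sum>f\<in>E. \<Sum>e\<in>E. (ip (bracket ?Y f) e)\<^sup>2)" by (rule sum.swap)
  also have "\<dots> < (\<Sum>f\<in>E. ip (bracket ?Y f) (bracket ?Y f))"
  proof (rule sum_strict_mono_ex1[OF E'(1)])
    show "\<forall>f\<in>E. (\<Sum>e\<in>E. (ip (bracket ?Y f) e)\<^sup>2) \<le> ip (bracket ?Y f) (bracket ?Y f)"
      by (intro ballI onb_bessel(1)[OF E subspace_n nV] bracket_g Xg eg)
    \<comment> \<open>If ad(\<theta> X) preserved \<n>, the coroot [\<theta> X, X] would lie in
      \<n>, which meets \<a> only in 0.\<close>
    have "\<exists>f\<in>E. bracket ?Y f \<notin> \<n>"
    proof (rule ccontr)
      assume "\<not> (\<exists>f\<in>E. bracket ?Y f \<notin> \<n>)"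
      then have "(\<Sum>f\<in>E. ip X f *\<^sub>R bracket ?Y f) \<in> \<n>"
        by (intro subspace_sum subspace_scale subspace_n) auto
      moreover have "bracket ?Y X = (\<Sum>f\<in>E. ip X f *\<^sub>R bracket ?Y f)"
        by (subst E'(3)[OF Xn]) (simp only: linear_sum[OF linear_bracket_right] linear_scale[OF linear_bracket_right])
      ultimately have "bracket ?Y X \<in> \<n>" by simp
      then have "bracket ?Y X = 0" using a_n_zero coroot(1)[OF X(1)] by blast
      then show False using coroot_nonzero[OF X Phi_Sigma[OF \<alpha>]] by simp
    qed
    then show "\<exists>f\<in>E. (\<Sum>e\<in>E. (ip (bracket ?Y f) e)\<^sup>2) < ip (bracket ?Y f) (bracket ?Y f)"
      using onb_bessel(2)[OF E subspace_n nV] bracket_g[OF Xg(2) eg] by blast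
  qed
  finally show ?thesis by (simp add: t sum_subtractf)
qed

text \<open>H represents the functional \<phi>, the trace of ad on \<n>. Then \<alpha>(H) <X, X> =
  \<phi>([\<theta> X, X]) for X in the root space, and this trace is positive.\<close>

lemma regular_element:
  obtains H where "H \<in> \<a>" "\<And>\<alpha>. \<alpha> \<in> \<Phi> \<Longrightarrow> 0 < \<alpha> H"
proof -
  have sub: "\<n> \<subseteq> \<g>" "\<a> \<subseteq> \<g>" using n_g a_g by auto
  obtain E F where E: "onb \<n> E" and F: "onb \<a> F"
    using onb_exists[OF subspace_n sub(1)] onb_exists[OF subspace_a sub(2)] by metis
  define \<phi> where "\<phi> H = (\<Sum>e\<in>E. ip (bracket H e) e)" for H
  have lin: "linear \<phi>"
    unfolding \<phi>_def
    by (intro linear_compose_sum ballI linearI)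
       (simp_all add: bilinear_ladd[OF bilinear_bracket] bilinear_lmul[OF bilinear_bracket] ip_simps)
  define H where "H = (\<Sum>f\<in>F. \<phi> f *\<^sub>R f)"
  have F': "finite F" "F \<subseteq> \<a>" "\<And>x. x \<in> \<a> \<Longrightarrow> x = (\<Sum>f\<in>F. ip x f *\<^sub>R f)"
    using F by (auto simp: onb_def)
  have H: "H \<in> \<a>" unfolding H_def using F' by (intro subspace_sum subspace_scale subspace_a) auto
  have rep: "ip h H = \<phi> h" if h: "h \<in> \<a>" for h
  proof -
    have "\<phi> h = \<phi> (\<Sum>f\<in>F. ip h f *\<^sub>R f)" using F'(3)[OF h] by simp
    also have "\<dots> = ip h H"
      unfolding H_def ip_sum_right by (simp add: linear_sum[OF lin] linear_scale[OF lin] ip_simps mult.commute)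
    finally show ?thesis by simp
  qed
  have "0 < \<alpha> H" if \<alpha>: "\<alpha> \<in> \<Phi>" for \<alpha>
  proof -
    have "root \<alpha> \<noteq> {0}" using Phi_Sigma[OF \<alpha>] by (simp add: restricted_roots_def)
    moreover have "0 \<in> root \<alpha>" using subspace_0[OF subspace_g] by (simp add: root_space_def)
    ultimately obtain X where X: "X \<in> root \<alpha>" "X \<noteq> 0" by blast
    have "\<alpha> H * ip X X = \<phi> (bracket (d\<theta> X) X)"
      using coroot(2)[OF X(1) H] rep[OF coroot(1)[OF X(1)]] by simp
    also have "\<dots> > 0" unfolding \<phi>_def by (rule trace_coroot_pos[OF E X \<alpha>])
    finally show ?thesis using ip_pos[OF root_g[OF X(1)] X(2)] by (simp add: zero_less_mult_iff)
  qed
  then show thesis using that H by blast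
qed

text \<open>This takes the place of a full root space decomposition: the operators ad H for H in
  \<a> commute and are symmetric, so they have a common eigenvector, and distinguishing h among them
  gives a root that does not vanish at h.\<close>

lemma exists_root_vector:
  assumes W: "subspace W" "W \<subseteq> \<g>" "\<And>H X. H \<in> \<a> \<Longrightarrow> X \<in> W \<Longrightarrow> bracket H X \<in> W"
    and w: "h \<in> \<a>" "w \<in> W" "bracket h w \<noteq> 0"
  obtains z \<alpha> where "z \<in> W" "z \<noteq> 0" "\<alpha> \<in> \<Sigma>" "z \<in> root \<alpha>" "\<alpha> h \<noteq> 0"
proof -
  have comm: "bracket H (bracket H' x) = bracket H' (bracket H x)" if "H \<in> \<a>" "H' \<in> \<a>" for H H' x
    using bracket_jacobi[of H H' x] a_comm[OF that] by simp
  obtain z where z: "z \<in> W" "z \<noteq> 0" "bracket h z \<noteq> 0" "\<And>T. T \<in> bracket ` \<a> \<Longrightarrow> \<exists>c. T z = c *\<^sub>R z"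
  proof (rule common_eigenvector[OF W(1,2), of "bracket ` \<a>" "bracket h" w])
    show "linear T" if "T \<in> bracket ` \<a>" for T using that linear_bracket_right by auto
    show "T x \<in> W" if "T \<in> bracket ` \<a>" "x \<in> W" for T x using that W(3) by auto
    show "ip (T x) y = ip x (T y)" if T: "T \<in> bracket ` \<a>" and xy: "x \<in> W" "y \<in> W" for T x y
    proof -
      obtain H where H: "H \<in> \<a>" "T = bracket H" using T by auto
      show ?thesis unfolding H(2) using xy W(2) by (intro ip_bracket_p a_p H(1)) auto
    qed
    show "S (T x) = T (S x)" if "S \<in> bracket ` \<a>" "T \<in> bracket ` \<a>" for S T x
      using that comm by auto
  qed (use w in auto)
  have zg: "z \<in> \<g>" using z(1) W(2) by blast
  have zz: "ip z z \<noteq> 0" using ip_pos[OF zg z(2)] by simp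
  define f where "f H = ip (bracket H z) z / ip z z" for H
  have f: "linear f"
    by (rule linearI) (simp_all add: f_def bilinear_ladd[OF bilinear_bracket] bilinear_lmul[OF bilinear_bracket] ip_simps add_divide_distrib)
  define \<alpha> where "\<alpha> = (\<lambda>H. if H \<in> \<a> then f H else 0)"
  have eig: "bracket H z = \<alpha> H *\<^sub>R z" if H: "H \<in> \<a>" for H
  proof -
    obtain c where "bracket H z = c *\<^sub>R z" using z(4) H by blast
    then show ?thesis using zz H by (simp add: \<alpha>_def f_def ip_simps)
  qed
  have r: "z \<in> root \<alpha>" by (rule root_I[OF zg eig])
  have ah: "\<alpha> h \<noteq> 0" using eig[OF w(1)] z(3) by auto
  have "\<alpha> \<noteq> (\<lambda>_. 0)" using ah by auto
  moreover have "\<alpha> \<in> dual_space \<a>" using f by (auto simp: dual_space_def \<alpha>_def)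
  moreover have "root \<alpha> \<noteq> {0}" using r z(2) by blast
  ultimately have "\<alpha> \<in> \<Sigma>" by (simp add: restricted_roots_def)
  with z(1,2) show thesis using r ah by (rule that)
qed

text \<open>The Z such that Z and \<theta> Z both normalise \<n> form an \<a>-invariant subspace E.
  If some h in \<a> failed to centralise X, E would contain a root vector z; either z or \<theta> z
  lies in \<n>, so the coroot [\<theta> z, z] would be a nonzero element of \<a> in \<n>.\<close>

lemma p_normalizer_n:
  assumes X: "X \<in> \<p>" and nX: "\<And>Y. Y \<in> \<n> \<Longrightarrow> bracket X Y \<in> \<n>"
  shows "X \<in> \<a>"
proof (rule a_maximal[OF X], rule ccontr)
  define E where "E = {X \<in> \<g>. \<forall>Y\<in>\<n>. bracket X Y \<in> \<n> \<and> bracket (d\<theta> X) Y \<in> \<n>}"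
  have XE: "X \<in> E" using X nX subspace_neg[OF subspace_n] by (simp add: E_def p_iff)
  have sE: "subspace E"
    using subspace_g subspace_n unfolding E_def subspace_def
    by (auto simp: d\<theta>_simps bilinear_ladd[OF bilinear_bracket] bilinear_lmul[OF bilinear_bracket])
  have aE: "bracket H Z \<in> E" if H: "H \<in> \<a>" and Z: "Z \<in> E" for H Z
  proof -
    have Zg: "Z \<in> \<g>" using Z by (simp add: E_def)
    have d: "d\<theta> (bracket H Z) = - bracket H (d\<theta> Z)"
      using d\<theta>_bracket[OF a_g[OF H] Zg] by (simp add: d\<theta>_a H)
    have br: "bracket (bracket H W) Y \<in> \<n>" if W: "\<And>Y. Y \<in> \<n> \<Longrightarrow> bracket W Y \<in> \<n>" and Y: "Y \<in> \<n>" for W Y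
    proof -
      have "bracket (bracket H W) Y = bracket H (bracket W Y) - bracket W (bracket H Y)"
        by (simp add: bracket_jacobi[of H W Y])
      then show ?thesis by (simp add: subspace_diff[OF subspace_n] bracket_a_n[OF H] W Y)
    qed
    show ?thesis
      using Z br[of Z] br[of "d\<theta> Z"] subspace_neg[OF subspace_n] bracket_g[OF a_g[OF H] Zg]
      by (auto simp: E_def d)
  qed
  fix h assume h: "h \<in> \<a>" "bracket h X \<noteq> 0"
  have "E \<subseteq> \<g>" by (auto simp: E_def)
  then obtain z \<alpha> where z: "z \<in> E" "z \<noteq> 0" "\<alpha> \<in> \<Sigma>" "z \<in> root \<alpha>"
    using exists_root_vector[OF sE _ aE h(1) XE h(2)] by blast
  have zg: "z \<in> \<g>" using z(1) by (simp add: E_def)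
  have "bracket (d\<theta> z) z \<in> \<n>"
    using Phi_cases[OF z(3)]
  proof
    assume "\<alpha> \<in> \<Phi>"
    then have "z \<in> \<n>" using root_n z(4) by blast
    then show ?thesis using z(1) by (simp add: E_def)
  next
    assume "(\<lambda>H. - \<alpha> H) \<in> \<Phi>"
    then have "d\<theta> z \<in> \<n>" using root_n root_theta[OF z(4)] by blast
    then have "bracket z (d\<theta> z) \<in> \<n>" using z(1) by (simp add: E_def)
    then show ?thesis using bracket_swap[of "d\<theta> z" z] subspace_neg[OF subspace_n] by simp
  qed
  then show False using a_n_zero coroot(1)[OF z(4)] coroot_nonzero[OF z(4,2,3)] by blast
qed

end

section \<open>Unipotent groups and nilpotent algebras of matrices\<close>

lemma trace_diff_scaleR: "trace (A - B) = trace A - trace B" "trace (c *\<^sub>R A) = c * trace A" for A B :: "real^'n^'n"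
  by (simp_all add: trace_def sum_subtractf sum_distrib_left)

lemma orthogonal_projection_matrix:
  fixes S :: "(real^'n) set"
  assumes "subspace S"
  obtains P :: "real^'n^'n" where "\<And>v. P *v v \<in> S" "\<And>v. v \<in> S \<Longrightarrow> P *v v = v" "S \<noteq> {0} \<Longrightarrow> 0 < trace P"
proof -
  interpret std: ip_on "UNIV :: (real^'n) set" "(\<bullet>)"
    by unfold_locales (auto simp: bilinear_def linear_iff inner_add_left inner_add_right inner_commute)
  obtain E where E: "std.onb S E" using std.onb_exists[OF assms subset_UNIV] by blast
  have E': "finite E" "E \<subseteq> S" "\<And>e. e \<in> E \<Longrightarrow> e \<bullet> e = 1" "\<And>x. x \<in> S \<Longrightarrow> x = (\<Sum>e\<in>E. (x \<bullet> e) *\<^sub>R e)"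
    using E by (auto simp: std.onb_def)
  define p where "p v = (\<Sum>e\<in>E. (v \<bullet> e) *\<^sub>R e)" for v
  have lin: "linear p"
    unfolding p_def by (intro linear_compose_sum ballI linearI) (simp_all add: inner_add_left scaleR_left_distrib)
  have P: "matrix p *v v = p v" for v by (simp add: matrix_works lin)
  show thesis
  proof (rule that[of "matrix p"])
    show "matrix p *v v \<in> S" for v
      unfolding P p_def using E' assms by (intro subspace_sum subspace_scale) auto
    show "matrix p *v v = v" if "v \<in> S" for v unfolding P p_def using E'(4)[OF that] by simp
    assume "S \<noteq> {0}"
    then have "E \<noteq> {}" using E'(4) subspace_0[OF assms] by force
    have "trace (matrix p) = (\<Sum>i\<in>UNIV. \<Sum>e\<in>E. e $ i * e $ i)"
      by (simp add: trace_def matrix_def p_def inner_axis')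
    also have "\<dots> = (\<Sum>e\<in>E. e \<bullet> e)"
      by (subst sum.swap) (simp add: inner_vec_def)
    also have "\<dots> = card E" using E'(3) by simp
    finally show "0 < trace (matrix p)" using E'(1) \<open>E \<noteq> {}\<close> by (simp add: card_gt_0_iff)
  qed
qed

text \<open>If P projects orthogonally onto the image of e, then P e = e and e P = P, so e and P
  have the same trace; for P it is the cardinality of an orthonormal basis of the image.\<close>

lemma trace_idempotent_pos:
  fixes e :: "real^'n^'n"
  assumes "e ** e = e" "e \<noteq> 0" shows "0 < trace e"
proof -
  have S: "subspace (range ((*v) e))" by (rule linear_subspace_image) (simp_all add: subspace_UNIV)
  obtain P :: "real^'n^'n" where P: "\<And>v. P *v v \<in> range ((*v) e)" "\<And>v. v \<in> range ((*v) e) \<Longrightarrow> P *v v = v"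
    "range ((*v) e) \<noteq> {0} \<Longrightarrow> 0 < trace P"
    using orthogonal_projection_matrix[OF S] by blast
  have "range ((*v) e) \<noteq> {0}"
  proof
    assume "range ((*v) e) = {0}"
    then have "e *v v = 0" for v by blast
    then show False using assms(2) by (simp add: matrix_eq)
  qed
  then have tP: "0 < trace P" by (rule P(3))
  have "P ** e = e" using P(2) by (simp add: matrix_eq matrix_vector_mul_assoc[symmetric])
  moreover have "e ** P = P"
  proof -
    have "e *v (P *v v) = P *v v" for v
    proof -
      obtain w where "P *v v = e *v w" using P(1)[of v] by blast
      then show ?thesis using assms(1) by (simp add: matrix_vector_mul_assoc)
    qed
    then show ?thesis by (simp add: matrix_eq matrix_vector_mul_assoc[symmetric])
  qed
  ultimately show ?thesis using tP trace_mul_sym[of P e] by simp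
qed

lemma matpow_add: "matpow x (i + j) = matpow x i ** matpow x j"
  by (simp add: matpow_eq power_add)

text \<open>With P j the projection onto the image of x^j, P (j+1) x P j = x P j and P j P (j+1) = P
  (j+1), so the trace of x P j does not depend on j; P 0 is the identity and P k is 0.\<close>

lemma trace_nilpotent:
  fixes x :: "real^'n^'n"
  assumes "matpow x k = 0" shows "trace x = 0"
proof -
  have S: "subspace (range ((*v) (matpow x j)))" for j by (rule linear_subspace_image) (simp_all add: subspace_UNIV)
  have "\<exists>P :: real^'n^'n. (\<forall>v. P *v v \<in> range ((*v) (matpow x j))) \<and> (\<forall>v \<in> range ((*v) (matpow x j)). P *v v = v)" for j
    using orthogonal_projection_matrix[OF S[of j]] by metis
  then obtain P :: "nat \<Rightarrow> real^'n^'n" where P: "\<And>j v. P j *v v \<in> range ((*v) (matpow x j))"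
    "\<And>j v. v \<in> range ((*v) (matpow x j)) \<Longrightarrow> P j *v v = v"
    by metis
  have step: "trace (x ** P j) = trace (x ** P (Suc j))" for j
  proof -
    have "P (Suc j) ** (x ** P j) = x ** P j"
    proof -
      have "P (Suc j) *v (x *v (P j *v v)) = x *v (P j *v v)" for v
      proof (rule P(2))
        obtain w where "P j *v v = matpow x j *v w" using P(1)[of j v] by blast
        then have "x *v (P j *v v) = matpow x (Suc j) *v w" by (simp add: matpow_Suc matrix_vector_mul_assoc)
        then show "x *v (P j *v v) \<in> range ((*v) (matpow x (Suc j)))" by simp
      qed
      then show ?thesis by (simp add: matrix_eq matrix_vector_mul_assoc[symmetric])
    qed
    moreover have "P j ** P (Suc j) = P (Suc j)"
    proof -
      have "P j *v (P (Suc j) *v v) = P (Suc j) *v v" for v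
      proof (rule P(2))
        obtain w where "P (Suc j) *v v = matpow x (Suc j) *v w" using P(1)[of "Suc j" v] by blast
        then have "P (Suc j) *v v = matpow x j *v (x *v w)" by (simp add: matpow_Suc2 matrix_vector_mul_assoc)
        then show "P (Suc j) *v v \<in> range ((*v) (matpow x j))" by simp
      qed
      then show ?thesis by (simp add: matrix_eq matrix_vector_mul_assoc[symmetric])
    qed
    ultimately show ?thesis
      using trace_mul_sym[of "P (Suc j)" "x ** P j"] by (simp add: matrix_mul_assoc[symmetric])
  qed
  have tr: "trace (x ** P 0) = trace (x ** P j)" for j by (induction j) (simp_all add: step[symmetric])
  have "P 0 = mat 1" using P(2)[of _ 0] by (simp add: matrix_eq)
  moreover have "P k = 0" using P(1)[of k] by (simp add: assms matrix_eq)
  ultimately show ?thesis using tr[of k] by (simp add: trace_def)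
qed

text \<open>The spans A m of the powers x^k with k >= m become stationary, and then A m = x^m A m.
  If x were not nilpotent, an element of A m acting as a unit on x^m would be a nonzero idempotent
  of J, contradicting trace 0.\<close>

lemma nilpotent_of_trace_zero_algebra:
  fixes J :: "(real^'n^'n) set"
  assumes J: "subspace J" "\<And>x y. x \<in> J \<Longrightarrow> y \<in> J \<Longrightarrow> x ** y \<in> J" "\<And>x. x \<in> J \<Longrightarrow> trace x = 0"
    and x: "x \<in> J"
  obtains k where "matpow x k = 0"
proof (rule ccontr)
  assume "\<not> thesis"
  then have nz: "matpow x k \<noteq> 0" for k using that by blast
  define A where "A m = span {matpow x k | k. m \<le> k}" for m
  have sub: "subspace (A m)" for m by (simp add: A_def)
  have base: "m \<le> k \<Longrightarrow> matpow x k \<in> A m" for m k unfolding A_def by (intro span_base) auto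
  have mono: "A m' \<subseteq> A m" if "m \<le> m'" for m m' unfolding A_def using that by (intro span_mono) auto
  have AJ: "A m \<subseteq> J" if "0 < m" for m
  proof -
    have "matpow x (Suc k) \<in> J" for k by (induction k) (use x J(2) in \<open>auto simp: matpow_Suc\<close>)
    then have "matpow x k \<in> J" if "m \<le> k" for k using that \<open>0 < m\<close> by (cases k) auto
    then show ?thesis unfolding A_def by (intro span_minimal J(1)) auto
  qed
  \<comment> \<open>Positivity of m matters: x^0 is the identity, which need not lie in J.\<close>
  obtain m where m: "0 < m" "\<And>m'. 0 < m' \<Longrightarrow> dim (A m) \<le> dim (A m')"
    using ex_has_least_nat[of "\<lambda>m. 0 < m" 1 "\<lambda>m. dim (A m)"] by auto
  have eq: "A (m + m) = A m"
    using subspace_dim_equal[OF sub sub mono[of m "m + m"]] m by simp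
  have fac: "\<exists>b \<in> A m. a = matpow x m ** b" if "a \<in> A m" for a
  proof -
    have "A (m + m) \<subseteq> (**) (matpow x m) ` A m"
      unfolding A_def[of "m + m"]
    proof (rule span_minimal)
      show "subspace ((**) (matpow x m) ` A m)"
        by (rule linear_subspace_image[OF _ sub]) (rule bounded_linear.linear[OF matmul.bounded_linear_right])
      show "{matpow x k |k. m + m \<le> k} \<subseteq> (**) (matpow x m) ` A m"
      proof clarify
        fix k assume "m + m \<le> k"
        then have "matpow x k = matpow x m ** matpow x (k - m)" "m \<le> k - m" by (simp_all add: matpow_add[symmetric])
        then show "matpow x k \<in> (**) (matpow x m) ` A m" using base by blast
      qed
    qed
    then show ?thesis using that eq by auto
  qed
  have comm: "b ** matpow x m = matpow x m ** b" if "b \<in> A m" for b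
  proof -
    have "A m \<subseteq> {b. b ** matpow x m = matpow x m ** b}"
      unfolding A_def
    proof (rule span_minimal)
      show "subspace {b. b ** matpow x m = matpow x m ** b}"
        by (auto simp: subspace_def matrix_mult_simps)
    qed (auto simp: matpow_add[symmetric] add.commute)
    then show ?thesis using that by blast
  qed
  obtain e where e: "e \<in> A m" "matpow x m = matpow x m ** e" using fac[OF base[of m m]] by auto
  obtain b where b: "b \<in> A m" "e = matpow x m ** b" using fac[OF e(1)] by blast
  have "e ** e = b ** (matpow x m ** e)" by (simp add: b(2) comm[OF b(1), symmetric] matrix_mul_assoc[symmetric])
  also have "\<dots> = e" using e(2) b(2) comm[OF b(1)] by simp
  finally have "e ** e = e" .
  moreover have "e \<noteq> 0" using e(2) nz[of m] by auto
  ultimately have "0 < trace e" by (rule trace_idempotent_pos)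
  moreover have "trace e = 0" using J(3) AJ[OF m(1)] e(1) by blast
  ultimately show False by simp
qed

text \<open>A v outside W with J v + W of least dimension works. If w = x v were outside W, then J w
  + W would equal J v + W and contain w, so w = y w modulo W for some y in J; iterating the
  nilpotent y puts w into W.\<close>

lemma nil_algebra_fixed_vector:
  fixes J :: "(real^'n^'n) set" and W :: "(real^'n) set"
  assumes J: "subspace J" "\<And>x y. x \<in> J \<Longrightarrow> y \<in> J \<Longrightarrow> x ** y \<in> J" and nil: "\<And>x. x \<in> J \<Longrightarrow> \<exists>k. matpow x k = 0"
    and W: "subspace W" "W \<noteq> UNIV" "\<And>x v. x \<in> J \<Longrightarrow> v \<in> W \<Longrightarrow> x *v v \<in> W"
  obtains v where "v \<notin> W" "\<And>x. x \<in> J \<Longrightarrow> x *v v \<in> W"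
proof (rule ccontr)
  assume "\<not> thesis"
  then have ex: "\<exists>x\<in>J. x *v v \<notin> W" if "v \<notin> W" for v using \<open>\<And>v. v \<notin> W \<Longrightarrow> (\<And>x. x \<in> J \<Longrightarrow> x *v v \<in> W) \<Longrightarrow> thesis\<close> that by blast
  define S where "S v = {x *v v + w | x w. x \<in> J \<and> w \<in> W}" for v
  have sub: "subspace (S v)" for v
  proof (rule subspaceI)
    show "0 \<in> S v" unfolding S_def using subspace_0[OF J(1)] subspace_0[OF W(1)]
      by (auto intro!: exI[of _ 0])
    fix a b c assume a: "a \<in> S v"
    then obtain x w where xw: "x \<in> J" "w \<in> W" "a = x *v v + w" by (auto simp: S_def)
    show "c *\<^sub>R a \<in> S v"
      unfolding S_def using xw subspace_scale[OF J(1), of x c] subspace_scale[OF W(1), of w c]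
      by (auto simp: scaleR_right_distrib scaleR_matrix_vector_assoc intro!: exI[of _ "c *\<^sub>R x"])
    assume "b \<in> S v"
    then obtain y u where yu: "y \<in> J" "u \<in> W" "b = y *v v + u" by (auto simp: S_def)
    have "a + b = (x + y) *v v + (w + u)" by (simp add: xw yu matrix_vector_mult_add_rdistrib)
    then show "a + b \<in> S v"
      unfolding S_def using subspace_add[OF J(1) xw(1) yu(1)] subspace_add[OF W(1) xw(2) yu(2)] by blast
  qed
  obtain v0 where "v0 \<notin> W" using W(2) by blast
  then obtain v where v: "v \<notin> W" "\<And>w. w \<notin> W \<Longrightarrow> dim (S v) \<le> dim (S w)"
    using ex_has_least_nat[of "\<lambda>v. v \<notin> W" v0 "\<lambda>v. dim (S v)"] by blast
  obtain x where x: "x \<in> J" "x *v v \<notin> W" using ex[OF v(1)] by blast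
  define w where "w = x *v v"
  have "S w \<subseteq> S v"
    unfolding S_def w_def matrix_vector_mul_assoc using J(2) x(1) by blast
  then have "S w = S v"
    using subspace_dim_equal[OF sub sub] v(2)[of w] x(2) w_def by blast
  moreover have "w \<in> S v" unfolding S_def w_def using x(1) subspace_0[OF W(1)] by force
  ultimately have "w \<in> S w" by simp
  then obtain y k where yk: "y \<in> J" "k \<in> W" "w = y *v w + k" unfolding S_def by blast
  have "w - matpow y m *v w \<in> W" for m
  proof (induction m)
    case (Suc m)
    have "y *v (w - matpow y m *v w) \<in> W" using W(3) yk(1) Suc by blast
    then have "y *v (w - matpow y m *v w) + k \<in> W" using subspace_add[OF W(1)] yk(2) by blast
    moreover have "y *v (w - matpow y m *v w) + k = w - matpow y (Suc m) *v w"
      by (subst (3) yk(3)) (simp add: matrix_vector_mult_diff_distrib matpow_Suc matrix_vector_mul_assoc)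
    ultimately show ?case by simp
  qed (simp add: subspace_0[OF W(1)])
  moreover obtain m where "matpow y m = 0" using nil[OF yk(1)] by blast
  ultimately have "w \<in> W" by (metis diff_zero matrix_vector_mult_0)
  then show False using x(2) by (simp add: w_def)
qed

text \<open>Kolchin's theorem: the augmentation ideal J of a unipotent group lowers a full flag.\<close>

lemma unipotent_flag:
  fixes U :: "(real^'n^'n) set"
  assumes mult: "\<And>u v. u \<in> U \<Longrightarrow> v \<in> U \<Longrightarrow> u ** v \<in> U" and unip: "\<And>u. u \<in> U \<Longrightarrow> unipotent u"
  obtains F :: "nat \<Rightarrow> (real^'n) set" and M where "F 0 = {0}" "\<And>s. M \<le> s \<Longrightarrow> F s = UNIV"
    "\<And>s. subspace (F s)" "\<And>s t. s \<le> t \<Longrightarrow> F s \<subseteq> F t" "\<And>s u v. u \<in> U \<Longrightarrow> v \<in> F (Suc s) \<Longrightarrow> u *v v - v \<in> F s"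
proof -
  define J where "J = span ((\<lambda>u. u - mat 1) ` U)"
  have sJ: "subspace J" by (simp add: J_def)
  \<comment> \<open>Nilpotency does not pass to sums, vanishing of the trace does; it extends from
    the elements u - 1 to their span J and is turned back into nilpotency once J is known to be an
    algebra.\<close>
  have trJ: "trace x = 0" if "x \<in> J" for x
  proof -
    have "J \<subseteq> {x. trace x = 0}"
      unfolding J_def
    proof (rule span_minimal)
      show "subspace {x :: real^'n^'n. trace x = 0}"
        by (auto simp: subspace_def trace_diff_scaleR trace_add trace_0) (simp add: trace_def)
      show "(\<lambda>u. u - mat 1) ` U \<subseteq> {x. trace x = 0}"
        using unip trace_nilpotent by (auto simp: unipotent_def)
    qed
    then show ?thesis using that by blast
  qed
  have mulJ: "x ** y \<in> J" if x: "x \<in> J" and y: "y \<in> J" for x y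
  proof -
    have 1: "(u - mat 1) ** y \<in> J" if u: "u \<in> U" for u
    proof -
      have "J \<subseteq> {y. (u - mat 1) ** y \<in> J}"
        unfolding J_def
      proof (rule span_minimal)
        show "subspace {y. (u - mat 1) ** y \<in> span ((\<lambda>u. u - mat 1) ` U)}"
          by (auto simp: subspace_def matrix_add_ldistrib matrix_mult_scaleR_right intro: span_add span_scale span_0)
        show "(\<lambda>u. u - mat 1) ` U \<subseteq> {y. (u - mat 1) ** y \<in> span ((\<lambda>u. u - mat 1) ` U)}"
        proof clarify
          fix v assume v: "v \<in> U"
          have "(u - mat 1) ** (v - mat 1) = (u ** v - mat 1) - (u - mat 1) - (v - mat 1)"
            by (simp add: matrix_mult_simps)
          also have "\<dots> \<in> span ((\<lambda>u. u - mat 1) ` U)"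
            using mult u v by (intro span_diff span_base) auto
          finally show "(u - mat 1) ** (v - mat 1) \<in> span ((\<lambda>u. u - mat 1) ` U)" .
        qed
      qed
      then show ?thesis using y by blast
    qed
    have "J \<subseteq> {x. x ** y \<in> J}"
      unfolding J_def
    proof (rule span_minimal)
      show "subspace {x. x ** y \<in> span ((\<lambda>u. u - mat 1) ` U)}"
        by (auto simp: subspace_def matrix_mult_add_left matrix_mult_scaleR_left intro: span_add span_scale span_0)
    qed (use 1 in \<open>auto simp: J_def\<close>)
    then show ?thesis using x by blast
  qed
  have nil: "\<exists>k. matpow x k = 0" if "x \<in> J" for x
    using nilpotent_of_trace_zero_algebra[OF sJ mulJ trJ that] by blast
  define F where "F = rec_nat {0} (\<lambda>s W. {v. \<forall>x\<in>J. x *v v \<in> W})"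
  have F0: "F 0 = {0}" and FS: "F (Suc s) = {v. \<forall>x\<in>J. x *v v \<in> F s}" for s by (simp_all add: F_def)
  have sub: "subspace (F s)" for s
  proof (induction s)
    case (Suc s)
    then show ?case unfolding FS subspace_def
      by (auto simp: matrix_vector_right_distrib matrix_vector_mult_scaleR)
  qed (simp add: F0)
  have inc: "F s \<subseteq> F (Suc s)" for s
  proof (induction s)
    case (Suc s)
    then show ?case by (auto simp: FS)
  qed (simp add: F0 FS)
  have mono: "F s \<subseteq> F t" if "s \<le> t" for s t using lift_Suc_mono_le[of F, OF inc that] by simp
  \<comment> \<open>As long as F s is proper, some vector outside it is mapped into it by all of J,
    so the dimension grows by at least one.\<close>
  have grow: "F s = UNIV \<or> s \<le> dim (F s)" for s
  proof (induction s)
    case (Suc s)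
    show ?case
    proof (cases "F s = UNIV")
      case False
      have inv: "x *v v \<in> F s" if "x \<in> J" "v \<in> F s" for x v using inc that by (auto simp: FS)
      obtain v where v: "v \<notin> F s" "\<And>x. x \<in> J \<Longrightarrow> x *v v \<in> F s"
        using nil_algebra_fixed_vector[OF sJ mulJ nil sub False inv] by blast
      have "v \<in> F (Suc s)" using v(2) by (simp add: FS)
      then have "dim (F s) \<noteq> dim (F (Suc s))"
        using subspace_dim_equal[OF sub sub inc, of s] v(1) by force
      moreover have "dim (F s) \<le> dim (F (Suc s))" by (rule dim_subset[OF inc])
      ultimately show ?thesis using Suc False by auto
    qed (use inc in auto)
  qed simp
  have UN: "F CARD('n) = UNIV"
    using grow[of "CARD('n)"] dim_eq_full[of "F CARD('n)"] dim_subset_UNIV[of "F CARD('n)"]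
    by (auto simp: span_eq_iff[THEN iffD2, OF sub])
  show thesis
  proof (rule that[of F "CARD('n)"])
    show "F s = UNIV" if "CARD('n) \<le> s" for s using mono[OF that] UN by auto
    show "u *v v - v \<in> F s" if "u \<in> U" "v \<in> F (Suc s)" for s u v
    proof -
      have "u - mat 1 \<in> J" unfolding J_def using that by (intro span_base) auto
      then have "(u - mat 1) *v v \<in> F s" using that(2) by (simp add: FS)
      then show ?thesis by (simp add: matrix_vector_mult_diff_rdistrib)
    qed
  qed (fact F0 sub mono)+
qed

text \<open>F s consists of the matrices that lower the flag f by s - M steps. In Ad(u) X - X = (u -
  1) X u^-1 + X (u^-1 - 1) each summand lowers it by one step more.\<close>

lemma unipotent_conj_filtration:
  fixes U :: "(real^'n^'n) set"
  assumes U: "subgroup U GL" and unip: "\<And>u. u \<in> U \<Longrightarrow> unipotent u"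
  obtains F :: "nat \<Rightarrow> (real^'n^'n) set" and L where "F 0 = UNIV" "F L = {0}" "\<And>s. F (Suc s) \<subseteq> F s"
    "\<And>s u X. u \<in> U \<Longrightarrow> X \<in> F s \<Longrightarrow> conj_by u X - X \<in> F (Suc s)"
proof -
  have Ui: "invertible u" if "u \<in> U" for u using subgroup.mem_carrier[OF U that] by (simp add: GL_simps)
  have mult: "u ** v \<in> U" if "u \<in> U" "v \<in> U" for u v using subgroup.m_closed[OF U that] by (simp add: GL_simps)
  have inv: "matrix_inv u \<in> U" if "u \<in> U" for u using subgroup.m_inv_closed[OF U that] inv_GL[OF Ui[OF that]] by simp
  obtain f :: "nat \<Rightarrow> (real^'n) set" and M where f: "f 0 = {0}" "\<And>s. M \<le> s \<Longrightarrow> f s = UNIV"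
    "\<And>s. subspace (f s)" "\<And>s t. s \<le> t \<Longrightarrow> f s \<subseteq> f t" "\<And>s u v. u \<in> U \<Longrightarrow> v \<in> f (Suc s) \<Longrightarrow> u *v v - v \<in> f s"
    using unipotent_flag[OF mult unip] by blast
  have f': "u *v v - v \<in> f (s - 1)" if "u \<in> U" "v \<in> f s" for s u v
    using f(5)[OF that(1), of v "s - 1"] f(1) that(2) by (cases s) auto
  have finv: "u *v v \<in> f s" if "u \<in> U" "v \<in> f s" for s u v
  proof -
    have "u *v v - v \<in> f s" using f'[OF that] f(4)[of "s - 1" s] by auto
    from subspace_add[OF f(3) this that(2)] show ?thesis by simp
  qed
  \<comment> \<open>The shift by M lets the index start at 0: F 0 imposes no condition, and for s =
    2 M truncated subtraction yields f 0 = {0} as the target of f M, which is everything.\<close>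
  define F where "F s = {X. \<forall>i. \<forall>v\<in>f i. X *v v \<in> f (i + M - s)}" for s
  show thesis
  proof (rule that[of F "M + M"])
    show "F 0 = UNIV" by (simp add: F_def f(2))
    show "F (M + M) = {0}"
    proof
      show "F (M + M) \<subseteq> {0}"
      proof
        fix X assume X: "X \<in> F (M + M)"
        have "X *v v = 0" for v
        proof -
          have "v \<in> f M" using f(2) by simp
          then have "X *v v \<in> f (M + M - (M + M))" using X unfolding F_def by blast
          then show ?thesis using f(1) by simp
        qed
        then show "X \<in> {0}" by (simp add: matrix_eq)
      qed
      show "{0} \<subseteq> F (M + M)" using subspace_0[OF f(3)] by (simp add: F_def)
    qed
    show "F (Suc s) \<subseteq> F s" for s
      using f(4)[of "i + M - Suc s" "i + M - s" for i] unfolding F_def by fastforce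
    show "conj_by u X - X \<in> F (Suc s)" if u: "u \<in> U" and X: "X \<in> F s" for s u X
      unfolding F_def
    proof clarify
      fix i v assume v: "v \<in> f i"
      define w where "w = matrix_inv u *v v"
      have w: "w \<in> f i" unfolding w_def by (rule finv[OF inv[OF u] v])
      have "w - v \<in> f (i - 1)" unfolding w_def by (rule f'[OF inv[OF u] v])
      then have "X *v (w - v) \<in> f (i - 1 + M - s)" using X by (simp add: F_def)
      \<comment> \<open>For i = 0 the truncated i - 1 gains no step, but f 0 = {0} forces w =
        v.\<close>
      moreover have "i - 1 + M - s \<le> i + M - Suc s \<or> w - v = 0"
        using \<open>w - v \<in> f (i - 1)\<close> w v f(1) by (cases i) auto
      ultimately have 1: "X *v (w - v) \<in> f (i + M - Suc s)"
        using f(4) subspace_0[OF f(3)] by (metis matrix_vector_mult_0_right subsetD)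
      have "X *v w \<in> f (i + M - s)" using X w by (simp add: F_def)
      from f'[OF u this] have 2: "u *v (X *v w) - X *v w \<in> f (i + M - Suc s)" by simp
      have "(conj_by u X - X) *v v = (u *v (X *v w) - X *v w) + X *v (w - v)"
        by (simp add: conj_by_def w_def matrix_vector_mult_diff_rdistrib matrix_vector_mult_diff_distrib
            matrix_vector_mul_assoc matrix_mul_assoc)
      then show "(conj_by u X - X) *v v \<in> f (i + M - Suc s)" using subspace_add[OF f(3) 2 1] by simp
    qed
  qed
qed

section \<open>Unipotent groups normalise a conjugate of the nilradical\<close>

text \<open>Inverses of generators have no case of their own: the inverse of exp X is exp(-X), and S
  is a subspace.\<close>

lemma connected_lie_subgroup_induct [consumes 2, case_names one mexp mult]:
  assumes x: "x \<in> connected_lie_subgroup S" and S: "subspace S"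
    and one: "P (mat 1)" and mexp: "\<And>X. X \<in> S \<Longrightarrow> P (mexp X)"
    and mult: "\<And>x y. x \<in> connected_lie_subgroup S \<Longrightarrow> y \<in> connected_lie_subgroup S \<Longrightarrow> P x \<Longrightarrow> P y \<Longrightarrow> P (x ** y)"
  shows "P x"
  using x unfolding connected_lie_subgroup_def
proof (induction rule: generate.induct)
  case one
  then show ?case using assms(3) by (simp add: GL_simps)
next
  case (incl h)
  then show ?case using mexp by auto
next
  case (inv h)
  then obtain X where X: "X \<in> S" "h = mexp X" by auto
  then show ?case using mexp[of "- X"] subspace_neg[OF S] by (simp add: inv_GL)
next
  case (eng h1 h2)
  then show ?case using mult by (simp add: GL_simps connected_lie_subgroup_def)
qed

lemma subgroup_connected_lie_subgroup: "subgroup (connected_lie_subgroup S) GL"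
  unfolding connected_lie_subgroup_def
  by (rule group.generate_is_subgroup[OF group_GL]) (auto simp: GL_simps)

lemma mexp_connected_lie_subgroup: "X \<in> S \<Longrightarrow> mexp X \<in> connected_lie_subgroup S"
  unfolding connected_lie_subgroup_def by (rule generate.incl) simp

locale iwasawa_group = iwasawa G \<theta> \<a> \<Phi> for G :: "(real^'n^'n) set" and \<theta> \<a> \<Phi> +
  assumes decomposition: "G = K <#>\<^bsub>GL\<^esub> connected_lie_subgroup \<a> <#>\<^bsub>GL\<^esub> connected_lie_subgroup \<n>"
begin

abbreviation A where "A \<equiv> connected_lie_subgroup \<a>"
abbreviation N where "N \<equiv> connected_lie_subgroup \<n>"

lemma A_G: assumes "x \<in> A" shows "x \<in> G"
  using assms subspace_a by (induction rule: connected_lie_subgroup_induct) (auto intro: mexp_G a_g)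

lemma N_G: assumes "x \<in> N" shows "x \<in> G"
  using assms subspace_n by (induction rule: connected_lie_subgroup_induct) (auto intro: mexp_G n_g)

lemma A_exp: assumes "x \<in> A" shows "x \<in> mexp ` \<a>"
  using assms subspace_a
proof (induction rule: connected_lie_subgroup_induct)
  case one
  then show ?case using subspace_0[OF subspace_a] by (auto intro!: image_eqI[of _ _ 0])
next
  case (mult x y)
  then obtain X Y where XY: "X \<in> \<a>" "Y \<in> \<a>" "x = mexp X" "y = mexp Y" by blast
  have "X ** Y = Y ** X" using a_comm[OF XY(1,2)] by (simp add: bracket_def)
  then have "x ** y = mexp (X + Y)" by (simp add: XY mexp_add_commuting)
  then show ?case using subspace_add[OF subspace_a XY(1,2)] by blast
qed simp

lemma KAN:
  assumes "g \<in> G" obtains k a n where "k \<in> K" "a \<in> A" "n \<in> N" "g = k ** a ** n"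
  using assms by (subst (asm) decomposition) (auto simp: set_mult_def GL_simps)

text \<open>The cases \<a> and \<n> go through one induction: for a product x y and X in \<a>, the
  hypothesis for x is applied both to X and to Ad(y) X - X, which lies in \<n>.\<close>

lemma N_diff_n:
  assumes "x \<in> N" "X \<in> \<a> \<or> X \<in> \<n>" shows "conj_by x X - X \<in> \<n>"
  using assms(1) subspace_n assms(2)
proof (induction x arbitrary: X rule: connected_lie_subgroup_induct)
  case (mexp Z)
  have b: "bracket Z Y \<in> \<n>" if "Y \<in> \<a> \<or> Y \<in> \<n>" for Y
    using that
  proof
    assume "Y \<in> \<a>"
    then show ?thesis using subspace_neg[OF subspace_n bracket_a_n[OF _ mexp(1)]] bracket_swap[of Z Y] by simp
  qed (rule bracket_n_n[OF mexp(1)])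
  show ?case by (rule conj_by_mexp_diff_mem[OF subspace_n]) (use b mexp in auto)
next
  case (mult x y)
  have i: "invertible x" "invertible y" using mult N_G G_invertible by auto
  have yX: "conj_by y X - X \<in> \<n>" by (rule mult.IH(2)[OF mult.prems])
  have "conj_by x (conj_by y X - X) - (conj_by y X - X) \<in> \<n>" by (rule mult.IH(1)) (simp add: yX)
  from subspace_add[OF subspace_n this yX] have "conj_by x (conj_by y X - X) \<in> \<n>" by simp
  from subspace_add[OF subspace_n this mult.IH(1)[OF mult.prems]]
  show ?case by (simp add: conj_by_mult[OF i] linear_diff[OF linear_conj_by])
qed (simp add: subspace_0[OF subspace_n])

lemma A_fixes_a: "x \<in> A \<Longrightarrow> X \<in> \<a> \<Longrightarrow> conj_by x X = X"
  using A_exp[of x] conj_by_mexp_fixed a_comm by auto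

lemma A_n: "x \<in> A \<Longrightarrow> X \<in> \<n> \<Longrightarrow> conj_by x X \<in> \<n>"
  using A_exp[of x] conj_by_mexp_mem[OF subspace_n bracket_a_n] by auto

lemma N_n: "x \<in> N \<Longrightarrow> X \<in> \<n> \<Longrightarrow> conj_by x X \<in> \<n>"
  using N_diff_n[of x X] subspace_add[OF subspace_n, of "conj_by x X - X" X] by simp

lemma AN_n: "a \<in> A \<Longrightarrow> n \<in> N \<Longrightarrow> X \<in> \<n> \<Longrightarrow> conj_by (a ** n) X \<in> \<n>"
  using A_n N_n by (simp add: conj_by_mult A_G N_G G_invertible)

lemma AN_diff_n: "a \<in> A \<Longrightarrow> n \<in> N \<Longrightarrow> X \<in> \<a> \<Longrightarrow> conj_by (a ** n) X - X \<in> \<n>"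
  using A_n[of a "conj_by n X - X"] N_diff_n[of n X] A_fixes_a[of a X]
  by (simp add: conj_by_mult A_G N_G G_invertible linear_diff[OF linear_conj_by])

text \<open>The decomposition is applied to g^-1 = k a n. The form a n g in K serves to replace g by
  an element of K at the price of a factor that preserves \<n>.\<close>

lemma NA_K:
  assumes "g \<in> G" obtains a n k where "a \<in> A" "n \<in> N" "k \<in> K" "a ** n ** g = k" 
proof -
  obtain k a n where kan: "k \<in> K" "a \<in> A" "n \<in> N" "matrix_inv g = k ** a ** n" using KAN[OF inv_G[OF assms]] by blast
  have i: "invertible g" "invertible k" "invertible a" "invertible n"
    using assms kan K_G A_G N_G G_invertible by auto
  have "k ** (a ** n ** g) = matrix_inv g ** g" by (simp add: kan(4) matrix_mul_assoc)
  then have "k ** (a ** n ** g) = mat 1" by (simp add: matrix_inv_simps i)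
  then have "a ** n ** g = matrix_inv k" using inverse_matrix_unique(1) by metis
  then show thesis using that[OF kan(2,3) K_inv[OF kan(1)]] by simp
qed

end

text \<open>With D = T - 1 this is the binomial theorem for (1 + D)^j modulo W; the sum stops at d
  because D^(d+1) x lies in W.\<close>

lemma funpow_binomial_expansion_mod:
  fixes T :: "'a::real_vector \<Rightarrow> 'a"
  assumes T: "linear T" and W: "subspace W" "\<And>x. x \<in> W \<Longrightarrow> T x \<in> W"
    and nil: "((\<lambda>x. T x - x) ^^ Suc d) x \<in> W"
  shows "(T ^^ j) x - (\<Sum>i\<le>d. real (j choose i) *\<^sub>R ((\<lambda>x. T x - x) ^^ i) x) \<in> W"
proof (induction j)
  case 0
  have "(\<Sum>i\<le>d. real (0 choose i) *\<^sub>R ((\<lambda>x. T x - x) ^^ i) x) = x"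
    by (subst sum.remove[of _ 0]) (auto intro!: sum.neutral simp: binomial_eq_0)
  then show ?case using subspace_0[OF W(1)] by simp
next
  case (Suc j)
  define D where "D x = T x - x" for x
  define c where "c i = (D ^^ i) x" for i
  have cS: "T (c i) = c i + c (Suc i)" for i by (simp add: c_def D_def)
  have IH: "(T ^^ j) x - (\<Sum>i\<le>d. real (j choose i) *\<^sub>R c i) \<in> W" using Suc by (simp add: c_def D_def[abs_def])
  have e1: "T ((T ^^ j) x - (\<Sum>i\<le>d. real (j choose i) *\<^sub>R c i)) = (T ^^ Suc j) x - (\<Sum>i\<le>d. real (j choose i) *\<^sub>R (c i + c (Suc i)))"
    by (simp add: linear_diff[OF T] linear_sum[OF T] linear_scale[OF T] cS)
  \<comment> \<open>Pascal's rule; the last term of the shifted sum is left over and lies in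
    W.\<close>
  have e2: "(\<Sum>i\<le>d. real (j choose i) *\<^sub>R (c i + c (Suc i)))
      = (\<Sum>i\<le>d. real (Suc j choose i) *\<^sub>R c i) + real (j choose d) *\<^sub>R c (Suc d)"
    by (induction d) (simp_all add: algebra_simps)
  have "(T ^^ Suc j) x - (\<Sum>i\<le>d. real (Suc j choose i) *\<^sub>R c i) - real (j choose d) *\<^sub>R c (Suc d) \<in> W"
    using W(2)[OF IH] unfolding e1 e2 by (simp only: diff_diff_eq)
  moreover have "real (j choose d) *\<^sub>R c (Suc d) \<in> W"
    using nil by (intro subspace_scale W(1)) (simp add: c_def D_def[abs_def])
  ultimately show ?case using subspace_add[OF W(1)] by (fastforce simp: c_def D_def[abs_def])
qed

lemma binomial_ratio_tendsto_0:
  assumes "i < d" shows "(\<lambda>j. real (j choose i) / real (j choose d)) \<longlonglongrightarrow> 0"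
proof (rule Lim_null_comparison)
  \<comment> \<open>Since (j choose i) is at most j^i and (j choose d) at least (j/d)^d, the
    constant is d^d.\<close>
  show "(\<lambda>j. real d ^ d * inverse (real j)) \<longlonglongrightarrow> 0"
    by (intro tendsto_mult_right_zero lim_inverse_n)
  show "\<forall>\<^sub>F j in sequentially. norm (real (j choose i) / real (j choose d)) \<le> real d ^ d * inverse (real j)"
    using eventually_ge_at_top[of "max 1 d"]
  proof eventually_elim
    case (elim j)
    then have j: "1 \<le> j" "d \<le> j" by auto
    have d: "d > 0" using assms by simp
    have "(real j / real d) ^ d \<le> real (j choose d)"
      using binomial_ge_n_over_k_pow_k[OF j(2), where 'a = real] by simp
    then have lo: "real j ^ d \<le> real d ^ d * real (j choose d)"
      using d by (simp add: power_divide divide_le_eq mult.commute)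
    have "real (j choose i) * real j \<le> real j ^ i * real j"
      using binomial_le_pow[of i j] assms j by (intro mult_right_mono) (auto simp flip: of_nat_power)
    also have "\<dots> = real j ^ Suc i" by simp
    also have "\<dots> \<le> real j ^ d" using assms j by (intro power_increasing) auto
    finally have "real (j choose i) * real j \<le> real d ^ d * real (j choose d)" using lo by simp
    moreover have "0 < real (j choose d)" using j by simp
    ultimately show ?case using j by (simp add: field_simps)
  qed
qed

context iwasawa_group
begin

text \<open>A closed cone in a representation of a unipotent group contains a vector that is fixed: a
  limit of rescaled vectors \<open>u\<^sup>j X\<close> moves a vector strictly down the invariant filtration. This is
  applied, modulo a maximal invariant subspace inside some conjugate of \<open>\<n>\<close>, to the union of those
  conjugates.\<close>

lemma unipotent_normalizes_conjugate:
  assumes U: "subgroup U GL" "U \<subseteq> G" "\<And>u. u \<in> U \<Longrightarrow> unipotent u"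
  obtains k where "k \<in> K" "\<And>u X. u \<in> U \<Longrightarrow> X \<in> \<n> \<Longrightarrow> conj_by (conj_by k u) X \<in> \<n>"
proof -
  have Ui: "invertible u" if "u \<in> U" for u using U(2) that G_invertible by blast
  have Uinv: "matrix_inv u \<in> U" if "u \<in> U" for u using subgroup.m_inv_closed[OF U(1) that] inv_GL[OF Ui[OF that]] by simp
  obtain F :: "nat \<Rightarrow> (real^'n^'n) set" and L where F: "F 0 = UNIV" "F L = {0}" "\<And>s. F (Suc s) \<subseteq> F s"
    "\<And>s u X. u \<in> U \<Longrightarrow> X \<in> F s \<Longrightarrow> conj_by u X - X \<in> F (Suc s)"
    using unipotent_conj_filtration[OF U(1,3)] by blast
  have Fmono: "F t \<subseteq> F s" if "s \<le> t" for s t using lift_Suc_antimono_le[of F, OF F(3) that] by simp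
  \<comment> \<open>These are the invariant subspaces that fit into a conjugate of \<n>. One of
    maximal dimension will turn out to fill its conjugate.\<close>
  define good where "good W \<longleftrightarrow> subspace W \<and> (\<forall>u\<in>U. \<forall>X\<in>W. conj_by u X \<in> W) \<and> (\<exists>k\<in>K. \<forall>X\<in>W. conj_by k X \<in> \<n>)" for W
  have one_K: "mat 1 \<in> K" by (intro K_I) auto
  have "good {0}"
    unfolding good_def using one_K subspace_0[OF subspace_n] by (auto simp: linear_0[OF linear_conj_by])
  then obtain W where W: "good W" "\<And>W'. good W' \<Longrightarrow> dim W' \<le> dim W"
    using ex_has_greatest_nat[of good "{0}" dim "Suc DIM(real^'n^'n)"] dim_subset_UNIV by (metis less_Suc_eq_le)
  have sW: "subspace W" and UW: "\<And>u X. u \<in> U \<Longrightarrow> X \<in> W \<Longrightarrow> conj_by u X \<in> W" using W(1) by (auto simp: good_def)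
  obtain k where k: "k \<in> K" "\<And>X. X \<in> W \<Longrightarrow> conj_by k X \<in> \<n>" using W(1) by (auto simp: good_def)
  define C where "C = {X. \<exists>k\<in>K. (\<forall>Y\<in>W. conj_by k Y \<in> \<n>) \<and> conj_by k X \<in> \<n>}"
  have Cscale: "c *\<^sub>R X \<in> C" if "X \<in> C" for c X
    using that subspace_scale[OF subspace_n] by (auto simp: C_def linear_scale[OF linear_conj_by])
  have CW: "X + w \<in> C" if "X \<in> C" "w \<in> W" for X w
    using that subspace_add[OF subspace_n] by (auto simp: C_def linear_add[OF linear_conj_by])
  have CU: "conj_by u X \<in> C" if u: "u \<in> U" and X: "X \<in> C" for u X
  proof -
    obtain k where k: "k \<in> K" "\<And>Y. Y \<in> W \<Longrightarrow> conj_by k Y \<in> \<n>" "conj_by k X \<in> \<n>" using X by (auto simp: C_def)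
    have ug: "matrix_inv u \<in> G" using u U(2) by auto
    \<comment> \<open>l = a n k u^-1 satisfies Ad(l) Ad(u) = Ad(a n) Ad(k), and Ad(a n) preserves
      \<n>; so l is a witness for Ad(u) X.\<close>
    obtain a n l where l: "a \<in> A" "n \<in> N" "l \<in> K" "a ** n ** (k ** matrix_inv u) = l"
      using NA_K[OF mult_G[OF K_G[OF k(1)] ug]] by blast
    have i: "invertible k" "invertible u" "invertible (matrix_inv u)" "invertible (a ** n)" "invertible (k ** matrix_inv u)"
      using k l u U(2) ug by (auto intro!: G_invertible mult_G intro: K_G A_G N_G)
    have le: "conj_by l Z = conj_by (a ** n) (conj_by k (conj_by (matrix_inv u) Z))" for Z
      unfolding l(4)[symmetric] by (simp only: conj_by_mult i)
    have "conj_by l Y \<in> \<n>" if "Y \<in> W" for Y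
      unfolding le by (intro AN_n l(1,2) k(2) UW Uinv u that)
    moreover have "conj_by l (conj_by u X) \<in> \<n>"
      unfolding le by (intro AN_n l(1,2)) (simp add: i k(3))
    ultimately show ?thesis using l(3) by (auto simp: C_def)
  qed
  have Cclosed: "X \<in> C" if XC: "\<And>m. X' m \<in> C" and lim: "X' \<longlonglongrightarrow> X" for X' X
  proof -
    obtain h where h: "\<And>m. h m \<in> K" "\<And>m Y. Y \<in> W \<Longrightarrow> conj_by (h m) Y \<in> \<n>" "\<And>m. conj_by (h m) (X' m) \<in> \<n>"
      using XC unfolding C_def mem_Collect_eq by metis
    \<comment> \<open>Passing to a subsequence of the pairs makes the inverses converge as
      well.\<close>
    have "\<forall>m. (h m, matrix_inv (h m)) \<in> K \<times> K" using h(1) K_inv by simp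
    from seq_compactE[OF compact_imp_seq_compact[OF compact_Times[OF compact_K compact_K]] this]
    obtain l r where l: "l \<in> K \<times> K" "strict_mono r" "((\<lambda>m. (h m, matrix_inv (h m))) \<circ> r) \<longlonglongrightarrow> l" .
    have h1: "(\<lambda>m. h (r m)) \<longlonglongrightarrow> fst l" and h2: "(\<lambda>m. matrix_inv (h (r m))) \<longlonglongrightarrow> snd l"
      using tendsto_fst[OF l(3)] tendsto_snd[OF l(3)] by (simp_all add: o_def)
    have "(\<lambda>m. h (r m) ** matrix_inv (h (r m))) \<longlonglongrightarrow> fst l ** snd l" by (rule matmul.tendsto[OF h1 h2])
    then have "fst l ** snd l = mat 1"
      using matrix_inv_simps(1)[OF G_invertible[OF K_G[OF h(1)]]] by (simp add: LIMSEQ_const_iff)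
    then have inv: "matrix_inv (fst l) = snd l" by (rule inverse_matrix_unique)
    have cl: "closed \<n>" by (rule closed_subspace[OF subspace_n])
    have lc: "(\<lambda>m. conj_by (h (r m)) (Z m)) \<longlonglongrightarrow> conj_by (fst l) Z'" if "Z \<longlonglongrightarrow> Z'" for Z Z'
      unfolding conj_by_def inv by (intro matmul.tendsto h1 h2 that)
    have "conj_by (fst l) Y \<in> \<n>" if "Y \<in> W" for Y
      by (rule closed_sequentially[OF cl _ lc[OF tendsto_const]]) (rule h(2)[OF that])
    moreover have "conj_by (fst l) X \<in> \<n>"
      using closed_sequentially[OF cl _ lc[OF LIMSEQ_subseq_LIMSEQ[OF lim l(2)]]] h(3) by (simp add: o_def)
    moreover have "fst l \<in> K" using l(1) by auto
    ultimately show ?thesis by (auto simp: C_def)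
  qed
  have "C \<subseteq> W"
  proof (rule ccontr)
    assume nC: "\<not> C \<subseteq> W"
    have Z: "0 \<in> W" by (rule subspace_0[OF sW])
    have bound: "s < Suc L" if "\<not> C \<inter> F s \<subseteq> W" for s
    proof (rule ccontr)
      assume "\<not> s < Suc L"
      then have "F s \<subseteq> {0}" using Fmono[of L s] F(2) by auto
      then show False using that Z by blast
    qed
    \<comment> \<open>X will be taken as deep in the filtration as possible outside W; F L = {0}
      bounds the depth.\<close>
    obtain s where s: "\<not> C \<inter> F s \<subseteq> W" "\<And>t. \<not> C \<inter> F t \<subseteq> W \<Longrightarrow> t \<le> s"
      using ex_has_greatest_nat[of "\<lambda>s. \<not> C \<inter> F s \<subseteq> W" 0 "\<lambda>s. s" "Suc L"] nC F(1) bound by auto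
    obtain X where X: "X \<in> C" "X \<in> F s" "X \<notin> W" using s(1) by blast
    have fixed: "conj_by u X - X \<in> W" if u: "u \<in> U" for u
    proof (rule ccontr)
      assume nW: "conj_by u X - X \<notin> W"
      define D where "D = (\<lambda>Y. conj_by u Y - Y)"
      have DF: "(D ^^ d) X \<in> F (s + d)" for d
        by (induction d) (use X(2) F(4)[OF u] in \<open>auto simp: D_def\<close>)
      have "(D ^^ d) X \<notin> W \<Longrightarrow> d < Suc L" for d
        using DF[of d] Fmono[of L "s + d"] F(2) Z by (cases "L \<le> d") auto
      then obtain d where d: "(D ^^ d) X \<notin> W" "\<And>e. (D ^^ e) X \<notin> W \<Longrightarrow> e \<le> d"
        using ex_has_greatest_nat[of "\<lambda>d. (D ^^ d) X \<notin> W" 0 "\<lambda>d. d" "Suc L"] X(3) by auto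
      have d1: "1 \<le> d" using d(2)[of 1] nW by (simp add: D_def)
      have dS: "(D ^^ Suc d) X \<in> W" using d(2)[of "Suc d"] by auto
      define Y where "Y j = (\<Sum>i\<le>d. real (j choose i) *\<^sub>R (D ^^ i) X)" for j
      have YC: "Y j \<in> C" for j
      proof -
        have "(conj_by u ^^ j) X - Y j \<in> W"
          unfolding Y_def D_def
          by (rule funpow_binomial_expansion_mod[OF linear_conj_by sW UW[OF u] dS[unfolded D_def]])
        then have "- ((conj_by u ^^ j) X - Y j) \<in> W" by (rule subspace_neg[OF sW])
        moreover have "(conj_by u ^^ j) X \<in> C" by (induction j) (auto simp: X(1) CU u)
        ultimately show ?thesis using CW by fastforce
      qed
      \<comment> \<open>Division by the leading binomial coefficient leaves D^d X, where d is the
        last exponent for which this is outside W. It lies in C, and in F (s + d) with d >= 1,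
        against the choice of s.\<close>
      have "(\<lambda>j. (1 / real (j choose d)) *\<^sub>R Y j) \<longlonglongrightarrow> (D ^^ d) X"
      proof -
        have "(\<lambda>j. (\<Sum>i<d. (real (j choose i) / real (j choose d)) *\<^sub>R (D ^^ i) X)) \<longlonglongrightarrow> (\<Sum>i<d. 0 *\<^sub>R (D ^^ i) X)"
          by (intro tendsto_sum tendsto_scaleR binomial_ratio_tendsto_0 tendsto_const) simp
        then have "(\<lambda>j. (\<Sum>i<d. (real (j choose i) / real (j choose d)) *\<^sub>R (D ^^ i) X) + (D ^^ d) X) \<longlonglongrightarrow> 0 + (D ^^ d) X"
          by (intro tendsto_add tendsto_const) simp
        moreover have "\<forall>\<^sub>F j in sequentially. (\<Sum>i<d. (real (j choose i) / real (j choose d)) *\<^sub>R (D ^^ i) X) + (D ^^ d) X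
            = (1 / real (j choose d)) *\<^sub>R Y j"
          using eventually_ge_at_top[of d]
        proof eventually_elim
          case (elim j)
          then have "real (j choose d) \<noteq> 0" by simp
          then show ?case
            by (simp add: Y_def lessThan_Suc_atMost[symmetric] scaleR_right_distrib scaleR_sum_right)
        qed
        ultimately show ?thesis using Lim_transform_eventually by fastforce
      qed
      then have "(D ^^ d) X \<in> C" by (rule Cclosed[rotated]) (intro Cscale YC)
      then have "s + d \<le> s" using s(2)[of "s + d"] DF[of d] d(1) by blast
      then show False using d1 by simp
    qed
    obtain l where l: "l \<in> K" "\<And>Y. Y \<in> W \<Longrightarrow> conj_by l Y \<in> \<n>" "conj_by l X \<in> \<n>" using X(1) by (auto simp: C_def)
    define W' where "W' = span (insert X W)"
    have sW': "subspace W'" by (simp add: W'_def)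
    have lift: "W' \<subseteq> {Y. f Y \<in> T}" if "linear f" "subspace T" "f X \<in> T" "\<And>Y. Y \<in> W \<Longrightarrow> f Y \<in> T" for f :: "real^'n^'n \<Rightarrow> real^'n^'n" and T
      unfolding W'_def
    proof (rule span_minimal)
      show "subspace {Y. f Y \<in> T}" using linear_subspace_vimage[OF that(1,2)] by (simp add: vimage_def)
    qed (use that in auto)
    have WW': "insert X W \<subseteq> W'" unfolding W'_def by (rule span_superset)
    have "good W'"
      unfolding good_def
    proof (intro conjI bexI[of _ l] ballI)
      fix u Y assume u: "u \<in> U" and Y: "Y \<in> W'"
      have "conj_by u X = (conj_by u X - X) + X" by simp
      also have "\<dots> \<in> W'" using fixed[OF u] WW' by (intro subspace_add[OF sW']) auto
      finally show "conj_by u Y \<in> W'"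
        using lift[OF linear_conj_by sW', of u] UW[OF u] WW' Y by blast
    next
      fix Y assume "Y \<in> W'"
      then show "conj_by l Y \<in> \<n>" using lift[OF linear_conj_by subspace_n l(3)] l(2) by blast
    qed (fact sW' l(1))+
    then have "dim W' \<le> dim W" by (rule W(2))
    then have "W = W'" using WW' by (intro subspace_dim_equal sW sW') auto
    then show False using X(3) WW' by blast
  qed
  \<comment> \<open>The set Ad(k^-1) \<n> is part of C and so of W, which is U-invariant and mapped
    into \<n> by Ad(k).\<close>
  show thesis
  proof (rule that[OF k(1)])
    fix u X assume u: "u \<in> U" and X: "X \<in> \<n>"
    have i: "invertible k" "invertible u" using K_G[OF k(1)] u Ui G_invertible by auto
    define Y where "Y = conj_by (matrix_inv k) X"
    have "conj_by k Y \<in> \<n>" using X i by (simp add: Y_def)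
    then have "Y \<in> C" using k by (auto simp: C_def)
    then have "conj_by u Y \<in> W" using UW[OF u] \<open>C \<subseteq> W\<close> by blast
    then have "conj_by k (conj_by u Y) \<in> \<n>" by (rule k(2))
    moreover have "conj_by (conj_by k u) X = conj_by k (conj_by u Y)"
    proof -
      have "conj_by k u = k ** u ** matrix_inv k" by (simp add: conj_by_def)
      then show ?thesis using i by (simp add: conj_by_mult invertible_mult Y_def)
    qed
    ultimately show "conj_by (conj_by k u) X \<in> \<n>" by simp
  qed
qed

end

section \<open>Unipotent elements normalising the nilradical\<close>

text \<open>With v = u - 1, Ad(u) - 1 sends Z to v Z u^-1 - Z v u^-1. It raises by one the total
  exponent i + j of products v^i Y v^j, as u^-1 commutes with v; once i + j = 2 k, one of the outer
  factors is 0.\<close>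

lemma conj_by_minus_id_nilpotent:
  fixes u :: "real^'n^'n"
  assumes u: "invertible u" "unipotent u"
  obtains m where "\<And>X. ((\<lambda>X. conj_by u X - X) ^^ m) X = 0"
proof -
  obtain k where k: "matpow (u - mat 1) k = 0" using u(2) by (auto simp: unipotent_def)
  define v where "v = u - mat 1"
  define w where "w = matrix_inv u"
  have uv: "u = mat 1 + v" by (simp add: v_def)
  have uw: "u ** w = mat 1" "w ** u = mat 1" using u(1) by (simp_all add: w_def matrix_inv_simps)
  have vw: "v ** w = w ** v" by (simp add: v_def matrix_mult_simps uw)
  have vjw: "matpow v j ** w = w ** matpow v j" for j
  proof (induction j)
    case (Suc j)
    have "matpow v (Suc j) ** w = v ** (matpow v j ** w)" by (simp add: matpow_Suc matrix_mul_assoc)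
    also have "\<dots> = w ** matpow v (Suc j)" by (simp add: Suc matpow_Suc matrix_mul_assoc vw)
    finally show ?case .
  qed simp
  define S where "S m = span {matpow v i ** Y ** matpow v j | i Y j. i + j = m}" for m
  define D where "D = (\<lambda>X. conj_by u X - X)"
  have lD: "linear D" unfolding D_def by (rule linear_compose_sub[OF linear_conj_by linear_ident])
  have step: "D X \<in> S (Suc m)" if X: "X \<in> S m" for X m
  proof -
    have "S m \<subseteq> D -` S (Suc m)"
      unfolding S_def[of m]
    proof (rule span_minimal)
      show "subspace (D -` S (Suc m))" by (rule linear_subspace_vimage[OF lD]) (simp add: S_def)
      show "{matpow v i ** Y ** matpow v j | i Y j. i + j = m} \<subseteq> D -` S (Suc m)"
      proof clarify
        fix i Y j assume m: "m = i + j"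
        let ?Z = "matpow v i ** Y ** matpow v j"
        have "?Z = ?Z ** u ** w" by (simp add: uw matrix_mul_assoc[symmetric])
        then have "D ?Z = u ** ?Z ** w - ?Z ** u ** w" by (simp add: D_def conj_by_def w_def)
        also have "\<dots> = v ** ?Z ** w - ?Z ** v ** w" by (simp add: uv matrix_mult_simps)
        also have "v ** ?Z ** w = matpow v (Suc i) ** (Y ** w) ** matpow v j"
          by (simp add: matpow_Suc matrix_mul_assoc[symmetric] vjw)
        also have "?Z ** v ** w = matpow v i ** Y ** (matpow v (Suc j) ** w)"
          by (simp add: matpow_Suc2 matrix_mul_assoc)
        also have "\<dots> = matpow v i ** (Y ** w) ** matpow v (Suc j)"
          unfolding vjw by (simp add: matrix_mul_assoc)
        also have "matpow v (Suc i) ** (Y ** w) ** matpow v j - matpow v i ** (Y ** w) ** matpow v (Suc j) \<in> S (Suc m)"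
          unfolding S_def m
        proof (intro span_diff span_base)
          show "matpow v (Suc i) ** (Y ** w) ** matpow v j \<in> {matpow v i' ** Y' ** matpow v j' |i' Y' j'. i' + j' = Suc (i + j)}"
            by (intro CollectI exI[of _ "Suc i"] exI[of _ "Y ** w"] exI[of _ j]) simp
          show "matpow v i ** (Y ** w) ** matpow v (Suc j) \<in> {matpow v i' ** Y' ** matpow v j' |i' Y' j'. i' + j' = Suc (i + j)}"
            by (intro CollectI exI[of _ i] exI[of _ "Y ** w"] exI[of _ "Suc j"]) simp
        qed
        finally show "?Z \<in> D -` S (Suc (i + j))" by (simp add: m)
      qed
    qed
    then show ?thesis using X by blast
  qed
  have "(D ^^ m) X \<in> S m" for m X
  proof (induction m)
    case 0
    have "X \<in> {matpow v i ** Y ** matpow v j | i Y j. i + j = 0}"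
      by (intro CollectI exI[of _ 0] exI[of _ X]) simp
    then show ?case by (simp add: S_def span_base)
  qed (simp add: step)
  moreover have "S (k + k) \<subseteq> {0}"
    unfolding S_def
  proof (rule span_minimal)
    have z: "matpow v i = 0" if "k \<le> i" for i
      using k matpow_add[of v k "i - k"] that by (simp add: v_def)
    show "{matpow v i ** Y ** matpow v j | i Y j. i + j = k + k} \<subseteq> {0}"
    proof clarify
      fix i Y j assume "i + j = k + k"
      then have "k \<le> i \<or> k \<le> j" by linarith
      then show "matpow v i ** Y ** matpow v j = 0" using z by auto
    qed
  qed simp
  ultimately have "(D ^^ (k + k)) X = 0" for X by blast
  then show thesis using that[of "k + k"] by (simp add: D_def)
qed

lemma linear_inj_invariant_subspace:
  fixes f :: "'a::euclidean_space \<Rightarrow> 'a"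
  assumes "linear f" "inj f" "subspace S" "\<And>x. x \<in> S \<Longrightarrow> f x \<in> S" "y \<in> S"
  obtains x where "x \<in> S" "y = f x"
proof -
  have "dim (f ` S) = dim S" using assms(1,2) by (intro dim_image_eq) (auto intro: inj_on_subset)
  then have "f ` S = S"
    using assms by (intro subspace_dim_equal linear_subspace_image) auto
  then show thesis using assms(5) that by blast
qed

lemma inj_conj_by: "invertible g \<Longrightarrow> inj (conj_by g)"
  by (rule inj_on_inverseI[of _ "conj_by (matrix_inv g)"]) simp

lemma matpow_conj_by: "invertible g \<Longrightarrow> matpow (conj_by g x) k = conj_by g (matpow x k)"
  by (induction k) (simp_all add: matpow_Suc conj_by_mat_mult)

lemma matpow_conj_by_diff: "invertible g \<Longrightarrow> matpow (conj_by g x - mat 1) k = conj_by g (matpow (x - mat 1) k)"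
  using matpow_conj_by[of g "x - mat 1" k] by (simp add: linear_diff[OF linear_conj_by])

lemma unipotent_conj_by: "invertible g \<Longrightarrow> unipotent x \<Longrightarrow> unipotent (conj_by g x)"
  unfolding unipotent_def using matpow_conj_by_diff linear_0[OF linear_conj_by] by metis

lemma tendsto_matpow: "(f \<longlongrightarrow> l) F \<Longrightarrow> ((\<lambda>x. matpow (f x) k) \<longlongrightarrow> matpow l k) F"
  by (induction k) (simp_all add: matpow_Suc matmul.tendsto)

lemma trace_conj_by: "invertible g \<Longrightarrow> trace (conj_by g x) = trace x"
  unfolding conj_by_def using trace_mul_sym[of "g ** x" "matrix_inv g"]
  by (simp add: matrix_mul_assoc matrix_inv_simps)

context iwasawa_group
begin

text \<open>On the root space of \<alpha> the conjugation is multiplication by exp(-\<alpha>(H))^i,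
  which tends to 0; continuity of \<open>mexp\<close> and multiplicativity carry this from \<n> to
  the group it generates.\<close>

lemma N_contracted:
  assumes H: "H \<in> \<a>" "\<forall>\<alpha>\<in>\<Phi>. 0 < \<alpha> H" and x: "x \<in> N"
  shows "(\<lambda>i. conj_by (mexp ((- real i) *\<^sub>R H)) x) \<longlonglongrightarrow> mat 1"
proof -
  let ?c = "\<lambda>i. conj_by (mexp ((- real i) *\<^sub>R H))"
  have n: "(\<lambda>i. ?c i X) \<longlonglongrightarrow> 0" if X: "X \<in> \<n>" for X
  proof -
    have "\<n> \<subseteq> {X. (\<lambda>i. ?c i X) \<longlonglongrightarrow> 0}"
      unfolding \<n>_def
    proof (rule span_minimal)
      show "subspace {X. (\<lambda>i. ?c i X) \<longlonglongrightarrow> 0}"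
        unfolding subspace_def
        by (auto simp: linear_0[OF linear_conj_by] linear_add[OF linear_conj_by] linear_scale[OF linear_conj_by]
            intro: tendsto_add_zero tendsto_scaleR[OF tendsto_const, where b = 0, simplified])
      show "(\<Union>\<alpha>\<in>\<Phi>. root \<alpha>) \<subseteq> {X. (\<lambda>i. ?c i X) \<longlonglongrightarrow> 0}"
      proof clarify
        fix \<alpha> X assume \<alpha>: "\<alpha> \<in> \<Phi>" and X: "X \<in> root \<alpha>"
        have br: "bracket ((- real i) *\<^sub>R H) X = (real i * (- \<alpha> H)) *\<^sub>R X" for i
          unfolding bilinear_lmul[OF bilinear_bracket] root_bracket[OF X H(1)] by simp
        have c: "?c i X = exp (- \<alpha> H) ^ i *\<^sub>R X" for i
          using conj_by_mexp_eigenvector[OF br[of i]] by (simp only: exp_of_nat_mult)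
        have "(\<lambda>i. exp (- \<alpha> H) ^ i) \<longlonglongrightarrow> 0" using H(2) \<alpha> by (intro LIMSEQ_power_zero) simp
        from tendsto_scaleR[OF this tendsto_const[of X]]
        show "(\<lambda>i. ?c i X) \<longlonglongrightarrow> 0" by (simp only: c scaleR_zero_left)
      qed
    qed
    then show ?thesis using X by blast
  qed
  show ?thesis
    using x subspace_n
  proof (induction rule: connected_lie_subgroup_induct)
    case (mexp X)
    show ?case using tendsto_mexp[OF n[OF mexp]] by (simp only: mexp_conj_by invertible_mexp mexp_zero)
  next
    case (mult x y)
    show ?case using matmul.tendsto[OF mult.IH] by (simp add: conj_by_mat_mult)
  qed simp
qed

text \<open>The matrices contracted to 0 form an algebra on which the trace, being invariant under
  conjugation, vanishes. Such an algebra is nil, and it contains x - 1.\<close>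

lemma N_unipotent:
  assumes "x \<in> N" shows "unipotent x"
proof -
  obtain H where H: "H \<in> \<a>" "\<forall>\<alpha>\<in>\<Phi>. 0 < \<alpha> H"
    by (rule regular_element) (rule that, blast+)
  let ?c = "\<lambda>i. conj_by (mexp ((- real i) *\<^sub>R H))"
  define J where "J = {x. (\<lambda>i. ?c i x) \<longlonglongrightarrow> 0}"
  have sJ: "subspace J"
    unfolding subspace_def J_def
    by (auto simp: linear_0[OF linear_conj_by] linear_add[OF linear_conj_by] linear_scale[OF linear_conj_by]
        intro: tendsto_add_zero tendsto_scaleR[OF tendsto_const, where b = 0, simplified])
  have mJ: "x ** y \<in> J" if "x \<in> J" "y \<in> J" for x y
    using matmul.tendsto_zero[of "\<lambda>i. ?c i x" _ "\<lambda>i. ?c i y"] that by (simp add: J_def conj_by_mat_mult)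
  have tJ: "trace x = 0" if "x \<in> J" for x
  proof -
    have "(\<lambda>i. \<Sum>j\<in>UNIV. ?c i x $ j $ j) \<longlonglongrightarrow> (\<Sum>j\<in>UNIV. (0 :: real^'n^'n) $ j $ j)"
      using that by (intro tendsto_sum tendsto_vec_nth) (simp add: J_def)
    then have "(\<lambda>i. trace (?c i x)) \<longlonglongrightarrow> 0" by (simp add: trace_def)
    then show ?thesis by (simp add: trace_conj_by LIMSEQ_const_iff)
  qed
  have "(\<lambda>i. ?c i x - mat 1) \<longlonglongrightarrow> mat 1 - mat 1"
    by (intro tendsto_diff N_contracted[OF H assms] tendsto_const)
  then have "x - mat 1 \<in> J" by (simp add: J_def linear_diff[OF linear_conj_by])
  from nilpotent_of_trace_zero_algebra[OF sJ mJ tJ this] show ?thesis by (auto simp: unipotent_def)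
qed

text \<open>Each element is joined to 1 inside N by translates of one-parameter groups, built up
  along its factors.\<close>

lemma connected_N: "connected N"
proof -
  have *: "\<exists>T. connected T \<and> T \<subseteq> N \<and> mat 1 \<in> T \<and> x \<in> T" if "x \<in> N" for x
    using that subspace_n
  proof (induction rule: connected_lie_subgroup_induct)
    case one
    have "mat 1 \<in> N" using mexp_connected_lie_subgroup[OF subspace_0[OF subspace_n]] by simp
    then show ?case by (intro exI[of _ "{mat 1}"]) simp
  next
    case (mexp X)
    let ?T = "(\<lambda>t. mexp (t *\<^sub>R X)) ` (UNIV :: real set)"
    have "connected ?T"
      by (intro connected_continuous_image continuous_on_compose2[OF continuous_on_mexp[of UNIV]] continuous_intros) auto
    moreover have "?T \<subseteq> N" using mexp_connected_lie_subgroup subspace_scale[OF subspace_n mexp] by blast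
    moreover have "mat 1 \<in> ?T" by (rule image_eqI[of _ _ 0]) auto
    moreover have "mexp X \<in> ?T" by (rule image_eqI[of _ _ 1]) auto
    ultimately show ?case by blast
  next
    case (mult x y)
    obtain S T where S: "connected S" "S \<subseteq> N" "mat 1 \<in> S" "x \<in> S" and T: "connected T" "T \<subseteq> N" "mat 1 \<in> T" "y \<in> T"
      using mult.IH by blast
    let ?T = "(**) x ` T"
    have "connected ?T"
      using T(1) by (rule connected_continuous_image[rotated])
        (rule linear_continuous_on[OF matmul.bounded_linear_right])
    moreover have xT: "x \<in> ?T" using T(3) by (intro image_eqI[of _ _ "mat 1"]) auto
    ultimately have "connected (S \<union> ?T)" using S(1,4) by (intro connected_Un) auto
    moreover have "?T \<subseteq> N"
      using T(2) mult(1) subgroup.m_closed[OF subgroup_connected_lie_subgroup[of \<n>]] by (auto simp: GL_simps)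
    moreover have "x ** y \<in> ?T" using T(4) by simp
    ultimately show ?case using S(2,3) by (intro exI[of _ "S \<union> ?T"]) auto
  qed
  have "connected (\<Union>{T. connected T \<and> T \<subseteq> N \<and> mat 1 \<in> T})"
    by (rule connected_Union) auto
  moreover have "\<Union>{T. connected T \<and> T \<subseteq> N \<and> mat 1 \<in> T} = N" using * by auto
  ultimately show ?thesis by simp
qed

lemma unipotent_normalizer_subset_N:
  assumes u: "u \<in> G" "unipotent u" and nu: "\<And>X. X \<in> \<n> \<Longrightarrow> conj_by u X \<in> \<n>"
  shows "u \<in> N"
proof -
  obtain k a n where kan: "k \<in> K" "a \<in> A" "n \<in> N" "u = k ** a ** n" using KAN[OF u(1)] by blast
  have i: "invertible u" "invertible k" "invertible a" "invertible n" "invertible (a ** n)" "invertible (k ** a)"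
    using u(1) kan K_G A_G N_G by (auto intro!: G_invertible mult_G)
  have cu: "conj_by u X = conj_by k (conj_by (a ** n) X)" for X
    using conj_by_mult[OF i(2,5)] by (simp add: kan(4) matrix_mul_assoc)
  \<comment> \<open>Ad(a n) maps \<n> onto itself, so the subspace normalised by u is normalised by
    k.\<close>
  have kn: "conj_by k X \<in> \<n>" if X: "X \<in> \<n>" for X
  proof -
    obtain Y where "Y \<in> \<n>" "X = conj_by (a ** n) Y"
      using linear_inj_invariant_subspace[OF linear_conj_by inj_conj_by[OF i(5)] subspace_n AN_n[OF kan(2,3)] X] by blast
    then show ?thesis using nu[of Y] by (simp add: cu)
  qed
  have ka: "conj_by k H \<in> \<a>" if H: "H \<in> \<a>" for H
  proof (rule p_normalizer_n)
    show "conj_by k H \<in> \<p>" by (rule conj_by_K_p[OF kan(1) a_p[OF H]])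
    fix Y assume "Y \<in> \<n>"
    then obtain Z where Z: "Z \<in> \<n>" "Y = conj_by k Z"
      using linear_inj_invariant_subspace[OF linear_conj_by inj_conj_by[OF i(2)] subspace_n kn] by blast
    have "bracket (conj_by k H) Y = conj_by k (bracket H Z)" by (simp add: Z(2) conj_by_bracket i)
    then show "bracket (conj_by k H) Y \<in> \<n>" using kn bracket_a_n[OF H Z(1)] by simp
  qed
  define Du where "Du = (\<lambda>X. conj_by u X - X)"
  define Dk where "Dk = (\<lambda>X. conj_by k X - X)"
  have lDu: "linear Du" unfolding Du_def by (rule linear_compose_sub[OF linear_conj_by linear_ident])
  have Dka: "(Dk ^^ m) H \<in> \<a>" if "H \<in> \<a>" for m H
    by (induction m) (use that ka subspace_diff[OF subspace_a] in \<open>auto simp: Dk_def\<close>)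
  have Dun: "Du X \<in> \<n>" if "X \<in> \<n>" for X unfolding Du_def using nu[OF that] that by (intro subspace_diff subspace_n)
  \<comment> \<open>Modulo \<n>, Ad(u) and Ad(k) agree on \<a>, because Ad(a n) H - H lies in \<n>.
    Nilpotency of Ad(u) - 1 thus leaves (Ad(k) - 1)^m H in both \<a> and \<n>, so it is 0.\<close>
  have dif: "(Du ^^ m) H - (Dk ^^ m) H \<in> \<n>" if H: "H \<in> \<a>" for m H
  proof (induction m)
    case (Suc m)
    let ?h = "(Dk ^^ m) H" and ?e = "(Du ^^ m) H - (Dk ^^ m) H"
    have "Du ?h - Dk ?h = conj_by k (conj_by (a ** n) ?h - ?h)"
      by (simp add: Du_def Dk_def cu linear_diff[OF linear_conj_by])
    then have "Du ?h - Dk ?h \<in> \<n>" using kn AN_diff_n[OF kan(2,3) Dka[OF H]] by simp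
    from subspace_add[OF subspace_n Dun[OF Suc] this] show ?case
      by (simp add: linear_diff[OF lDu])
  qed (simp add: subspace_0[OF subspace_n])
  obtain m where m: "\<And>X. (Du ^^ m) X = 0" using conj_by_minus_id_nilpotent[OF i(1) u(2)] unfolding Du_def by blast
  have kfix: "conj_by k H = H" if H: "H \<in> \<a>" for H
  proof (rule orthogonal_unipotent_fixed[OF linear_conj_by ka subspace_a _ _ H])
    show "\<a> \<subseteq> \<g>" using a_g by blast
    show "ip (conj_by k x) (conj_by k y) = ip x y" if "x \<in> \<a>" "y \<in> \<a>" for x y
      by (intro ip_conj_by_K kan(1) a_g that)
    have "- (Dk ^^ m) H \<in> \<n>" using dif[OF H, of m] by (simp add: m)
    then have "(Dk ^^ m) H \<in> \<n>" using subspace_neg[OF subspace_n] by fastforce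
    then show "((\<lambda>y. conj_by k y - y) ^^ m) H = 0" using a_n_zero[OF Dka[OF H]] by (simp add: Dk_def)
  qed
  obtain H where H: "H \<in> \<a>" "\<forall>\<alpha>\<in>\<Phi>. 0 < \<alpha> H"
    by (rule regular_element) (rule that, blast+)
  define y where "y = k ** a"
  have yG: "y \<in> G" using kan(1,2) K_G A_G by (auto simp: y_def)
  let ?c = "\<lambda>i. conj_by (mexp ((- real i) *\<^sub>R H))"
  \<comment> \<open>Ad(k) and Ad(a) fix H, so y commutes with exp(-iH) and is untouched by the
    conjugation that contracts n to 1.\<close>
  have cy: "?c i y = y" for i
  proof -
    let ?T = "(- real i) *\<^sub>R H"
    have T: "?T \<in> \<a>" using H(1) subspace_scale[OF subspace_a] by blast
    have "conj_by k (mexp ?T) = mexp ?T" using mexp_conj_by[OF i(2), of ?T] kfix[OF T] by simp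
    moreover have "conj_by a (mexp ?T) = mexp ?T" using mexp_conj_by[OF i(3), of ?T] A_fixes_a[OF kan(2) T] by simp
    ultimately have "conj_by y (mexp ?T) = mexp ?T" by (simp add: y_def conj_by_mult i)
    then have "mexp ?T ** y = y ** mexp ?T" using conj_by_mult_self[OF i(6)[folded y_def], of "mexp ?T"] by simp
    then have "?c i y = y ** (mexp ?T ** mexp (- ?T))" unfolding conj_by_mexp_eq by (simp only: matrix_mul_assoc)
    then show ?thesis by (simp only: mexp_minus_right matrix_mul_rid)
  qed
  have lim: "(\<lambda>i. ?c i u) \<longlonglongrightarrow> y"
  proof -
    have "(\<lambda>i. ?c i y ** ?c i n) \<longlonglongrightarrow> y ** mat 1"
      unfolding cy by (intro matmul.tendsto tendsto_const N_contracted[OF H kan(3)])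
    then show ?thesis by (simp add: conj_by_mat_mult[symmetric] kan(4) y_def)
  qed
  obtain r where r: "matpow (u - mat 1) r = 0" using u(2) by (auto simp: unipotent_def)
  have "(\<lambda>i. matpow (?c i u - mat 1) r) \<longlonglongrightarrow> matpow (y - mat 1) r"
    by (intro tendsto_matpow tendsto_diff lim tendsto_const)
  then have "matpow (y - mat 1) r = 0"
    by (simp add: matpow_conj_by_diff r linear_0[OF linear_conj_by] LIMSEQ_const_iff)
  then have yu: "unipotent y" by (auto simp: unipotent_def)
  define Dy where "Dy = (\<lambda>X. conj_by y X - X)"
  obtain s where s: "\<And>X. (Dy ^^ s) X = 0"
    using conj_by_minus_id_nilpotent[OF i(6)[folded y_def] yu] unfolding Dy_def by blast
  obtain H' where H': "H' \<in> \<a>" "a = mexp H'" using A_exp[OF kan(2)] by blast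
  have adH': "bracket H' X = 0" if X: "X \<in> \<g>" for X
  proof (rule ccontr)
    assume "bracket H' X \<noteq> 0"
    then obtain z \<alpha> where z: "z \<noteq> 0" "z \<in> root \<alpha>" "\<alpha> H' \<noteq> 0"
      using exists_root_vector[OF subspace_g subset_refl bracket_g[OF a_g] H'(1) X] by metis
    define c where "c = exp (\<alpha> H')"
    have sr: "subspace (root \<alpha>)"
      using subspace_g unfolding subspace_def root_space_def
      by (auto simp: bilinear_radd[OF bilinear_bracket] bilinear_rmul[OF bilinear_bracket] scaleR_right_distrib)
    have kr: "conj_by k x \<in> root \<alpha>" if x: "x \<in> root \<alpha>" for x
    proof (rule root_I)
      show "conj_by k x \<in> \<g>" by (intro conj_by_g K_G kan(1) root_g[OF x])
      fix h assume h: "h \<in> \<a>"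
      have "bracket h (conj_by k x) = conj_by k (bracket h x)" by (simp add: conj_by_bracket i kfix[OF h])
      then show "bracket h (conj_by k x) = \<alpha> h *\<^sub>R conj_by k x"
        by (simp add: root_bracket[OF x h] linear_scale[OF linear_conj_by])
    qed
    have yr: "conj_by y x = c *\<^sub>R conj_by k x" if x: "x \<in> root \<alpha>" for x
      using conj_by_mexp_eigenvector[OF root_bracket[OF x H'(1)]]
      by (simp add: y_def conj_by_mult i H'(2)[symmetric] c_def linear_scale[OF linear_conj_by])
    have Dr: "(Dy ^^ d) z \<in> root \<alpha>" for d
      by (induction d) (use z(2) yr kr sr in \<open>auto simp: Dy_def intro!: subspace_diff subspace_scale\<close>)
    \<comment> \<open>The last nonzero iterate of the nilpotent Ad(y) - 1 on z is a fixed vector of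
      Ad(y) in the root space.\<close>
    obtain d where d: "(Dy ^^ d) z \<noteq> 0" "\<And>e. (Dy ^^ e) z \<noteq> 0 \<Longrightarrow> e \<le> d"
    proof -
      have "(Dy ^^ d) z \<noteq> 0 \<Longrightarrow> d < Suc s" for d
      proof (rule ccontr)
        assume "\<not> d < Suc s" and n: "(Dy ^^ d) z \<noteq> 0"
        then have "(Dy ^^ d) z = (Dy ^^ s) ((Dy ^^ (d - s)) z)"
          by (simp flip: funpow_add[unfolded fun_eq_iff o_def, rule_format])
        then show False using s n by simp
      qed
      then show thesis
        using ex_has_greatest_nat[of "\<lambda>d. (Dy ^^ d) z \<noteq> 0" 0 "\<lambda>d. d" "Suc s"] z(1) that by auto
    qed
    define w where "w = (Dy ^^ d) z"
    have w: "w \<in> root \<alpha>" "w \<noteq> 0" using Dr d(1) by (auto simp: w_def)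
    have "Dy w = 0" using d(2)[of "Suc d"] by (auto simp: w_def)
    \<comment> \<open>Ad(k) is isometric, so comparing norms gives c^2 = 1 for the positive number c
      = exp(\<alpha>(H')).\<close>
    then have "w = c *\<^sub>R conj_by k w" using yr[OF w(1)] by (simp add: Dy_def)
    then have "ip w w = ip (c *\<^sub>R conj_by k w) (c *\<^sub>R conj_by k w)" by simp
    also have "\<dots> = c * c * ip w w"
      by (simp add: ip_simps ip_conj_by_K kan(1) root_g[OF w(1)])
    finally have "c * c = 1" using ip_pos[OF root_g[OF w(1)] w(2)] by simp
    then have "exp (2 * \<alpha> H') = 1" by (simp add: c_def exp_add[symmetric])
    then show False using z(3) by simp
  qed
  have yk: "conj_by y X = conj_by k X" if X: "X \<in> \<g>" for X
    using conj_by_mexp_fixed[OF adH'[OF X]] by (simp add: y_def conj_by_mult i H'(2)[symmetric])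
  have "conj_by k X = X" if X: "X \<in> \<g>" for X
  proof (rule orthogonal_unipotent_fixed[OF linear_conj_by conj_by_g[OF K_G[OF kan(1)]] subspace_g subset_refl ip_conj_by_K[OF kan(1)] X])
    have "(Dk ^^ j) X = (Dy ^^ j) X \<and> (Dy ^^ j) X \<in> \<g>" for j
      by (induction j) (use X yk conj_by_g[OF yG] subspace_diff[OF subspace_g] in \<open>auto simp: Dk_def Dy_def\<close>)
    then have "(Dk ^^ s) X = 0" using s by simp
    then show "((\<lambda>y. conj_by k y - y) ^^ s) X = 0" by (simp add: Dk_def)
  qed
  then have "y = mat 1" using central_unipotent_trivial[OF yG yu] yk by simp
  then show ?thesis using kan(3,4) by (simp add: y_def)
qed

section \<open>Conjugacy of unipotent subgroups\<close>

lemma conj_into_N: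
  assumes U: "unipotent_subgroup U G" obtains g where "g \<in> G" "conj_by g ` U \<subseteq> N"
proof -
  have U': "subgroup U GL" "U \<subseteq> G" "\<And>u. u \<in> U \<Longrightarrow> unipotent u" using U by (auto simp: unipotent_subgroup_def)
  obtain k where k: "k \<in> K" "\<And>u X. u \<in> U \<Longrightarrow> X \<in> \<n> \<Longrightarrow> conj_by (conj_by k u) X \<in> \<n>"
    using unipotent_normalizes_conjugate[OF U'] by blast
  have kG: "k \<in> G" by (rule K_G[OF k(1)])
  have "conj_by k u \<in> N" if "u \<in> U" for u
    by (rule unipotent_normalizer_subset_N)
       (use that U' kG k(2) in \<open>auto intro: conj_by_G unipotent_conj_by G_invertible\<close>)
  then show thesis using that kG by blast
qed

lemma unipotent_subgroup_N: "unipotent_subgroup N G"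
  unfolding unipotent_subgroup_def
  using subgroup_connected_lie_subgroup N_G connected_N N_unipotent by blast

lemma unipotent_subgroup_conj:
  assumes U: "unipotent_subgroup U G" and g: "g \<in> G" shows "unipotent_subgroup (conj_by g ` U) G"
proof -
  have U': "subgroup U GL" "U \<subseteq> G" "connected U" "\<And>u. u \<in> U \<Longrightarrow> unipotent u" using U by (auto simp: unipotent_subgroup_def)
  have gi: "invertible g" by (rule G_invertible[OF g])
  have sub: "conj_by g ` U \<subseteq> G" using U'(2) conj_by_G[OF g] by blast
  have "subgroup (conj_by g ` U) GL"
  proof (rule group.subgroupI[OF group_GL])
    show "conj_by g ` U \<subseteq> carrier GL" using sub G_invertible by (auto simp: GL_simps)
    show "conj_by g ` U \<noteq> {}" using subgroup.one_closed[OF U'(1)] by blast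
    fix x assume "x \<in> conj_by g ` U"
    then obtain u where u: "u \<in> U" "x = conj_by g u" by blast
    have ui: "invertible u" using u(1) U'(2) G_invertible by blast
    have "x ** conj_by g (matrix_inv u) = mat 1"
      by (simp add: u(2) conj_by_mat_mult[OF gi, symmetric] matrix_inv_simps ui gi)
    then have "matrix_inv x = conj_by g (matrix_inv u)" "invertible x" by (rule inverse_matrix_unique)+
    moreover have "matrix_inv u \<in> U" using subgroup.m_inv_closed[OF U'(1) u(1)] by (simp add: inv_GL ui)
    ultimately show "inv\<^bsub>GL\<^esub> x \<in> conj_by g ` U" by (simp add: inv_GL)
    fix y assume "y \<in> conj_by g ` U"
    then obtain v where v: "v \<in> U" "y = conj_by g v" by blast
    have "u ** v \<in> U" using subgroup.m_closed[OF U'(1) u(1) v(1)] by (simp add: GL_simps)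
    then show "x \<otimes>\<^bsub>GL\<^esub> y \<in> conj_by g ` U"
      by (auto simp: GL_simps u(2) v(2) conj_by_mat_mult[OF gi, symmetric])
  qed
  moreover have "connected (conj_by g ` U)"
    by (rule connected_continuous_image[OF linear_continuous_on U'(3)])
       (rule linear_conv_bounded_linear[THEN iffD1, OF linear_conj_by])
  ultimately show ?thesis
    using sub U'(4) unipotent_conj_by[OF gi] by (auto simp: unipotent_subgroup_def)
qed

text \<open>The inclusion of g U g^-1 in N places U inside the unipotent subgroup g^-1 N g of G, and
  maximality of U makes them equal.\<close>

lemma maximal_conj_eq_N:
  assumes U: "maximal_unipotent_subgroup U G" obtains g where "g \<in> G" "conj_by g ` U = N"
proof -
  have U1: "unipotent_subgroup U G" and U2: "\<And>V. unipotent_subgroup V G \<Longrightarrow> U \<subseteq> V \<Longrightarrow> V = U"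
    using U by (auto simp: maximal_unipotent_subgroup_def)
  obtain g where g: "g \<in> G" "conj_by g ` U \<subseteq> N" using conj_into_N[OF U1] by blast
  have gi: "invertible g" by (rule G_invertible[OF g(1)])
  have "U \<subseteq> conj_by (matrix_inv g) ` N"
  proof
    fix u assume "u \<in> U"
    then have "conj_by g u \<in> N" using g(2) by blast
    then show "u \<in> conj_by (matrix_inv g) ` N" by (rule rev_image_eqI) (simp add: gi)
  qed
  then have "conj_by (matrix_inv g) ` N = U"
    by (rule U2[OF unipotent_subgroup_conj[OF unipotent_subgroup_N inv_G[OF g(1)]]])
  then have "conj_by g ` U = N" by (auto simp: gi image_image)
  then show thesis using that g(1) by blast
qed

lemma maximal_unipotent_conjugate:
  assumes "maximal_unipotent_subgroup U G" "maximal_unipotent_subgroup V G"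
  obtains g where "g \<in> G" "conj_by g ` U = V"
proof -
  obtain g where g: "g \<in> G" "conj_by g ` U = N" using maximal_conj_eq_N[OF assms(1)] by blast
  obtain h where h: "h \<in> G" "conj_by h ` V = N" using maximal_conj_eq_N[OF assms(2)] by blast
  have i: "invertible g" "invertible h" "invertible (matrix_inv h)" using g(1) h(1) by (auto intro: G_invertible inv_G)
  have "conj_by (matrix_inv h ** g) ` U = conj_by (matrix_inv h) ` conj_by g ` U"
    by (simp add: image_image conj_by_mult i)
  also have "\<dots> = conj_by (matrix_inv h) ` conj_by h ` V" by (simp add: g(2) h(2))
  also have "\<dots> = V" by (simp add: image_image i)
  finally show thesis using that[of "matrix_inv h ** g"] g(1) h(1) by auto
qed

end

theorem proposition1:
  fixes G K A N :: "(real^'n^'n) set"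
  assumes "connected_reductive_linear_group G"
    and "iwasawa_decomposition G K A N"
  shows "(\<forall>U. unipotent_subgroup U G \<longrightarrow> (\<exists>g\<in>G. conj_by g ` U \<subseteq> N)) \<and>
    (\<forall>U V. maximal_unipotent_subgroup U G \<and> maximal_unipotent_subgroup V G \<longrightarrow>
       (\<exists>g\<in>G. conj_by g ` U = V))"
proof -
  obtain \<theta> \<a> P where d: "cartan_involution G \<theta>" "K = fixed_group G \<theta>"
    "maximal_abelian_subspace \<a> (eigenspace_minus G \<theta>)"
    "positive_system (restricted_roots (lie_algebra G) \<a>) P"
    "A = connected_lie_subgroup \<a>"
    "N = connected_lie_subgroup (span (\<Union>\<alpha>\<in>P. root_space (lie_algebra G) \<a> \<alpha>))"
    "G = K <#>\<^bsub>GL\<^esub> A <#>\<^bsub>GL\<^esub> N"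
    using assms(2) unfolding iwasawa_decomposition_def by blast
  have G: "subgroup G GL" "closedin (top_of_set (carrier GL)) G" "connected G"
    "\<exists>P. invertible P \<and> (\<forall>h \<in> conj_by P ` G. transpose h \<in> conj_by P ` G)"
    using assms(1) unfolding connected_reductive_linear_group_def by blast+
  interpret I: iwasawa G \<theta> \<a> P
    by (intro iwasawa.intro iwasawa_axioms.intro cartan_group.intro cartan_group_axioms.intro
        closed_linear_group.intro G d(1,3,4))
  have N: "N = connected_lie_subgroup I.\<n>" unfolding d(6) I.\<n>_def ..
  interpret I: iwasawa_group G \<theta> \<a> P
    by unfold_locales (rule d(7)[unfolded d(2,5) N])
  show ?thesis
    unfolding N using I.conj_into_N I.maximal_unipotent_conjugate by metis
qed

end
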